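(* Write $\varphi=\varphi^{D_8}_{0,1}$. For all $a_1,a_2,a_3,a_4,a_5\in\mathbb{C}$ the following modular differential equation holds identically: $$\begin{aligned} &a_1\,H_6\circ H_4\circ H_2\circ H_0(\varphi)+a_2\,H_6\circ H_4(E_4\varphi)+a_3\,H_6(E_4H_0(\varphi))+a_4\,H_6(E_6\varphi)+a_5\,E_4\,H_2\circ H_0(\varphi)\\ &\quad+\frac{1}{27}\left(a_1+18a_2+9a_3-27a_4\right)E_6H_0(\varphi)-\frac{1}{162}\left(2a_1+36a_2+9a_3-81a_4+9a_5\right)E_4^2\varphi=0. \end{aligned}$$
   Context: $D_8=\{x\in\mathbb{Z}^8:\sum x_i\equiv0\bmod 2\}$ with the Euclidean inner product, dual lattice $D_8^\vee$; $\tau$ is in the upper half-plane, $q=e^{2\pi i\tau}$, $\mathfrak{z}=(z_1,\dots,z_8)\in D_8\otimes\mathbb{C}$ in standard coordinates, $\zeta_j=e^{2\pi i z_j}$, $\zeta^l=e^{2\pi i(\mathfrak{z},l)}$. A weak Jacobi form of weight $k$ and index $1$ for $D_8$ is a holomorphic function $\varphi(\tau,\mathfrak{z})$ with $\varphi\left(\frac{a\tau+b}{c\tau+d},\frac{\mathfrak{z}}{c\tau+d}\right)=(c\tau+d)^k e^{\pi i\frac{c(\mathfrak{z},\mathfrak{z})}{c\tau+d}}\varphi(\tau,\mathfrak{z})$ for all $\begin{pmatrix}a&b\\c&d\end{pmatrix}\in SL_2(\mathbb{Z})$, $\varphi(\tau,\mathfrak{z}+\lambda\tau+\mu)=e^{-2\pi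 i(\lambda,\mathfrak{z})-\pi i(\lambda,\lambda)\tau}\varphi(\tau,\mathfrak{z})$ for all $\lambda,\mu\in D_8$, and Fourier expansion $\sum_{n\ge0,\,l\in D_8^\vee}a(n,l)q^n\zeta^l$. For such $\varphi$ of weight $k$, the modular differential operator is $$H_k(\varphi)=\frac{1}{2\pi i}\frac{\partial\varphi}{\partial\tau}+\frac{1}{8\pi^2}\sum_{i=1}^8\frac{\partial^2\varphi}{\partial z_i^2}+(2k-8)G_2\varphi=\sum_{n,l}\left(n-\tfrac12(l,l)\right)a(n,l)q^n\zeta^l+(2k-8)G_2\varphi,$$ with $G_2(\tau)=-\frac1{24}+\sum_{n\ge1}\sigma_1(n)q^n$; it maps weight $k$ to weight $k+2$ and preserves the index. $E_4=1+240\sum_{n\ge1}\sigma_3(n)q^n$, $E_6=1-504\sum_{n\ge1}\sigma_5(n)q^n$. Let $\vartheta(\tau,z)=q^{1/8}\sum_{n\in\mathbb{Z}}(-1)^nq^{n(n+1)/2}e^{2\pi i(n+1/2)z}$, $\Theta_{D_8}(\tau,\mathfrak{z})=\prod_{i=1}^8\vartheta(\tau,z_i)$ and $(\Theta_{D_8}|T_-(2))(\tau,\mathfrak{z})=\frac12\left[16\,\Theta_{D_8}(2\tau,2\mathfrak{z})+\Theta_{D_8}(\tfrac{\tau}{2},\mathfrak{z})+\Theta_{D_8}(\tfrac{\tau+1}{2},\mathfrak{z})\right]$. Then $$\varphi^{D_8}_{0,1}=-\frac{\Theta_{D_8}|T_-(2)}{\Theta_{D_8}}=8+\sum_{j=1}^8(\zeta_j+\zeta_j^{-1})+q(\dots),$$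 an $O(D_8)$-invariant weak Jacobi form of weight $0$ and index $1$ for $D_8$. *)

theory Defs
  imports "HOL-Analysis.Analysis"
begin

text \<open>
  Functions on (upper half-plane) \<open>\<times>\<close> (D_8 \<open>\<otimes>\<close> C) are modelled as curried functions of
  type \<open>complex \<Rightarrow> complex^8 \<Rightarrow> complex\<close>; their values for \<open>Im \<tau> \<le> 0\<close> are irrelevant.
\<close>

definition nome :: "complex \<Rightarrow> complex" where
  "nome \<tau> = exp (2 * of_real pi * \<i> * \<tau>)"

text \<open>Divisor sums; only used for \<open>n \<ge> 1\<close>.\<close>
definition sigma :: "nat \<Rightarrow> nat \<Rightarrow> nat" where
  "sigma k n = (\<Sum>d | d dvd n. d ^ k)"

definition G2 :: "complex \<Rightarrow> complex" where
  "G2 \<tau> = - 1 / 24 + (\<Sum>n. of_nat (sigma 1 (Suc n)) * nome \<tau> ^ Suc n)"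

definition E4 :: "complex \<Rightarrow> complex" where
  "E4 \<tau> = 1 + 240 * (\<Sum>n. of_nat (sigma 3 (Suc n)) * nome \<tau> ^ Suc n)"

definition E6 :: "complex \<Rightarrow> complex" where
  "E6 \<tau> = 1 - 504 * (\<Sum>n. of_nat (sigma 5 (Suc n)) * nome \<tau> ^ Suc n)"

text \<open>Here \<open>q\<^bsup>1/8\<^esup>\<close> means \<open>exp (\<pi> \<i> \<tau> / 4)\<close>; the sum ranges over all integers.\<close>
definition jacobi_theta :: "complex \<Rightarrow> complex \<Rightarrow> complex" where
  "jacobi_theta \<tau> z = exp (of_real pi * \<i> * \<tau> / 4) *
     (\<Sum>\<^sub>\<infinity>n::int. (- 1) powi n * nome \<tau> powi (n * (n + 1) div 2) *
        exp (2 * of_real pi * \<i> * (of_int n + 1 / 2) * z))"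

definition Theta_D8 :: "complex \<Rightarrow> complex^8 \<Rightarrow> complex" where
  "Theta_D8 \<tau> z = (\<Prod>i\<in>UNIV. jacobi_theta \<tau> (z $ i))"

definition Theta_D8_T2 :: "complex \<Rightarrow> complex^8 \<Rightarrow> complex" where
  "Theta_D8_T2 \<tau> z =
     1 / 2 * (16 * Theta_D8 (2 * \<tau>) (2 *s z) + Theta_D8 (\<tau> / 2) z + Theta_D8 ((\<tau> + 1) / 2) z)"

text \<open>
  The weak Jacobi form \<open>\<phi>\<close> of weight 0 and index 1 for D_8. The quotient has only removable
  singularities along the zeros of \<open>Theta_D8\<close>; HOL would give it the value 0 there, so
  it is extended continuously from the complement of the zero set.
\<close>
definition phi_D8 :: "complex \<Rightarrow> complex^8 \<Rightarrow> complex" where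
  "phi_D8 \<tau> z =
     Lim (at (\<tau>, z) within {(t, w). Im t > 0 \<and> Theta_D8 t w \<noteq> 0})
       (\<lambda>(t, w). - (Theta_D8_T2 t w / Theta_D8 t w))"

definition partial2 :: "8 \<Rightarrow> (complex^8 \<Rightarrow> complex) \<Rightarrow> complex^8 \<Rightarrow> complex" where
  "partial2 i f z = (deriv ^^ 2) (\<lambda>w. f (\<chi> j. if j = i then w else z $ j)) (z $ i)"

definition H :: "int \<Rightarrow> (complex \<Rightarrow> complex^8 \<Rightarrow> complex) \<Rightarrow> complex \<Rightarrow> complex^8 \<Rightarrow> complex" where
  "H k f \<tau> z =
     1 / (2 * of_real pi * \<i>) * deriv (\<lambda>t. f t z) \<tau>
     + 1 / (8 * of_real pi ^ 2) * (\<Sum>i\<in>UNIV. partial2 i (f \<tau>) z)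
     + (2 * of_int k - 8) * G2 \<tau> * f \<tau> z"

end

theory Submission
  imports Defs "HOL-Complex_Analysis.Complex_Analysis" "HOL-Real_Asymp.Real_Asymp"
begin

text \<open>
  Write \<open>D = (1 / 2 \<pi> \<i>) d/d\<tau>\<close>, and let \<open>\<theta>\<^sub>2, \<theta>\<^sub>3, \<theta>\<^sub>4\<close> be the even Jacobi theta functions
  and \<open>\<theta>\<^sub>1\<close> the odd one, which is \<open>jacobi_theta\<close> up to a constant factor.

  The form \<open>\<phi>\<close> is a combination, with coefficients depending on \<open>\<tau>\<close> alone, of the three products
  \<open>P\<^sub>i(\<tau>, z) = \<theta>\<^sub>i(\<tau>, z\<^sub>1) \<dots> \<theta>\<^sub>i(\<tau>, z\<^sub>8)\<close>, \<open>i = 2, 3, 4\<close>: the duplication formulas express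
  \<open>\<theta>\<^sub>1(2\<tau>, 2z)\<close>, \<open>\<theta>\<^sub>1(\<tau>/2, z)\<close> and \<open>\<theta>\<^sub>1((\<tau>+1)/2, z)\<close> as multiples of \<open>\<theta>\<^sub>1 \<theta>\<^sub>2\<close>, \<open>\<theta>\<^sub>1 \<theta>\<^sub>4\<close> and
  \<open>\<theta>\<^sub>1 \<theta>\<^sub>3\<close>, so that \<open>\<Theta>\<close> divides each of the three terms of \<open>\<Theta>|T\<^sub>-(2)\<close> (lemma \<open>phi_D8_eq\<close>).

  Each \<open>\<theta>\<^sub>i\<close> satisfies the heat equation. Hence the differential part of \<open>H\<^sub>k\<close> kills the \<open>P\<^sub>i\<close>, and
  \<open>H\<^sub>k\<close> acts on the coefficients of a combination by \<open>D + (2k - 8) G\<^sub>2\<close> (lemma \<open>H_theta_comb\<close>). The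
  claim is thereby an identity between functions of \<open>\<tau>\<close>.

  Let \<open>d\<^sub>i\<close> be the logarithmic derivative \<open>D \<theta>\<^sub>i(\<tau>, 0) / \<theta>\<^sub>i(\<tau>, 0)\<close> and \<open>s = d\<^sub>2 + d\<^sub>3 + d\<^sub>4\<close>. Two facts
  determine everything. First, Halphen's system \<open>D (d\<^sub>i + d\<^sub>j) = 4 d\<^sub>i d\<^sub>j\<close>: it is one Taylor
  coefficient of the formula that writes \<open>\<theta>\<^sub>i(\<tau>, x) \<theta>\<^sub>j(\<tau>, y)\<close> through theta functions of \<open>2\<tau>\<close> at
  \<open>x + y\<close> and \<open>x - y\<close>, once the heat equation has turned derivatives in \<open>z\<close> into derivatives in \<open>\<tau>\<close>
  (lemma \<open>halphen\<close>). Second, \<open>G\<^sub>2\<close>, \<open>E\<^sub>4\<close> and \<open>E\<^sub>6\<close> are polynomials in the \<open>d\<^sub>i\<close> (lemma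
  \<open>eisenstein_dlog\<close>). By the Jacobi triple product, \<open>\<theta>\<^sub>1 = C(\<tau>) sin(\<pi>z) exp(- \<Lambda>(z))\<close> where the Taylor
  coefficients of \<open>\<Lambda>\<close> are the divisor sum series, so the Eisenstein series are polynomials in the
  Taylor coefficients of \<open>\<theta>\<^sub>1 / \<theta>\<^sub>1'(0)\<close> at \<open>z = 0\<close>. By the heat equation the Taylor coefficients of \<open>\<theta>\<^sub>1\<close>
  are multiples of the \<open>D\<close>-derivatives of \<open>\<theta>\<^sub>1'(0)\<close>, whose logarithmic derivative is \<open>s\<close>.

  Ramanujan's formulas for \<open>D E\<^sub>4\<close> and \<open>D E\<^sub>6\<close> follow, and so does \<open>H\<^sub>2 (H\<^sub>0 \<phi>) = E\<^sub>4 \<phi> / 18\<close>. From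
  these the coefficient of each \<open>a\<^sub>j\<close> in the equation vanishes separately.
\<close>

section \<open>Theta series with characteristics\<close>

text \<open>
  A locally uniform majorant suffices: by Cauchy's estimates, which are hidden in the theorem on
  uniform limits, the series of derivatives converges on its own.
\<close>
lemma has_field_derivative_infsum:
  fixes f :: "'i \<Rightarrow> complex \<Rightarrow> complex"
  assumes r: "r > 0"
    and bound: "\<And>i w. i \<in> A \<Longrightarrow> w \<in> cball z r \<Longrightarrow> norm (f i w) \<le> M i"
    and M: "M summable_on A"
    and deriv: "\<And>i w. i \<in> A \<Longrightarrow> w \<in> cball z r \<Longrightarrow> (f i has_field_derivative f' i w) (at w)"
  shows "((\<lambda>w. \<Sum>\<^sub>\<infinity>i\<in>A. f i w) has_field_derivative (\<Sum>\<^sub>\<infinity>i\<in>A. f' i z)) (at z)"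
proof -
  let ?F = "finite_subsets_at_top A"
  have ulim: "uniform_limit (cball z r) (\<lambda>X w. \<Sum>i\<in>X. f i w) (\<lambda>w. \<Sum>\<^sub>\<infinity>i\<in>A. f i w) ?F"
    using bound M by (rule Weierstrass_m_test_general)
  have "eventually (\<lambda>X. finite X \<and> X \<subseteq> A) ?F"
    by (simp add: eventually_finite_subsets_at_top_weakI)
  hence ev: "eventually (\<lambda>X. continuous_on (cball z r) (\<lambda>w. \<Sum>i\<in>X. f i w) \<and>
      (\<forall>w\<in>ball z r. ((\<lambda>w. \<Sum>i\<in>X. f i w) has_field_derivative (\<Sum>i\<in>X. f' i w)) (at w))) ?F"
  proof eventually_elim
    case (elim X)
    have "((\<lambda>w. \<Sum>i\<in>X. f i w) has_field_derivative (\<Sum>i\<in>X. f' i w)) (at w)" if "w \<in> cball z r" for w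
      using elim that deriv by (intro DERIV_sum) auto
    thus ?case
      by (meson ball_subset_cball continuous_at_imp_continuous_on DERIV_isCont subset_iff)
  qed
  obtain g' where g': "\<And>w. w \<in> ball z r \<Longrightarrow>
      ((\<lambda>w. \<Sum>\<^sub>\<infinity>i\<in>A. f i w) has_field_derivative g' w) (at w) \<and>
      ((\<lambda>X. \<Sum>i\<in>X. f' i w) \<longlongrightarrow> g' w) ?F"
    using has_complex_derivative_uniform_limit[OF ev ulim _ r] by auto
  have "((\<lambda>i. f' i z) has_sum g' z) A"
    using g'[of z] r by (simp add: has_sum_def)
  thus ?thesis
    using g'[of z] r by (auto simp: infsumI)
qed

definition theta_term :: "real \<Rightarrow> complex \<Rightarrow> complex \<Rightarrow> complex" where
  "theta_term x \<tau> z = exp (of_real pi * \<i> * of_real x ^ 2 * \<tau> + 2 * of_real pi * \<i> * of_real x * z)"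

text \<open>
  The \<open>j\<close>-th moment of a theta series with characteristic \<open>\<alpha>\<close>. For \<open>j = 0\<close> and \<open>\<alpha> = 0\<close> or \<open>1/2\<close>,
  evaluated at \<open>z\<close> or \<open>z + 1/2\<close>, it gives the four Jacobi theta functions, the odd one being
  \<open>theta 0 (1/2) \<tau> (z + 1/2)\<close>. Up to powers of \<open>2 \<pi> \<i>\<close> the moments are the derivatives in \<open>z\<close>, and
  differentiation in \<open>\<tau>\<close> raises \<open>j\<close> by two: this is the heat equation.
\<close>
definition theta :: "nat \<Rightarrow> real \<Rightarrow> complex \<Rightarrow> complex \<Rightarrow> complex" where
  "theta j \<alpha> \<tau> z = (\<Sum>\<^sub>\<infinity>n::int. of_real (of_int n + \<alpha>) ^ j * theta_term (of_int n + \<alpha>) \<tau> z)"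

lemma norm_theta_term: "norm (theta_term x \<tau> z) = exp (- (pi * Im \<tau> * x\<^sup>2) - 2 * pi * Im z * x)"
  unfolding theta_term_def norm_exp_eq_Re by (simp add: power2_eq_square)

lemma summable_on_exp_neg_abs_int: "(\<lambda>n::int. exp (- \<bar>real_of_int n\<bar>)) summable_on UNIV"
proof -
  have s: "(\<lambda>n::nat. exp (- real n)) summable_on UNIV"
  proof -
    have "summable (\<lambda>n. exp (-1) ^ n :: real)" by (rule summable_geometric) simp
    also have "(\<lambda>n. exp (-1) ^ n :: real) = (\<lambda>n. exp (- real n))"
      by (simp add: exp_of_nat_mult[symmetric])
    finally show ?thesis by (intro summable_nonneg_imp_summable_on) auto
  qed
  have 1: "(\<lambda>n::int. exp (- \<bar>real_of_int n\<bar>)) summable_on range int"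
    by (subst summable_on_reindex) (use s in \<open>auto simp: o_def\<close>)
  have 2: "(\<lambda>n::int. exp (- \<bar>real_of_int n\<bar>)) summable_on range (\<lambda>n. - int n)"
    by (subst summable_on_reindex) (use s in \<open>auto simp: o_def inj_def\<close>)
  have "UNIV = range int \<union> range (\<lambda>n. - int n)"
    by (auto simp: image_iff) (metis int_cases2)
  thus ?thesis using summable_on_union[OF 1 2] by simp
qed

text \<open>
  The common majorant of the theta series and all their derivatives on a region where \<open>Im \<tau>\<close> is
  bounded below and \<open>\<bar>Im z\<bar>\<close> is bounded.
\<close>
lemma summable_on_gauss_int:
  assumes "a > (0::real)"
  shows "(\<lambda>n::int. \<bar>of_int n + \<alpha>\<bar> ^ j * exp (- (a * (of_int n + \<alpha>)\<^sup>2) + b * \<bar>of_int n + \<alpha>\<bar>))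
           summable_on UNIV"
proof -
  \<comment> \<open>The additional \<open>+ 1\<close> leaves a factor \<open>exp (- x)\<close>, which is summable.\<close>
  let ?g = "\<lambda>x::real. x ^ j * exp (- (a * x\<^sup>2) + (b + 1) * x)"
  have lim: "(?g \<longlongrightarrow> 0) at_top"
    using assms by real_asymp
  hence "eventually (\<lambda>x. dist (?g x) 0 < 1) at_top"
    by (rule tendstoD) simp
  then obtain X where X: "\<And>x. x \<ge> X \<Longrightarrow> \<bar>?g x\<bar> < 1"
    unfolding eventually_at_top_linorder dist_real_def by (metis diff_zero)
  have "compact (?g ` {0..X})"
    by (intro compact_continuous_image continuous_intros) auto
  then obtain C0 where C0: "\<And>x. x \<in> {0..X} \<Longrightarrow> \<bar>?g x\<bar> \<le> C0"
    using compact_imp_bounded bounded_iff by (metis (no_types, lifting) imageI real_norm_def)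
  define C where "C = max 1 C0"
  have C: "?g x \<le> C" if "x \<ge> 0" for x
    using X[of x] C0[of x] that unfolding C_def by fastforce
  have le: "norm (\<bar>of_int n + \<alpha>\<bar> ^ j * exp (- (a * (of_int n + \<alpha>)\<^sup>2) + b * \<bar>of_int n + \<alpha>\<bar>))
     \<le> C * exp \<bar>\<alpha>\<bar> * exp (- \<bar>real_of_int n\<bar>)" for n :: int
  proof -
    define x where "x = \<bar>of_int n + \<alpha>\<bar>"
    have x0: "x \<ge> 0" by (simp add: x_def)
    have "norm (\<bar>of_int n + \<alpha>\<bar> ^ j * exp (- (a * (of_int n + \<alpha>)\<^sup>2) + b * \<bar>of_int n + \<alpha>\<bar>))
        = ?g x * exp (- x)"
      by (simp add: x_def mult_exp_exp abs_mult power_abs algebra_simps)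
    also have "\<dots> \<le> C * exp (-x)"
      using C[OF x0] by (intro mult_right_mono) auto
    also have "\<dots> \<le> C * (exp \<bar>\<alpha>\<bar> * exp (- \<bar>real_of_int n\<bar>))"
      by (intro mult_left_mono) (auto simp: mult_exp_exp x_def C_def)
    finally show ?thesis by (simp add: mult_ac)
  qed
  have "(\<lambda>n::int. C * exp \<bar>\<alpha>\<bar> * exp (- \<bar>real_of_int n\<bar>)) summable_on UNIV"
    by (intro summable_on_cmult_right summable_on_exp_neg_abs_int)
  from Infinite_Sum.abs_summable_on_comparison_test'[OF this le] show ?thesis by simp
qed

lemma norm_theta_term_le:
  assumes "a \<le> Im \<tau>" "\<bar>Im z\<bar> \<le> B"
  shows "norm (of_real x ^ j * theta_term x \<tau> z) \<le> \<bar>x\<bar> ^ j * exp (- (pi * a * x\<^sup>2) + 2 * pi * B * \<bar>x\<bar>)"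
proof -
  have "- (Im z * x) \<le> B * \<bar>x\<bar>"
    using mult_right_mono[OF assms(2), of "\<bar>x\<bar>"] by (simp flip: abs_mult)
  hence "2 * pi * - (Im z * x) \<le> 2 * pi * (B * \<bar>x\<bar>)" by (intro mult_left_mono) auto
  moreover have "pi * a * x\<^sup>2 \<le> pi * Im \<tau> * x\<^sup>2"
    using assms by (intro mult_right_mono mult_left_mono) auto
  moreover have "2 * pi * - (Im z * x) = - (2 * pi * Im z * x)" "2 * pi * (B * \<bar>x\<bar>) = 2 * pi * B * \<bar>x\<bar>"
    by simp_all
  ultimately have "- (pi * Im \<tau> * x\<^sup>2) - 2 * pi * Im z * x \<le> - (pi * a * x\<^sup>2) + 2 * pi * B * \<bar>x\<bar>"
    by argo
  thus ?thesis
    by (simp add: norm_mult norm_power norm_theta_term mult_left_mono)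
qed

lemma theta_term_abs_summable:
  assumes "Im \<tau> > 0"
  shows "(\<lambda>n::int. norm (of_real (of_int n + \<alpha>) ^ j * theta_term (of_int n + \<alpha>) \<tau> z)) summable_on UNIV"
proof (rule Infinite_Sum.abs_summable_on_comparison_test')
  show "(\<lambda>n::int. \<bar>of_int n + \<alpha>\<bar> ^ j * exp (- (pi * Im \<tau> * (of_int n + \<alpha>)\<^sup>2) + 2 * pi * \<bar>Im z\<bar> * \<bar>of_int n + \<alpha>\<bar>)) summable_on UNIV"
    using assms by (intro summable_on_gauss_int) auto
qed (rule norm_theta_term_le[OF order.refl order.refl])

lemma theta_term_summable:
  assumes "Im \<tau> > 0"
  shows "(\<lambda>n::int. of_real (of_int n + \<alpha>) ^ j * theta_term (of_int n + \<alpha>) \<tau> z) summable_on UNIV"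
  using theta_term_abs_summable[OF assms] by (rule abs_summable_summable)

lemma theta_deriv_z:
  assumes "Im \<tau> > 0"
  shows "((\<lambda>z. theta j \<alpha> \<tau> z) has_field_derivative 2 * of_real pi * \<i> * theta (Suc j) \<alpha> \<tau> z) (at z)"
proof -
  have "((\<lambda>z. theta j \<alpha> \<tau> z) has_field_derivative
     (\<Sum>\<^sub>\<infinity>n. 2 * of_real pi * \<i> * (of_real (of_int n + \<alpha>) ^ Suc j * theta_term (of_int n + \<alpha>) \<tau> z))) (at z)"
    unfolding theta_def
  proof (rule has_field_derivative_infsum[where r = 1])
    fix n :: int and w assume "w \<in> cball z 1"
    hence "\<bar>Im w - Im z\<bar> \<le> 1"
      using abs_Im_le_cmod[of "w - z"] by (simp add: dist_norm norm_minus_commute)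
    hence "\<bar>Im w\<bar> \<le> \<bar>Im z\<bar> + 1" by linarith
    from norm_theta_term_le[OF order.refl this]
    show "norm (of_real (of_int n + \<alpha>) ^ j * theta_term (of_int n + \<alpha>) \<tau> w) \<le>
      \<bar>of_int n + \<alpha>\<bar> ^ j * exp (- (pi * Im \<tau> * (of_int n + \<alpha>)\<^sup>2) + 2 * pi * (\<bar>Im z\<bar> + 1) * \<bar>of_int n + \<alpha>\<bar>)" .
  next
    show "(\<lambda>n::int. \<bar>of_int n + \<alpha>\<bar> ^ j * exp (- (pi * Im \<tau> * (of_int n + \<alpha>)\<^sup>2) + 2 * pi * (\<bar>Im z\<bar> + 1) * \<bar>of_int n + \<alpha>\<bar>)) summable_on UNIV"
      using assms by (intro summable_on_gauss_int) auto
  qed (auto simp: theta_term_def intro!: derivative_eq_intros)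
  thus ?thesis
    by (subst (asm) infsum_cmult_right') (simp add: theta_def[abs_def])
qed

lemma theta_deriv_tau:
  assumes "Im \<tau> > 0"
  shows "((\<lambda>\<tau>. theta j \<alpha> \<tau> z) has_field_derivative of_real pi * \<i> * theta (j + 2) \<alpha> \<tau> z) (at \<tau>)"
proof -
  have "((\<lambda>\<tau>. theta j \<alpha> \<tau> z) has_field_derivative
     (\<Sum>\<^sub>\<infinity>n. of_real pi * \<i> * (of_real (of_int n + \<alpha>) ^ (j + 2) * theta_term (of_int n + \<alpha>) \<tau> z))) (at \<tau>)"
    unfolding theta_def
  proof (rule has_field_derivative_infsum[where r = "Im \<tau> / 2"])
    fix n :: int and w assume "w \<in> cball \<tau> (Im \<tau> / 2)"
    hence "\<bar>Im w - Im \<tau>\<bar> \<le> Im \<tau> / 2"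
      using abs_Im_le_cmod[of "w - \<tau>"] by (simp add: dist_norm norm_minus_commute)
    hence "Im \<tau> / 2 \<le> Im w" by linarith
    from norm_theta_term_le[OF this order.refl]
    show "norm (of_real (of_int n + \<alpha>) ^ j * theta_term (of_int n + \<alpha>) w z) \<le>
      \<bar>of_int n + \<alpha>\<bar> ^ j * exp (- (pi * (Im \<tau> / 2) * (of_int n + \<alpha>)\<^sup>2) + 2 * pi * \<bar>Im z\<bar> * \<bar>of_int n + \<alpha>\<bar>)" .
  next
    show "(\<lambda>n::int. \<bar>of_int n + \<alpha>\<bar> ^ j * exp (- (pi * (Im \<tau> / 2) * (of_int n + \<alpha>)\<^sup>2) + 2 * pi * \<bar>Im z\<bar> * \<bar>of_int n + \<alpha>\<bar>)) summable_on UNIV"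
      using assms by (intro summable_on_gauss_int) auto
  qed (use assms in \<open>auto simp: theta_term_def power2_eq_square intro!: derivative_eq_intros\<close>)
  thus ?thesis
    by (subst (asm) infsum_cmult_right') (simp add: theta_def[abs_def])
qed

lemma isCont_theta:
  assumes "Im \<tau> > 0"
  shows "isCont (\<lambda>p. theta j \<alpha> (fst p) (snd p)) (\<tau>, z)"
proof -
  let ?U = "{t. Im t > Im \<tau> / 2} \<times> {w. \<bar>Im w\<bar> < \<bar>Im z\<bar> + 1}"
  have "uniform_limit ?U (\<lambda>X p. \<Sum>n\<in>X. of_real (of_int n + \<alpha>) ^ j * theta_term (of_int n + \<alpha>) (fst p) (snd p))
     (\<lambda>p. \<Sum>\<^sub>\<infinity>n::int. of_real (of_int n + \<alpha>) ^ j * theta_term (of_int n + \<alpha>) (fst p) (snd p))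
     (finite_subsets_at_top UNIV)"
  proof (rule Weierstrass_m_test_general)
    fix n :: int and p assume "p \<in> ?U"
    thus "norm (of_real (of_int n + \<alpha>) ^ j * theta_term (of_int n + \<alpha>) (fst p) (snd p)) \<le>
       \<bar>of_int n + \<alpha>\<bar> ^ j * exp (- (pi * (Im \<tau> / 2) * (of_int n + \<alpha>)\<^sup>2) + 2 * pi * (\<bar>Im z\<bar> + 1) * \<bar>of_int n + \<alpha>\<bar>)"
      by (intro norm_theta_term_le) auto
  next
    show "(\<lambda>n::int. \<bar>of_int n + \<alpha>\<bar> ^ j * exp (- (pi * (Im \<tau> / 2) * (of_int n + \<alpha>)\<^sup>2) + 2 * pi * (\<bar>Im z\<bar> + 1) * \<bar>of_int n + \<alpha>\<bar>)) summable_on UNIV"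
      using assms by (intro summable_on_gauss_int) auto
  qed
  hence "continuous_on ?U (\<lambda>p. theta j \<alpha> (fst p) (snd p))"
    unfolding theta_def
    by (rule uniform_limit_theorem[rotated])
      (auto simp: theta_term_def intro!: always_eventually continuous_intros)
  moreover have "open ?U"
    by (intro open_Times open_Collect_less continuous_intros)
  ultimately show ?thesis
    using assms by (subst (asm) continuous_on_eq_continuous_at) auto
qed

section \<open>Symmetries and the product formula\<close>

lemma abs_summable_times:
  fixes f :: "'i \<Rightarrow> complex" and g :: "'j \<Rightarrow> complex"
  assumes f: "(\<lambda>x. norm (f x)) summable_on A" and g: "(\<lambda>y. norm (g y)) summable_on B"
  shows "(\<lambda>p. norm (f (fst p) * g (snd p))) summable_on A \<times> B"
proof (rule summable_on_SigmaI)
  fix x show "((\<lambda>y. norm (f (fst (x, y)) * g (snd (x, y)))) has_sum norm (f x) * (\<Sum>\<^sub>\<infinity>y\<in>B. norm (g y))) B"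
    unfolding fst_conv snd_conv norm_mult
    using g by (intro has_sum_cmult_right has_sum_infsum)
next
  show "(\<lambda>x. norm (f x) * (\<Sum>\<^sub>\<infinity>y\<in>B. norm (g y))) summable_on A"
    using f by (rule summable_on_cmult_left)
qed auto

lemma infsum_times_infsum:
  fixes f :: "'i \<Rightarrow> complex" and g :: "'j \<Rightarrow> complex"
  assumes f: "(\<lambda>x. norm (f x)) summable_on A" and g: "(\<lambda>y. norm (g y)) summable_on B"
  shows "infsum f A * infsum g B = (\<Sum>\<^sub>\<infinity>p\<in>A \<times> B. f (fst p) * g (snd p))"
proof -
  have "((\<lambda>p. f (fst p) * g (snd p)) has_sum (infsum f A * infsum g B)) (A \<times> B)"
  proof (rule has_sum_SigmaI)
    fix x show "((\<lambda>y. f (fst (x, y)) * g (snd (x, y))) has_sum (f x * infsum g B)) B"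
      unfolding fst_conv snd_conv
      using abs_summable_summable[OF g] by (intro has_sum_cmult_right has_sum_infsum)
  next
    show "((\<lambda>x. f x * infsum g B) has_sum infsum f A * infsum g B) A"
      using abs_summable_summable[OF f] by (intro has_sum_cmult_left has_sum_infsum)
  qed (rule abs_summable_summable[OF abs_summable_times[OF f g]])
  thus ?thesis by (simp add: infsumI)
qed

lemma infsum_int_pairs_by_parity:
  fixes f :: "int \<times> int \<Rightarrow> complex"
  assumes f: "f summable_on UNIV"
  shows "infsum f UNIV = (\<Sum>\<^sub>\<infinity>(a, b). f (a + b, a - b)) + (\<Sum>\<^sub>\<infinity>(a, b). f (a + b + 1, a - b))"
proof -
  let ?E = "{p :: int \<times> int. even (fst p + snd p)}" and ?O = "{p :: int \<times> int. odd (fst p + snd p)}"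
  have "infsum f (?E \<union> ?O) = infsum f ?E + infsum f ?O"
    by (intro infsum_Un_disjoint summable_on_subset_banach[OF f]) auto
  moreover have "?E \<union> ?O = UNIV" by auto
  moreover have E: "(m + n) div 2 + (m - n) div 2 = m \<and> (m + n) div 2 - (m - n) div 2 = n" if "even (m + n)" for m n :: int
    using that by presburger
  moreover have O: "(m + n - 1) div 2 + (m - n - 1) div 2 + 1 = m \<and> (m + n - 1) div 2 - (m - n - 1) div 2 = n" if "odd (m + n)" for m n :: int
    using that by presburger
  moreover have "infsum f ?E = (\<Sum>\<^sub>\<infinity>(a, b). f (a + b, a - b))"
    by (rule infsum_reindex_bij_witness[where i = "\<lambda>(a, b). (a + b, a - b)"
          and j = "\<lambda>(m, n). ((m + n) div 2, (m - n) div 2)"]) (use E in auto)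
  moreover have "infsum f ?O = (\<Sum>\<^sub>\<infinity>(a, b). f (a + b + 1, a - b))"
    by (rule infsum_reindex_bij_witness[where i = "\<lambda>(a, b). (a + b + 1, a - b)"
          and j = "\<lambda>(m, n). ((m + n - 1) div 2, (m - n - 1) div 2)"]) (use O in auto)
  ultimately show ?thesis by simp
qed

lemma theta_term_mult:
  "theta_term (u + v) \<tau> x * theta_term (u - v) \<tau> y = theta_term u (2 * \<tau>) (x + y) * theta_term v (2 * \<tau>) (x - y)"
  unfolding theta_term_def mult_exp_exp by (rule arg_cong[of _ _ exp]) (simp add: power2_eq_square algebra_simps)

text \<open>
  Let \<open>k\<close> and \<open>l\<close> be the shifted summation indices of the two series. The sum \<open>k\<^sup>2 + l\<^sup>2\<close> in the exponent
  of the double series is \<open>2 u\<^sup>2 + 2 v\<^sup>2\<close> for \<open>u = (k + l)/2\<close> and \<open>v = (k - l)/2\<close>; the parity of the sum of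
  the summation indices gives the two terms. The formula is the source of Halphen's system and of
  the duplication formulas.
\<close>
lemma theta_mult_theta:
  assumes "Im \<tau> > 0"
  shows "theta 0 \<alpha> \<tau> x * theta 0 \<beta> \<tau> y =
     theta 0 ((\<alpha> + \<beta>) / 2) (2 * \<tau>) (x + y) * theta 0 ((\<alpha> - \<beta>) / 2) (2 * \<tau>) (x - y) +
     theta 0 ((\<alpha> + \<beta> + 1) / 2) (2 * \<tau>) (x + y) * theta 0 ((\<alpha> - \<beta> + 1) / 2) (2 * \<tau>) (x - y)"
proof -
  have T: "Im (2 * \<tau>) > 0" using assms by simp
  have s: "(\<lambda>n::int. norm (theta_term (of_int n + \<gamma>) t w)) summable_on UNIV" if "Im t > 0" for \<gamma> t w
    using theta_term_abs_summable[OF that, of \<gamma> 0 w] by simp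
  let ?f = "\<lambda>p :: int \<times> int. theta_term (of_int (fst p) + \<alpha>) \<tau> x * theta_term (of_int (snd p) + \<beta>) \<tau> y"
  have prod: "theta 0 \<gamma> t w * theta 0 \<delta> t w' =
     (\<Sum>\<^sub>\<infinity>p. theta_term (of_int (fst p) + \<gamma>) t w * theta_term (of_int (snd p) + \<delta>) t w')" if "Im t > 0" for \<gamma> \<delta> t w w'
    using infsum_times_infsum[OF s s, OF that that, of \<gamma> w \<delta> w'] by (simp add: theta_def)
  have "?f summable_on UNIV"
    using abs_summable_summable[OF abs_summable_times[OF s s, OF assms assms, of \<alpha> x \<beta> y]] by simp
  from infsum_int_pairs_by_parity[OF this]
  have "theta 0 \<alpha> \<tau> x * theta 0 \<beta> \<tau> y =
     (\<Sum>\<^sub>\<infinity>(a, b). ?f (a + b, a - b)) + (\<Sum>\<^sub>\<infinity>(a, b). ?f (a + b + 1, a - b))"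
    by (simp add: prod[OF assms])
  also have "(\<lambda>(a, b). ?f (a + b, a - b)) = (\<lambda>p. theta_term (of_int (fst p) + (\<alpha> + \<beta>) / 2) (2 * \<tau>) (x + y) *
      theta_term (of_int (snd p) + (\<alpha> - \<beta>) / 2) (2 * \<tau>) (x - y))"
  proof
    fix p :: "int \<times> int"
    obtain a b where p: "p = (a, b)" by force
    have "of_int (a + b) + \<alpha> = (of_int a + (\<alpha> + \<beta>) / 2) + (of_int b + (\<alpha> - \<beta>) / 2)"
      "of_int (a - b) + \<beta> = (of_int a + (\<alpha> + \<beta>) / 2) - (of_int b + (\<alpha> - \<beta>) / 2)"
      by (simp_all add: field_simps)
    thus "(case p of (a, b) \<Rightarrow> ?f (a + b, a - b)) = theta_term (of_int (fst p) + (\<alpha> + \<beta>) / 2) (2 * \<tau>) (x + y) *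
      theta_term (of_int (snd p) + (\<alpha> - \<beta>) / 2) (2 * \<tau>) (x - y)"
      unfolding p prod.case fst_conv snd_conv by (simp only: theta_term_mult)
  qed
  also have "(\<lambda>(a, b). ?f (a + b + 1, a - b)) = (\<lambda>p. theta_term (of_int (fst p) + (\<alpha> + \<beta> + 1) / 2) (2 * \<tau>) (x + y) *
      theta_term (of_int (snd p) + (\<alpha> - \<beta> + 1) / 2) (2 * \<tau>) (x - y))"
  proof
    fix p :: "int \<times> int"
    obtain a b where p: "p = (a, b)" by force
    have "of_int (a + b + 1) + \<alpha> = (of_int a + (\<alpha> + \<beta> + 1) / 2) + (of_int b + (\<alpha> - \<beta> + 1) / 2)"
      "of_int (a - b) + \<beta> = (of_int a + (\<alpha> + \<beta> + 1) / 2) - (of_int b + (\<alpha> - \<beta> + 1) / 2)"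
      by (simp_all add: field_simps)
    thus "(case p of (a, b) \<Rightarrow> ?f (a + b + 1, a - b)) = theta_term (of_int (fst p) + (\<alpha> + \<beta> + 1) / 2) (2 * \<tau>) (x + y) *
      theta_term (of_int (snd p) + (\<alpha> - \<beta> + 1) / 2) (2 * \<tau>) (x - y)"
      unfolding p prod.case fst_conv snd_conv by (simp only: theta_term_mult)
  qed
  finally show ?thesis by (simp add: prod[OF T])
qed

lemma theta_duplicate:
  assumes "Im \<tau> > 0"
  shows "theta 0 (2 * \<alpha>) (\<tau> / 2) z = theta 0 \<alpha> (2 * \<tau>) (2 * z) + theta 0 (\<alpha> + 1 / 2) (2 * \<tau>) (2 * z)"
proof -
  let ?f = "\<lambda>n::int. theta_term (of_int n + 2 * \<alpha>) (\<tau> / 2) z"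
  have f: "?f summable_on UNIV"
    using theta_term_summable[of "\<tau> / 2" "2 * \<alpha>" 0 z] assms by simp
  have g: "theta_term (2 * x) (\<tau> / 2) z = theta_term x (2 * \<tau>) (2 * z)" for x
    unfolding theta_term_def by (rule arg_cong[of _ _ exp]) (simp add: power2_eq_square)
  have g1: "theta_term (of_int (2 * n) + 2 * \<alpha>) (\<tau> / 2) z = theta_term (of_int n + \<alpha>) (2 * \<tau>) (2 * z)" for n
    unfolding g[symmetric] by (rule arg_cong[of _ _ "\<lambda>x. theta_term x (\<tau> / 2) z"]) simp
  have g2: "theta_term (of_int (2 * n + 1) + 2 * \<alpha>) (\<tau> / 2) z = theta_term (of_int n + (\<alpha> + 1 / 2)) (2 * \<tau>) (2 * z)" for n
    unfolding g[symmetric] by (rule arg_cong[of _ _ "\<lambda>x. theta_term x (\<tau> / 2) z"]) simp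
  let ?E = "{n :: int. even n}" and ?O = "{n :: int. odd n}"
  have "infsum ?f (?E \<union> ?O) = infsum ?f ?E + infsum ?f ?O"
    by (intro infsum_Un_disjoint summable_on_subset_banach[OF f]) auto
  moreover have "?E \<union> ?O = UNIV" by auto
  moreover have "infsum ?f ?E = theta 0 \<alpha> (2 * \<tau>) (2 * z)"
    unfolding theta_def
    by (rule infsum_reindex_bij_witness[where i = "\<lambda>n. 2 * n" and j = "\<lambda>n. n div 2"])
      (use g1 in \<open>auto elim!: evenE\<close>)
  moreover have "infsum ?f ?O = theta 0 (\<alpha> + 1 / 2) (2 * \<tau>) (2 * z)"
    unfolding theta_def
    by (rule infsum_reindex_bij_witness[where i = "\<lambda>n. 2 * n + 1" and j = "\<lambda>n. n div 2"])
      (use g2 in \<open>auto elim!: oddE\<close>)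
  ultimately show ?thesis by (simp add: theta_def)
qed

lemma theta_shift: "theta j (\<alpha> + 1) \<tau> z = theta j \<alpha> \<tau> z"
  unfolding theta_def
  by (rule infsum_reindex_bij_witness[where i = "\<lambda>n. n - 1" and j = "\<lambda>n. n + 1"]) (auto simp: algebra_simps)

lemma theta_neg: "theta j (- \<alpha>) \<tau> (- z) = (-1) ^ j * theta j \<alpha> \<tau> z"
proof -
  have "theta j (- \<alpha>) \<tau> (- z) = (\<Sum>\<^sub>\<infinity>n::int. (-1) ^ j * (of_real (of_int n + \<alpha>) ^ j * theta_term (of_int n + \<alpha>) \<tau> z))"
    unfolding theta_def
  proof (rule infsum_reindex_bij_witness[where i = uminus and j = uminus])
    fix n :: int
    have "complex_of_real (of_int n - \<alpha>) = (-1) * of_real (\<alpha> - of_int n)" by simp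
    hence p: "complex_of_real (of_int n - \<alpha>) ^ j = (-1) ^ j * of_real (\<alpha> - of_int n) ^ j"
      by (metis power_mult_distrib)
    have g: "theta_term (\<alpha> - of_int n) \<tau> z = theta_term (of_int n - \<alpha>) \<tau> (- z)"
      by (simp add: theta_term_def power2_eq_square algebra_simps)
    show "(- 1) ^ j * (complex_of_real (of_int (- n) + \<alpha>) ^ j * theta_term (of_int (- n) + \<alpha>) \<tau> z)
       = complex_of_real (of_int n + - \<alpha>) ^ j * theta_term (of_int n + - \<alpha>) \<tau> (- z)"
      using p g by simp
  qed auto
  thus ?thesis by (simp add: infsum_cmult_right' theta_def)
qed

lemma exp_two_pi_i_int: "exp (2 * of_real pi * \<i> * of_int n) = 1"
  using exp_integer_2pi[of "of_int n"] by (simp add: mult_ac)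

lemma theta_add_1: "theta j \<alpha> \<tau> (z + 1) = exp (2 * of_real pi * \<i> * of_real \<alpha>) * theta j \<alpha> \<tau> z"
proof -
  have "theta_term (of_int n + \<alpha>) \<tau> (z + 1) = exp (2 * of_real pi * \<i> * of_real \<alpha>) * theta_term (of_int n + \<alpha>) \<tau> z" for n
  proof -
    have "theta_term (of_int n + \<alpha>) \<tau> (z + 1) =
      exp (2 * of_real pi * \<i> * of_int n) * (exp (2 * of_real pi * \<i> * of_real \<alpha>) * theta_term (of_int n + \<alpha>) \<tau> z)"
      unfolding theta_term_def mult_exp_exp by (rule arg_cong[of _ _ exp]) (simp add: algebra_simps)
    thus ?thesis by (simp add: exp_two_pi_i_int)
  qed
  thus ?thesis
    unfolding theta_def infsum_cmult_right'[symmetric] by (simp add: mult_ac)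
qed

lemma exp_pi_i_square: "exp (of_real pi * \<i> * of_int n ^ 2) = exp (of_real pi * \<i> * of_int n)"
proof -
  have "even (n\<^sup>2 - n)" by simp
  then obtain k where k: "n\<^sup>2 = n + 2 * k"
    by (metis add.commute diff_add_cancel evenE)
  have "(of_int n :: complex) ^ 2 = of_int n + 2 * of_int k"
    using arg_cong[OF k, of "of_int :: int \<Rightarrow> complex"] by simp
  hence "exp (of_real pi * \<i> * of_int n ^ 2) = exp (of_real pi * \<i> * of_int n) * exp (2 * of_real pi * \<i> * of_int k)"
    unfolding mult_exp_exp by (simp add: algebra_simps)
  thus ?thesis by (simp add: exp_two_pi_i_int)
qed

text \<open>
  Together with the next lemma: \<open>\<tau> \<mapsto> \<tau> + 1\<close> exchanges \<open>\<theta>\<^sub>3\<close> and \<open>\<theta>\<^sub>4\<close> and fixes \<open>\<theta>\<^sub>2\<close> up to a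
  constant. This transports identities for \<open>(\<theta>\<^sub>2, \<theta>\<^sub>3)\<close> to \<open>(\<theta>\<^sub>2, \<theta>\<^sub>4)\<close>.
\<close>
lemma theta_0_tau_add_1: "theta j 0 (\<tau> + 1) z = theta j 0 \<tau> (z + 1 / 2)"
proof -
  have "theta_term (of_int n) (\<tau> + 1) z = theta_term (of_int n) \<tau> (z + 1 / 2)" for n
  proof -
    have "theta_term (of_int n) (\<tau> + 1) z = exp (of_real pi * \<i> * of_int n ^ 2) * theta_term (of_int n) \<tau> z"
      unfolding theta_term_def mult_exp_exp by (rule arg_cong[of _ _ exp]) (simp add: algebra_simps)
    also have "\<dots> = theta_term (of_int n) \<tau> (z + 1 / 2)"
      unfolding exp_pi_i_square unfolding theta_term_def mult_exp_exp
      by (rule arg_cong[of _ _ exp]) (simp add: algebra_simps)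
    finally show ?thesis .
  qed
  thus ?thesis by (simp add: theta_def)
qed

lemma theta_half_tau_add_1:
  "theta j (1 / 2) (\<tau> + 1) z = exp (of_real pi * \<i> / 4) * theta j (1 / 2) \<tau> z"
proof -
  have "theta_term (of_int n + 1 / 2) (\<tau> + 1) z = exp (of_real pi * \<i> / 4) * theta_term (of_int n + 1 / 2) \<tau> z" for n
  proof -
    have "theta_term (of_int n + 1 / 2) (\<tau> + 1) z = exp (of_real pi * \<i> * of_int n ^ 2) *
       (exp (of_real pi * \<i> * of_int n) * (exp (of_real pi * \<i> / 4) * theta_term (of_int n + 1 / 2) \<tau> z))"
      unfolding theta_term_def mult_exp_exp by (rule arg_cong[of _ _ exp]) (simp add: power2_eq_square algebra_simps)
    also have "\<dots> = exp (2 * of_real pi * \<i> * of_int n) * (exp (of_real pi * \<i> / 4) * theta_term (of_int n + 1 / 2) \<tau> z)"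
      unfolding exp_pi_i_square mult.assoc[symmetric] mult_exp_exp by (simp add: algebra_simps)
    finally show ?thesis by (simp add: exp_two_pi_i_int)
  qed
  thus ?thesis unfolding theta_def infsum_cmult_right'[symmetric] by (simp add: mult_ac)
qed

lemma jacobi_theta_eq_theta: "jacobi_theta \<tau> z = - \<i> * theta 0 (1 / 2) \<tau> (z + 1 / 2)"
proof -
  have "theta 0 (1 / 2) \<tau> (z + 1 / 2) = (\<Sum>\<^sub>\<infinity>n::int. \<i> * exp (of_real pi * \<i> * \<tau> / 4) * ((- 1) powi n * nome \<tau> powi (n * (n + 1) div 2) *
        exp (2 * of_real pi * \<i> * (of_int n + 1 / 2) * z)))"
    unfolding theta_def
  proof (rule infsum_cong)
    fix n :: int
    have e: "exp (of_real pi * \<i> * of_int n) = (- 1) powi n"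
    proof -
      have "exp (of_real pi * \<i> * of_int n) = exp (of_real pi * \<i>) powi n"
        by (subst exp_power_int) (rule arg_cong[of _ _ exp], simp)
      thus ?thesis by simp
    qed
    have "even (n * (n + 1))" by simp
    then obtain k where k: "n * (n + 1) = 2 * k" by (elim evenE)
    have "(of_int n :: complex) * (of_int n + 1) = 2 * of_int k"
      using arg_cong[OF k, of "of_int :: int \<Rightarrow> complex"] by simp
    hence nk: "(of_int n :: complex)^2 = 2 * of_int k - of_int n" by (simp add: power2_eq_square algebra_simps)
    have q: "nome \<tau> powi (n * (n + 1) div 2) = exp (2 * of_real pi * \<i> * \<tau> * of_int k)"
      using k by (simp add: nome_def exp_power_int mult_ac)
    have "theta_term (of_int n + 1 / 2) \<tau> (z + 1 / 2) = exp (of_real pi * \<i> / 2) * exp (of_real pi * \<i> * \<tau> / 4) * (exp (of_real pi * \<i> * of_int n) *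
        exp (2 * of_real pi * \<i> * \<tau> * of_int k) * exp (2 * of_real pi * \<i> * (of_int n + 1 / 2) * z))"
      unfolding theta_term_def mult_exp_exp
      by (rule arg_cong[of _ _ exp]) (simp add: power2_sum nk field_simps)
    also have "exp (of_real pi * \<i> / 2) = \<i>"
      using cis_pi_half by (simp add: cis_conv_exp mult.commute)
    finally show "complex_of_real (real_of_int n + 1 / 2) ^ 0 * theta_term (real_of_int n + 1 / 2) \<tau> (z + 1 / 2) =
      \<i> * exp (of_real pi * \<i> * \<tau> / 4) * ((- 1) powi n * nome \<tau> powi (n * (n + 1) div 2) *
        exp (2 * of_real pi * \<i> * (of_int n + 1 / 2) * z))"
      by (simp add: e q)
  qed
  also have "\<dots> = \<i> * jacobi_theta \<tau> z"
    by (simp add: jacobi_theta_def infsum_cmult_right' mult.assoc)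
  finally show ?thesis by simp
qed

section \<open>The q-binomial theorem\<close>

lemma infsum_dominated_convergence:
  fixes a :: "nat \<Rightarrow> 'i \<Rightarrow> complex"
  assumes lim: "\<And>n. n \<in> A \<Longrightarrow> (\<lambda>N. a N n) \<longlonglongrightarrow> b n"
    and bound: "\<And>N n. n \<in> A \<Longrightarrow> norm (a N n) \<le> M n"
    and M: "M summable_on A"
  shows "(\<lambda>N. \<Sum>\<^sub>\<infinity>n\<in>A. a N n) \<longlonglongrightarrow> (\<Sum>\<^sub>\<infinity>n\<in>A. b n)"
proof (rule swap_uniform_limit'[where F = "finite_subsets_at_top A" and S = UNIV])
  show "\<forall>\<^sub>F X in finite_subsets_at_top A. (\<lambda>N. \<Sum>n\<in>X. a N n) \<longlonglongrightarrow> (\<Sum>n\<in>X. b n)"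
    by (rule eventually_finite_subsets_at_top_weakI) (auto intro!: tendsto_sum lim)
  have "norm (b n) \<le> M n" if "n \<in> A" for n
    using tendsto_norm[OF lim[OF that]] bound[OF that] by (intro tendsto_upperbound) auto
  hence "b summable_on A"
    using abs_summable_summable[OF Infinite_Sum.abs_summable_on_comparison_test'[OF M, of b]] by blast
  thus "((\<lambda>X. \<Sum>n\<in>X. b n) \<longlongrightarrow> (\<Sum>\<^sub>\<infinity>n\<in>A. b n)) (finite_subsets_at_top A)"
    by (rule infsum_tendsto)
  show "uniform_limit UNIV (\<lambda>X N. \<Sum>n\<in>X. a N n) (\<lambda>N. \<Sum>\<^sub>\<infinity>n\<in>A. a N n) (finite_subsets_at_top A)"
    using bound M by (rule Weierstrass_m_test_general)
qed auto

text \<open>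
  Gaussian binomial coefficients; of the two Pascal recursions this is the one that multiplication
  by the last factor produces in \<open>gauss_binomial\<close>.
\<close>
fun qbin :: "complex \<Rightarrow> nat \<Rightarrow> nat \<Rightarrow> complex" where
  "qbin q n 0 = 1"
| "qbin q 0 (Suc j) = 0"
| "qbin q (Suc n) (Suc j) = qbin q n (Suc j) + q ^ (n - j) * qbin q n j"

lemma qbin_eq_0: "n < j \<Longrightarrow> qbin q n j = 0"
  by (induction q n j rule: qbin.induct) auto

lemma triangle_Suc: "(Suc j * j) div 2 = (j * (j - 1)) div 2 + j"
proof -
  have "Suc j * j = j * (j - 1) + 2 * j" by (cases j) auto
  thus ?thesis by simp
qed

lemma gauss_binomial:
  "(\<Prod>k<n. 1 + x * q ^ k) = (\<Sum>j\<le>n. q ^ (j * (j - 1) div 2) * qbin q n j * x ^ j)"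
proof (induction n)
  case (Suc n)
  let ?t = "\<lambda>j. j * (j - 1) div 2"
  have "(\<Sum>j\<le>Suc n. q ^ ?t j * qbin q (Suc n) j * x ^ j) =
     1 + (\<Sum>j\<le>n. q ^ ?t (Suc j) * qbin q (Suc n) (Suc j) * x ^ Suc j)"
    by (subst sum.atMost_Suc_shift) simp
  also have "(\<Sum>j\<le>n. q ^ ?t (Suc j) * qbin q (Suc n) (Suc j) * x ^ Suc j) =
     (\<Sum>j\<le>n. q ^ ?t (Suc j) * qbin q n (Suc j) * x ^ Suc j) +
     (\<Sum>j\<le>n. q ^ ?t j * qbin q n j * x ^ j * (x * q ^ n))"
    unfolding sum.distrib[symmetric]
  proof (rule sum.cong[OF refl])
    fix j assume "j \<in> {..n}"
    hence "?t (Suc j) + (n - j) = ?t j + n" using triangle_Suc[of j] by simp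
    hence "q ^ ?t (Suc j) * q ^ (n - j) = q ^ ?t j * q ^ n" by (metis power_add)
    thus "q ^ ?t (Suc j) * qbin q (Suc n) (Suc j) * x ^ Suc j =
      q ^ ?t (Suc j) * qbin q n (Suc j) * x ^ Suc j + q ^ ?t j * qbin q n j * x ^ j * (x * q ^ n)"
      by (simp add: algebra_simps del: mult_Suc)
  qed
  also have "1 + ((\<Sum>j\<le>n. q ^ ?t (Suc j) * qbin q n (Suc j) * x ^ Suc j) +
     (\<Sum>j\<le>n. q ^ ?t j * qbin q n j * x ^ j * (x * q ^ n))) =
     (\<Sum>j\<le>Suc n. q ^ ?t j * qbin q n j * x ^ j) + (\<Sum>j\<le>n. q ^ ?t j * qbin q n j * x ^ j) * (x * q ^ n)"
    unfolding sum.atMost_Suc_shift[of _ n] by (simp add: sum_distrib_right)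
  also have "(\<Sum>j\<le>Suc n. q ^ ?t j * qbin q n j * x ^ j) = (\<Sum>j\<le>n. q ^ ?t j * qbin q n j * x ^ j)"
    by (simp add: qbin_eq_0)
  finally show ?case by (simp add: Suc.IH algebra_simps)
qed auto

definition qpoch :: "complex \<Rightarrow> nat \<Rightarrow> complex" where
  "qpoch q n = (\<Prod>i<n. 1 - q ^ Suc i)"

lemma qpoch_Suc: "qpoch q (Suc n) = qpoch q n * (1 - q ^ Suc n)"
  by (simp add: qpoch_def)

lemma power_ne_1:
  assumes "norm (q :: complex) < 1" shows "q ^ Suc n \<noteq> 1"
proof
  assume "q ^ Suc n = 1"
  hence "norm q ^ Suc n = 1" by (metis norm_one norm_power)
  thus False using assms power_Suc_less_one[of "norm q" n] by (cases "q = 0") auto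
qed

lemma qpoch_nonzero: "norm q < 1 \<Longrightarrow> qpoch q n \<noteq> 0"
  unfolding qpoch_def using power_ne_1[of q] by (auto simp del: power_Suc)

lemma qbin_closed_form:
  assumes "norm q < 1" "j \<le> n"
  shows "qbin q n j * (qpoch q j * qpoch q (n - j)) = qpoch q n"
  using assms(2)
proof (induction q n j rule: qbin.induct)
  case (3 q n j)
  show ?case
  proof (cases "j = n")
    case True
    have "qbin q n n * (qpoch q n * qpoch q 0) = qpoch q n" using 3(2)[of] True by simp
    hence "qbin q n n * qpoch q n * (1 - q ^ Suc n) = qpoch q n * (1 - q ^ Suc n)" by (simp add: qpoch_def)
    thus ?thesis using True by (simp add: qbin_eq_0 qpoch_Suc qpoch_def[of q 0] mult_ac del: power_Suc)
  next
    case False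
    \<comment> \<open>Both summands of the recursion become multiples of \<open>qpoch q n\<close>, and the weights add up to \<open>1 - q ^ Suc n\<close>.\<close>
    hence j: "j < n" using 3(3) by simp
    then obtain d where d: "n = Suc j + d" by (metis add.commute less_natE add_Suc)
    have 1: "qbin q n (Suc j) * (qpoch q (Suc j) * qpoch q d) = qpoch q n"
      using 3(1) j d by simp
    have 2: "qbin q n j * (qpoch q j * qpoch q (Suc d)) = qpoch q n"
      using 3(2) j d by (simp add: Suc_diff_le)
    have "qbin q (Suc n) (Suc j) * (qpoch q (Suc j) * qpoch q (Suc d)) =
       qbin q n (Suc j) * (qpoch q (Suc j) * qpoch q d) * (1 - q ^ Suc d) +
       q ^ Suc d * (1 - q ^ Suc j) * (qbin q n j * (qpoch q j * qpoch q (Suc d)))"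
      using d by (simp add: qpoch_Suc algebra_simps del: power_Suc)
    also have "\<dots> = qpoch q n * (1 - q ^ Suc d * q ^ Suc j)"
      unfolding 1 2 by (simp add: algebra_simps)
    also have "q ^ Suc d * q ^ Suc j = q ^ Suc n"
      unfolding d power_add[symmetric] by (rule arg_cong[of _ _ "\<lambda>k. q ^ k"]) simp
    finally show ?thesis using d by (simp add: qpoch_Suc del: power_Suc)
  qed
qed (auto simp: qpoch_def)

lemma qpoch_limit:
  assumes "norm q < 1"
  obtains P where "P \<noteq> 0" "qpoch q \<longlonglongrightarrow> P"
proof -
  have "summable (\<lambda>i. norm ((1 - q ^ Suc i) - 1))"
    using summable_mult[OF summable_geometric[of "norm q"], of "norm q"] assms
    by (simp add: norm_mult norm_power)
  hence "convergent_prod (\<lambda>i. 1 - q ^ Suc i)"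
    by (intro abs_convergent_prod_imp_convergent_prod summable_imp_abs_convergent_prod)
  then obtain P where P: "(\<lambda>n. \<Prod>i\<le>n. 1 - q ^ Suc i) \<longlonglongrightarrow> P" "P \<noteq> 0"
    using convergent_prod_iff_nz_lim[of "\<lambda>i. 1 - q ^ Suc i"] power_ne_1[OF assms] by auto
  have "(\<lambda>n. qpoch q (Suc n)) \<longlonglongrightarrow> P"
    using P(1) by (simp add: qpoch_def lessThan_Suc_atMost del: power_Suc)
  thus ?thesis using that P(2) LIMSEQ_imp_Suc by blast
qed

text \<open>
  Dominated convergence, applied to the finite triple product, needs exactly this: the central
  Gaussian binomial coefficients, extended by zero, are bounded and have a nonzero limit that does
  not depend on \<open>n\<close>. The limit is the inverse of the Euler product.
\<close>
lemma central_qbin: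
  assumes q: "norm q < 1"
  obtains C K where "C \<noteq> 0"
    "\<And>n::int. (\<lambda>N. if \<bar>n\<bar> \<le> int N then qbin q (2 * N) (nat (int N + n)) else 0) \<longlonglongrightarrow> C"
    "\<And>N (n::int). norm (if \<bar>n\<bar> \<le> int N then qbin q (2 * N) (nat (int N + n)) else 0) \<le> K"
proof -
  obtain P where P: "P \<noteq> 0" "qpoch q \<longlonglongrightarrow> P" using qpoch_limit[OF q] by blast
  have inv: "(\<lambda>n. inverse (qpoch q n)) \<longlonglongrightarrow> inverse P"
    using P by (intro tendsto_inverse)
  obtain A where A: "\<And>n. norm (qpoch q n) \<le> A"
    using Bseq_def P(2) by (metis convergentI convergent_imp_Bseq)
  obtain B where B: "\<And>n. norm (inverse (qpoch q n)) \<le> B"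
    using Bseq_def inv by (metis (no_types, lifting) convergentI convergent_imp_Bseq)
  let ?b = "\<lambda>N (n::int). if \<bar>n\<bar> \<le> int N then qbin q (2 * N) (nat (int N + n)) else 0"
  have b: "?b N n = qpoch q (2 * N) * inverse (qpoch q (nat (int N + n))) * inverse (qpoch q (nat (int N - n)))"
    if "\<bar>n\<bar> \<le> int N" for N n
  proof -
    have "2 * N - nat (int N + n) = nat (int N - n)" using that by linarith
    thus ?thesis
      using qbin_closed_form[OF q, of "nat (int N + n)" "2 * N"] that qpoch_nonzero[OF q]
      by (simp add: field_simps nat_le_iff)
  qed
  show ?thesis
  proof (rule that[of "inverse P" "A * B * B"])
    fix n :: int
    have l: "filterlim (\<lambda>N. nat (int N + k)) sequentially sequentially" for k
      unfolding filterlim_at_top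
    proof
      fix Z :: nat
      show "\<forall>\<^sub>F N in sequentially. Z \<le> nat (int N + k)"
        using eventually_ge_at_top[of "Z + nat \<bar>k\<bar>"] by eventually_elim linarith
    qed
    have l2: "filterlim (\<lambda>N::nat. 2 * N) sequentially sequentially"
      by (rule filterlim_subseq) (auto simp: strict_mono_def)
    have "(\<lambda>N. qpoch q (2 * N) * inverse (qpoch q (nat (int N + n))) * inverse (qpoch q (nat (int N + (- n)))))
       \<longlonglongrightarrow> P * inverse P * inverse P"
      by (intro tendsto_mult filterlim_compose[OF P(2) l2] filterlim_compose[OF inv l])
    hence "(\<lambda>N. qpoch q (2 * N) * inverse (qpoch q (nat (int N + n))) * inverse (qpoch q (nat (int N - n))))
       \<longlonglongrightarrow> inverse P"
      using P(1) by simp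
    moreover have "\<forall>\<^sub>F N in sequentially. qpoch q (2 * N) * inverse (qpoch q (nat (int N + n))) * inverse (qpoch q (nat (int N - n))) = ?b N n"
      using eventually_ge_at_top[of "nat \<bar>n\<bar>"]
    proof eventually_elim
      case (elim N)
      hence "\<bar>n\<bar> \<le> int N" by linarith
      from b[OF this] show ?case by simp
    qed
    ultimately show "(\<lambda>N. ?b N n) \<longlonglongrightarrow> inverse P"
      by (rule Lim_transform_eventually)
  next
    have A0: "A \<ge> 0" and B0: "B \<ge> 0"
      using A[of 0] B[of 0] norm_ge_zero order_trans by blast+
    fix N and n :: int
    show "norm (?b N n) \<le> A * B * B"
    proof (cases "\<bar>n\<bar> \<le> int N")
      case True
      show ?thesis
        unfolding b[OF True] norm_mult using A B A0 B0
        by (intro mult_mono mult_nonneg_nonneg norm_ge_zero)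
    qed (use A0 B0 in auto)
  qed (use P in auto)
qed

text \<open>
  The Gaussian binomial theorem with \<open>2 N\<close> factors at \<open>x = - \<zeta> / q ^ N\<close>: half of the factors have the
  form \<open>1 - \<zeta> q\<^sup>i\<close>, the others are turned round at the cost of a monomial.
\<close>
lemma finite_triple_product:
  fixes q \<zeta> :: complex
  assumes "q \<noteq> 0" "\<zeta> \<noteq> 0"
  shows "(\<Prod>i<N. (1 - \<zeta> * q ^ i) * (1 - q ^ Suc i / \<zeta>)) * (\<Prod>i<N. - \<zeta> / q ^ Suc i) =
     (\<Sum>j\<le>2 * N. q ^ (j * (j - 1) div 2) * qbin q (2 * N) j * (- \<zeta> / q ^ N) ^ j)"
proof -
  have "(\<Sum>j\<le>2 * N. q ^ (j * (j - 1) div 2) * qbin q (2 * N) j * (- \<zeta> / q ^ N) ^ j) =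
     (\<Prod>k<N + N. 1 + (- \<zeta> / q ^ N) * q ^ k)"
    by (simp only: gauss_binomial mult_2)
  also have "\<dots> = (\<Prod>k<N. 1 + (- \<zeta> / q ^ N) * q ^ k) * (\<Prod>i<N. 1 + (- \<zeta> / q ^ N) * q ^ (N + i))"
    by (simp add: prod.nat_group[symmetric] lessThan_atLeast0 prod.atLeastLessThan_concat[symmetric, of 0 N "N + N"]
        prod.atLeastLessThan_shift_0[of _ N "N + N"] add.commute)
  also have "(\<Prod>k<N. 1 + (- \<zeta> / q ^ N) * q ^ k) = (\<Prod>i<N. 1 + (- \<zeta> / q ^ N) * q ^ (N - Suc i))"
    by (rule prod.nat_diff_reindex[symmetric])
  also have "\<dots> = (\<Prod>i<N. (1 - q ^ Suc i / \<zeta>) * (- \<zeta> / q ^ Suc i))"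
  proof (rule prod.cong[OF refl])
    fix i assume "i \<in> {..<N}"
    hence "q ^ N = q ^ Suc i * q ^ (N - Suc i)" by (metis Suc_leI le_add_diff_inverse lessThan_iff power_add)
    thus "1 + - \<zeta> / q ^ N * q ^ (N - Suc i) = (1 - q ^ Suc i / \<zeta>) * (- \<zeta> / q ^ Suc i)"
      using assms by (simp add: field_simps)
  qed
  also have "(\<Prod>i<N. 1 + (- \<zeta> / q ^ N) * q ^ (N + i)) = (\<Prod>i<N. 1 - \<zeta> * q ^ i)"
    using assms by (intro prod.cong) (auto simp: power_add)
  finally show ?thesis by (simp only: prod.distrib mult_ac)
qed

section \<open>The Jacobi triple product\<close>

lemma summable_poly_geometric:
  fixes x :: real
  assumes "0 < x" "x < 1"
  shows "summable (\<lambda>m. real (Suc m) ^ j * x ^ Suc m)"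
proof -
  define a where "a = - ln x"
  have a: "a > 0" using assms by (simp add: a_def ln_less_zero)
  have x: "x ^ n = exp (- (a * real n))" for n
    using assms by (simp add: a_def exp_of_nat_mult mult.commute flip: ln_realpow)
  have "(\<lambda>m::nat. real (Suc m) ^ j * exp (- (a * real (Suc m))) / exp (- (a / 2 * real m))) \<longlonglongrightarrow> 0"
    using a by real_asymp
  hence "eventually (\<lambda>m. norm (real (Suc m) ^ j * exp (- (a * real (Suc m))) / exp (- (a / 2 * real m))) < 1) sequentially"
    by (auto dest: tendstoD[of _ _ _ 1])
  hence ev: "eventually (\<lambda>m. norm (real (Suc m) ^ j * x ^ Suc m) \<le> exp (- (a / 2)) ^ m) sequentially"
  proof eventually_elim
    case (elim m)
    have "exp (- (a / 2)) ^ m = exp (- (a / 2 * real m))"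
      by (simp add: exp_of_nat_mult[symmetric] mult.commute)
    thus ?case using elim unfolding x by (simp add: field_simps abs_mult)
  qed
  show ?thesis
    by (rule summable_comparison_test_ev[OF ev summable_geometric]) (use a in auto)
qed

text \<open>
  For \<open>j = 0\<close> the sum over all pairs is \<open>\<Sum> q\<^sup>k\<^sup>m (\<zeta>\<^sup>m + \<zeta>\<^sup>-\<^sup>m) / m\<close> over \<open>k, m \<ge> 1\<close> with \<open>\<zeta> = exp s\<close>, minus the
  logarithm of the nontrivial factors of the triple product; the pair \<open>p\<close> is \<open>(k - 1, m - 1)\<close>. Raising
  \<open>j\<close> differentiates in \<open>s\<close>.
\<close>
definition lambert_term :: "complex \<Rightarrow> nat \<Rightarrow> nat \<times> nat \<Rightarrow> complex \<Rightarrow> complex" where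
  "lambert_term q j p s = (let m = of_nat (Suc (snd p)) in
     q ^ (Suc (fst p) * Suc (snd p)) * (m ^ j / m) * (exp (m * s) + (-1) ^ j * exp (- (m * s))))"

definition lambert :: "complex \<Rightarrow> nat \<Rightarrow> complex \<Rightarrow> complex" where
  "lambert q j s = (\<Sum>\<^sub>\<infinity>p. lambert_term q j p s)"

lemma lambert_term_bound:
  assumes q: "norm q < 1" and s: "\<bar>Re s\<bar> \<le> B"
  shows "norm (lambert_term q j p s) \<le>
    norm q ^ fst p * (2 * (real (Suc (snd p)) ^ j * (norm q * exp B) ^ Suc (snd p)))"
proof -
  obtain k l where p: "p = (k, l)" by force
  define m where "m = Suc l"
  have m: "real m \<ge> 1" by (simp add: m_def)
  have "norm (exp (of_nat m * s) + (-1) ^ j * exp (- (of_nat m * s))) \<le> exp (real m * Re s) + exp (- (real m * Re s))"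
    by (rule order_trans[OF norm_triangle_ineq]) (simp add: norm_mult norm_power)
  also have "\<dots> \<le> 2 * exp B ^ m"
  proof -
    have "real m * Re s \<le> real m * B" "- (real m * Re s) \<le> real m * B"
      using s m mult_left_mono[of "Re s" B "real m"] mult_left_mono[of "- Re s" B "real m"] by auto
    hence "exp (real m * Re s) \<le> exp (real m * B)" "exp (- (real m * Re s)) \<le> exp (real m * B)"
      by (simp_all only: exp_le_cancel_iff)
    thus ?thesis unfolding exp_of_nat_mult by linarith
  qed
  finally have 1: "norm (exp (of_nat m * s) + (-1) ^ j * exp (- (of_nat m * s))) \<le> 2 * exp B ^ m" .
  have 2: "norm ((of_nat m :: complex) ^ j / of_nat m) \<le> real m ^ j"
    using m by (simp add: norm_divide norm_power divide_le_eq mult_le_cancel_left1)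
  have 3: "norm (q ^ (Suc k * m)) \<le> norm q ^ k * norm q ^ m"
    unfolding norm_power power_add[symmetric]
    using q by (intro power_decreasing) (auto simp: m_def)
  have "norm (q ^ (Suc k * m) * (of_nat m ^ j / of_nat m) * (exp (of_nat m * s) + (-1) ^ j * exp (- (of_nat m * s))))
     \<le> (norm q ^ k * norm q ^ m) * real m ^ j * (2 * exp B ^ m)"
    unfolding norm_mult[of "q ^ (Suc k * m) * (of_nat m ^ j / of_nat m)"] norm_mult[of "q ^ (Suc k * m)"]
    by (intro mult_mono 1 2 3 mult_nonneg_nonneg norm_ge_zero zero_le_power of_nat_0_le_iff)
  also have "\<dots> = norm q ^ k * (2 * (real m ^ j * (norm q * exp B) ^ m))"
    by (simp only: power_mult_distrib mult_ac)
  finally show ?thesis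
    unfolding lambert_term_def Let_def p fst_conv snd_conv m_def .
qed

lemma lambert_bound_summable:
  assumes q: "norm q < 1" "q \<noteq> 0" and B: "norm q * exp B < 1"
  shows "(\<lambda>p::nat \<times> nat. norm q ^ fst p * (2 * (real (Suc (snd p)) ^ j * (norm q * exp B) ^ Suc (snd p)))) summable_on UNIV"
proof -
  let ?f = "\<lambda>k::nat. complex_of_real (norm q ^ k)"
  let ?g = "\<lambda>l::nat. complex_of_real (2 * (real (Suc l) ^ j * (norm q * exp B) ^ Suc l))"
  have nf: "norm (?f k) = norm q ^ k" for k by (simp add: norm_power)
  have ng: "norm (?g l) = 2 * (real (Suc l) ^ j * (norm q * exp B) ^ Suc l)" for l
    by (subst norm_of_real, rule abs_of_nonneg) simp
  have "(\<lambda>k. norm (?f k)) summable_on UNIV"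
    unfolding nf using q by (intro summable_nonneg_imp_summable_on summable_geometric) auto
  moreover have "(\<lambda>l. norm (?g l)) summable_on UNIV"
    unfolding ng using q B
    by (intro summable_nonneg_imp_summable_on summable_mult summable_poly_geometric) auto
  ultimately have "(\<lambda>p. norm (?f (fst p) * ?g (snd p))) summable_on UNIV \<times> UNIV"
    by (rule abs_summable_times)
  thus ?thesis unfolding norm_mult nf ng by simp
qed

lemma lambert_radius:
  assumes q: "q \<noteq> (0::complex)" and s: "norm q * exp \<bar>Re s\<bar> < 1"
  obtains r where "r > 0" "norm q * exp (\<bar>Re s\<bar> + r) < 1"
proof -
  define r where "r = (- ln (norm q) - \<bar>Re s\<bar>) / 2"
  have "norm q * exp \<bar>Re s\<bar> = exp (ln (norm q) + \<bar>Re s\<bar>)" using q by (simp add: exp_add)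
  hence "ln (norm q) + \<bar>Re s\<bar> < 0" using s by simp
  hence "r > 0" and "ln (norm q) + (\<bar>Re s\<bar> + r) < 0" by (simp_all add: r_def field_simps)
  moreover have "norm q * exp (\<bar>Re s\<bar> + r) = exp (ln (norm q) + (\<bar>Re s\<bar> + r))"
    using q by (simp add: exp_add)
  ultimately show ?thesis using that by simp
qed

lemma lambert_term_abs_summable:
  assumes q: "norm q < 1" "q \<noteq> 0" and s: "norm q * exp \<bar>Re s\<bar> < 1"
  shows "(\<lambda>p. norm (lambert_term q j p s)) summable_on UNIV"
  by (rule Infinite_Sum.abs_summable_on_comparison_test'[OF lambert_bound_summable[OF q s] lambert_term_bound[OF q(1) order.refl]])

lemma lambert_deriv:
  assumes q: "norm q < 1" "q \<noteq> 0" and s: "norm q * exp \<bar>Re s\<bar> < 1"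
  shows "(lambert q j has_field_derivative lambert q (Suc j) s) (at s)"
proof -
  obtain r where r: "r > 0" "norm q * exp (\<bar>Re s\<bar> + r) < 1" using lambert_radius[OF q(2) s] .
  show ?thesis
    unfolding lambert_def
  proof (rule has_field_derivative_infsum[OF r(1) _ lambert_bound_summable[OF q r(2)]])
    fix p :: "nat \<times> nat" and w assume "w \<in> cball s r"
    hence "\<bar>Re w - Re s\<bar> \<le> r"
      using abs_Re_le_cmod[of "w - s"] by (simp add: dist_norm norm_minus_commute)
    hence "\<bar>Re w\<bar> \<le> \<bar>Re s\<bar> + r" by linarith
    from lambert_term_bound[OF q(1) this]
    show "norm (lambert_term q j p w) \<le> norm q ^ fst p * (2 * (real (Suc (snd p)) ^ j * (norm q * exp (\<bar>Re s\<bar> + r)) ^ Suc (snd p)))" .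
    define m :: complex where "m = of_nat (Suc (snd p))"
    have m0: "m \<noteq> 0" unfolding m_def by (rule of_nat_neq_0)
    show "(lambert_term q j p has_field_derivative lambert_term q (Suc j) p w) (at w)"
    proof -
      have "((\<lambda>s. exp (m * s) + (-1) ^ j * exp (- (m * s))) has_field_derivative
          m * (exp (m * w) + (-1) ^ Suc j * exp (- (m * w)))) (at w)"
        by (auto intro!: derivative_eq_intros simp: algebra_simps)
      from DERIV_cmult[OF this, of "q ^ (Suc (fst p) * Suc (snd p)) * (m ^ j / m)"]
      show ?thesis
        unfolding lambert_term_def Let_def m_def[symmetric] by (simp add: m0 mult_ac)
    qed
  qed
qed

text \<open>
  Group the pairs \<open>(k, m)\<close> by their product.
\<close>
lemma lambert_eq_sigma:
  assumes q: "norm q < 1" "q \<noteq> 0" and j: "even j" "j > 0"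
  shows "lambert q j 0 = 2 * (\<Sum>n. of_nat (sigma (j - 1) (Suc n)) * q ^ Suc n)"
proof -
  let ?T = "SIGMA n:UNIV. {d. d dvd Suc n}"
  let ?g = "\<lambda>p. 2 * (of_nat (snd p ^ (j - 1)) * q ^ Suc (fst p))"
  have "(\<lambda>p. lambert_term q j p 0) summable_on UNIV"
    by (rule abs_summable_summable[OF lambert_term_abs_summable[OF q]]) (use q in auto)
  hence "((\<lambda>p. lambert_term q j p 0) has_sum lambert q j 0) UNIV"
    unfolding lambert_def by (rule has_sum_infsum)
  also have "?this \<longleftrightarrow> (?g has_sum lambert q j 0) ?T"
  proof (rule has_sum_reindex_bij_witness[where j = "\<lambda>p. (Suc (fst p) * Suc (snd p) - 1, Suc (snd p))"
        and i = "\<lambda>p. (Suc (fst p) div snd p - 1, snd p - 1)"])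
    fix p :: "nat \<times> nat"
    have "of_nat (Suc (snd p)) ^ j / of_nat (Suc (snd p)) = (of_nat (Suc (snd p)) :: complex) ^ (j - 1)"
      using j(2) of_nat_neq_0[where 'a = complex, of "snd p"] by (simp add: power_eq_if del: of_nat_Suc)
    moreover have "lambert_term q j p 0 = q ^ (Suc (fst p) * Suc (snd p)) * (of_nat (Suc (snd p)) ^ j / of_nat (Suc (snd p))) * 2"
      unfolding lambert_term_def Let_def using j(1) by simp
    moreover have "Suc (Suc (fst p) * Suc (snd p) - 1) = Suc (fst p) * Suc (snd p)" by simp
    ultimately show "?g (Suc (fst p) * Suc (snd p) - 1, Suc (snd p)) = lambert_term q j p 0"
      unfolding fst_conv snd_conv by (simp only: of_nat_power mult_ac)
  next
    fix p assume "p \<in> ?T"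
    then obtain n d where p: "p = (n, d)" and d: "d dvd Suc n" by auto
    then obtain e where e: "Suc n = d * e" by (elim dvdE)
    hence "d > 0" "e > 0" by (metis mult_is_0 nat.distinct(1) neq0_conv)+
    thus "(Suc (fst (Suc (fst p) div snd p - 1, snd p - 1)) * Suc (snd (Suc (fst p) div snd p - 1, snd p - 1)) - 1,
        Suc (snd (Suc (fst p) div snd p - 1, snd p - 1))) = p"
      using e unfolding p by (auto simp: mult.commute)
  qed (auto simp del: mult_Suc mult_Suc_right)
  finally have "((\<lambda>n. \<Sum>d | d dvd Suc n. 2 * (of_nat (d ^ (j - 1)) * q ^ Suc n)) has_sum lambert q j 0) UNIV"
    by (rule has_sum_SigmaD) (auto intro!: has_sum_finiteI)
  hence "(\<lambda>n. \<Sum>d | d dvd Suc n. 2 * (of_nat (d ^ (j - 1)) * q ^ Suc n)) sums lambert q j 0"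
    by (rule has_sum_imp_sums)
  also have "(\<lambda>n. \<Sum>d | d dvd Suc n. 2 * (of_nat (d ^ (j - 1)) * q ^ Suc n)) =
     (\<lambda>n. 2 * (of_nat (sigma (j - 1) (Suc n)) * q ^ Suc n))"
    by (simp add: sigma_def sum_distrib_left sum_distrib_right)
  finally have *: "(\<lambda>n. 2 * (of_nat (sigma (j - 1) (Suc n)) * q ^ Suc n)) sums lambert q j 0" .
  hence "(\<lambda>n. of_nat (sigma (j - 1) (Suc n)) * q ^ Suc n) sums (lambert q j 0 / 2)"
    using sums_divide[OF *, of 2] by simp
  hence "(\<Sum>n. of_nat (sigma (j - 1) (Suc n)) * q ^ Suc n) = lambert q j 0 / 2"
    by (rule sums_unique[symmetric])
  hence "2 * (\<Sum>n. of_nat (sigma (j - 1) (Suc n)) * q ^ Suc n) = 2 * (lambert q j 0 / 2)"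
    by (rule arg_cong)
  also have "\<dots> = lambert q j 0" by simp
  finally show ?thesis ..
qed

lemma lambert_odd_0: "odd j \<Longrightarrow> lambert q j 0 = 0"
  by (simp add: lambert_def lambert_term_def)

lemma one_minus_eq_exp:
  assumes "norm (x::complex) < 1"
  shows "((\<lambda>m. x ^ Suc m / of_nat (Suc m)) has_sum (- Ln (1 - x))) UNIV" "exp (Ln (1 - x)) = 1 - x"
proof -
  have "(\<lambda>n. - ((- (- x)) ^ n) / of_nat n) sums Ln (1 + - x)"
    by (rule Ln_series') (use assms in auto)
  hence "(\<lambda>n. x ^ n / of_nat n) sums - Ln (1 - x)"
    using sums_minus by fastforce
  hence "(\<lambda>n. x ^ Suc n / of_nat (Suc n)) sums - Ln (1 - x)"
    by (subst sums_Suc_iff) auto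
  moreover have "summable (\<lambda>n. norm (x ^ Suc n / of_nat (Suc n)))"
  proof (rule summable_comparison_test'[of "\<lambda>n. norm x ^ n"])
    show "summable (\<lambda>n. norm x ^ n)" using assms by (intro summable_geometric) auto
    fix n :: nat
    have "norm (x ^ Suc n / of_nat (Suc n)) \<le> norm x ^ Suc n"
      by (simp only: norm_divide norm_power norm_of_nat) (simp add: divide_le_eq mult_le_cancel_left1 del: power_Suc)
    also have "\<dots> \<le> norm x ^ n" using assms by (intro power_decreasing) auto
    finally show "norm (norm (x ^ Suc n / of_nat (Suc n))) \<le> norm x ^ n" by simp
  qed
  ultimately show "((\<lambda>m. x ^ Suc m / of_nat (Suc m)) has_sum (- Ln (1 - x))) UNIV"
    by (intro norm_summable_imp_has_sum)
  show "exp (Ln (1 - x)) = 1 - x" using assms by (intro exp_Ln) auto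
qed

lemma product_tendsto_exp_lambert:
  assumes q: "norm q < 1" "q \<noteq> 0" and s: "norm q * exp \<bar>Re s\<bar> < 1"
  shows "(\<lambda>N. \<Prod>i<N. (1 - exp s * q ^ Suc i) * (1 - q ^ Suc i / exp s)) \<longlonglongrightarrow> exp (- lambert q 0 s)"
proof -
  define L where "L = (\<lambda>i. Ln (1 - exp s * q ^ Suc i) + Ln (1 - q ^ Suc i / exp s))"
  have small: "norm (exp s * q ^ Suc i) < 1" "norm (q ^ Suc i / exp s) < 1" for i
  proof -
    have p: "norm (q ^ Suc i) \<le> norm q"
      using q by (simp add: norm_mult norm_power mult_left_le power_le_one)
    have "exp (Re s) \<le> exp \<bar>Re s\<bar>" "exp (- Re s) \<le> exp \<bar>Re s\<bar>" by auto
    hence "exp (Re s) * norm (q ^ Suc i) \<le> exp \<bar>Re s\<bar> * norm q"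
      "exp (- Re s) * norm (q ^ Suc i) \<le> exp \<bar>Re s\<bar> * norm q"
      using p by (intro mult_mono; simp)+
    thus "norm (exp s * q ^ Suc i) < 1" "norm (q ^ Suc i / exp s) < 1"
      using s by (simp_all add: norm_mult norm_divide norm_inverse exp_minus divide_inverse mult_ac del: power_Suc)
  qed
  have "(\<lambda>p. lambert_term q 0 p s) summable_on UNIV"
    using lambert_term_abs_summable[OF q s] by (rule abs_summable_summable)
  hence "((\<lambda>p. lambert_term q 0 p s) has_sum lambert q 0 s) (UNIV \<times> UNIV)"
    unfolding lambert_def by simp
  moreover have "((\<lambda>m. lambert_term q 0 (i, m) s) has_sum (- L i)) UNIV" for i
  proof -
    have "((\<lambda>m. (exp s * q ^ Suc i) ^ Suc m / of_nat (Suc m) + (q ^ Suc i / exp s) ^ Suc m / of_nat (Suc m)) has_sum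
       (- Ln (1 - exp s * q ^ Suc i) + - Ln (1 - q ^ Suc i / exp s))) UNIV"
      by (intro has_sum_add one_minus_eq_exp(1) small)
    also have "- Ln (1 - exp s * q ^ Suc i) + - Ln (1 - q ^ Suc i / exp s) = - L i" by (simp add: L_def)
    also have "(\<lambda>m. (exp s * q ^ Suc i) ^ Suc m / of_nat (Suc m) + (q ^ Suc i / exp s) ^ Suc m / of_nat (Suc m)) =
      (\<lambda>m. lambert_term q 0 (i, m) s)"
    proof
      fix m
      have "exp s ^ Suc m = exp (of_nat (Suc m) * s)" by (rule exp_of_nat_mult[symmetric])
      thus "(exp s * q ^ Suc i) ^ Suc m / of_nat (Suc m) + (q ^ Suc i / exp s) ^ Suc m / of_nat (Suc m) = lambert_term q 0 (i, m) s"
        unfolding lambert_term_def Let_def fst_conv snd_conv power_mult_distrib power_divide power_mult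
        by (simp add: exp_minus divide_inverse algebra_simps del: power_Suc of_nat_Suc)
    qed
    finally show ?thesis .
  qed
  ultimately have "((\<lambda>i. - L i) has_sum lambert q 0 s) UNIV"
    by (rule has_sum_SigmaD)
  hence "(\<lambda>N. \<Sum>i<N. - L i) \<longlonglongrightarrow> lambert q 0 s"
    using has_sum_imp_sums sums_def by blast
  hence "(\<lambda>N. exp (- (\<Sum>i<N. - L i))) \<longlonglongrightarrow> exp (- lambert q 0 s)"
    by (intro tendsto_intros)
  moreover have "exp (- (\<Sum>i<N. - L i)) = (\<Prod>i<N. (1 - exp s * q ^ Suc i) * (1 - q ^ Suc i / exp s))" for N
    unfolding sum_negf minus_minus exp_sum[OF finite_lessThan] L_def exp_add
    by (simp only: one_minus_eq_exp(2)[OF small(1)] one_minus_eq_exp(2)[OF small(2)])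
  ultimately show ?thesis by simp
qed

lemma triple_product_prefactor:
  fixes q Q \<zeta> t :: complex
  assumes q: "q = exp Q" and \<zeta>: "- \<zeta> = exp t"
  shows "(\<Prod>i<N. - \<zeta> / q ^ Suc i) = exp (of_nat N * t - Q * of_nat N * (of_nat N + 1) / 2)"
proof (induction N)
  case (Suc N)
  have "- \<zeta> / q ^ Suc N = exp (t - Q * of_nat (Suc N))"
  proof -
    have "q ^ Suc N = exp (Q * of_nat (Suc N))"
      unfolding q mult.commute[of Q] by (rule exp_of_nat_mult[symmetric])
    thus ?thesis by (simp only: \<zeta> exp_diff)
  qed
  thus ?case
    unfolding prod.lessThan_Suc Suc.IH by (simp add: mult_exp_exp) (rule arg_cong[of _ _ exp], simp add: field_simps)
qed auto

text \<open>
  The monomial prefactor completes the square, so that the finite product becomes a truncated theta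
  series weighted by Gaussian binomial coefficients.
\<close>
lemma finite_triple_product_theta_term:
  fixes N :: nat
  assumes Q: "Q = 2 * of_real pi * \<i> * \<tau>" and t: "t = 2 * of_real pi * \<i> * z + of_real pi * \<i>"
    and z: "\<zeta> = exp (2 * of_real pi * \<i> * z)"
  shows "exp (Q / 8 - t / 2) * (\<Prod>i<N. (1 - \<zeta> * nome \<tau> ^ i) * (1 - nome \<tau> ^ Suc i / \<zeta>)) =
    (\<Sum>j\<le>2 * N. qbin (nome \<tau>) (2 * N) j * theta_term (of_int (int j - int N) - 1 / 2) \<tau> (z + 1 / 2))"
proof -
  define q where "q = nome \<tau>"
  have q: "q = exp Q" by (simp add: q_def nome_def Q)
  have \<zeta>: "- \<zeta> = exp t" by (simp add: z t exp_add)
  have nz: "q \<noteq> 0" "\<zeta> \<noteq> 0" by (simp_all add: q z)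
  define D where "D = (\<Prod>i<N. - \<zeta> / q ^ Suc i)"
  have D: "D = exp (of_nat N * t - Q * of_nat N * (of_nat N + 1) / 2)"
    unfolding D_def by (rule triple_product_prefactor[OF q \<zeta>])
  have summand: "exp (Q / 8 - t / 2) * (q ^ (j * (j - 1) div 2) * (- \<zeta> / q ^ N) ^ j) =
     D * theta_term (of_int (int j - int N) - 1 / 2) \<tau> (z + 1 / 2)" for j
  proof -
    have "even (j * (j - 1))" by (cases j) auto
    then obtain k where k: "j * (j - 1) = 2 * k" by (elim evenE)
    have "(of_nat j :: complex) * (of_nat j - 1) = 2 * of_nat k"
      using arg_cong[OF k, of "of_nat :: nat \<Rightarrow> complex"] by (cases j) (auto simp: algebra_simps)
    hence k2: "(of_nat k :: complex) = of_nat j * (of_nat j - 1) / 2" by simp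
    have 1: "q ^ (j * (j - 1) div 2) = exp (of_nat j * (of_nat j - 1) / 2 * Q)"
      unfolding k q exp_of_nat_mult[symmetric] by (simp add: k2)
    have 2: "(- \<zeta> / q ^ N) ^ j = exp (of_nat j * (t - of_nat N * Q))"
      unfolding q \<zeta> exp_of_nat_mult exp_diff ..
    have 3: "theta_term (of_int (int j - int N) - 1 / 2) \<tau> (z + 1 / 2) =
       exp (Q / 2 * (of_nat j - of_nat N - 1 / 2) ^ 2 + t * (of_nat j - of_nat N - 1 / 2))"
      unfolding theta_term_def by (rule arg_cong[of _ _ exp]) (simp add: Q t field_simps)
    show ?thesis
      unfolding 1 2 3 D mult_exp_exp
      by (rule arg_cong[of _ _ exp]) (simp add: field_simps power2_eq_square)
  qed
  have "D * (exp (Q / 8 - t / 2) * (\<Prod>i<N. (1 - \<zeta> * q ^ i) * (1 - q ^ Suc i / \<zeta>))) =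
      exp (Q / 8 - t / 2) * ((\<Prod>i<N. (1 - \<zeta> * q ^ i) * (1 - q ^ Suc i / \<zeta>)) * D)"
    by (simp only: mult_ac)
  also have "\<dots> = exp (Q / 8 - t / 2) * (\<Sum>j\<le>2 * N. q ^ (j * (j - 1) div 2) * qbin q (2 * N) j * (- \<zeta> / q ^ N) ^ j)"
    unfolding D_def by (simp only: finite_triple_product[OF nz])
  also have "\<dots> = (\<Sum>j\<le>2 * N. qbin q (2 * N) j * (exp (Q / 8 - t / 2) * (q ^ (j * (j - 1) div 2) * (- \<zeta> / q ^ N) ^ j)))"
    unfolding sum_distrib_left by (rule sum.cong[OF refl]) (simp only: mult_ac)
  also have "\<dots> = D * (\<Sum>j\<le>2 * N. qbin q (2 * N) j * theta_term (of_int (int j - int N) - 1 / 2) \<tau> (z + 1 / 2))"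
    unfolding summand sum_distrib_left by (rule sum.cong[OF refl]) (simp only: mult_ac)
  finally show ?thesis by (simp add: D q_def)
qed

lemma nome_norm: "norm (nome \<tau>) = exp (- 2 * pi * Im \<tau>)"
  by (simp add: nome_def)

lemma nome_nonzero: "nome \<tau> \<noteq> 0"
  by (simp add: nome_def)

lemma nome_norm_less_1: "Im \<tau> > 0 \<Longrightarrow> norm (nome \<tau>) < 1"
  by (simp add: nome_norm)

lemma nome_strip:
  assumes "\<bar>Im z\<bar> < Im \<tau>"
  shows "norm (nome \<tau>) * exp \<bar>Re (2 * of_real pi * \<i> * z)\<bar> < 1"
proof -
  have "\<bar>Re (2 * of_real pi * \<i> * z)\<bar> = 2 * pi * \<bar>Im z\<bar>" by (simp add: abs_mult)
  thus ?thesis using assms by (simp add: nome_norm mult_exp_exp)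
qed

text \<open>
  The Jacobi triple product. As \<open>C\<close> is constant in \<open>z\<close>, it shows the logarithmic derivative in \<open>z\<close>
  and the zeros. The strip \<open>\<bar>Im z\<bar> < Im \<tau>\<close> contains the zero
  \<open>z = 0\<close> and the points at which the even theta constants are values of \<open>\<theta>\<^sub>1\<close>.
\<close>
lemma theta_product:
  assumes \<tau>: "Im \<tau> > 0"
  obtains C where "C \<noteq> 0" "\<And>z. \<bar>Im z\<bar> < Im \<tau> \<Longrightarrow> theta 0 (1 / 2) \<tau> (z + 1 / 2) =
     C * (exp (of_real pi * \<i> * z) - exp (- (of_real pi * \<i> * z))) * exp (- lambert (nome \<tau>) 0 (2 * of_real pi * \<i> * z))"
proof -
  define q where "q = nome \<tau>"
  have q: "norm q < 1" "q \<noteq> 0" using nome_norm_less_1[OF \<tau>] nome_nonzero by (auto simp: q_def)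
  obtain C K where C: "C \<noteq> 0"
    "\<And>n::int. (\<lambda>N. if \<bar>n\<bar> \<le> int N then qbin q (2 * N) (nat (int N + n)) else 0) \<longlonglongrightarrow> C"
    "\<And>N (n::int). norm (if \<bar>n\<bar> \<le> int N then qbin q (2 * N) (nat (int N + n)) else 0) \<le> K"
    using central_qbin[OF q(1)] by blast
  let ?b = "\<lambda>N (n::int). if \<bar>n\<bar> \<le> int N then qbin q (2 * N) (nat (int N + n)) else 0"
  define Q where "Q = 2 * of_real pi * \<i> * \<tau>"
  show ?thesis
  proof (rule that[of "- exp (Q / 8 - of_real pi * \<i> / 2) / C"])
    fix z assume z: "\<bar>Im z\<bar> < Im \<tau>"
    define s where "s = 2 * of_real pi * \<i> * z"
    define t where "t = s + of_real pi * \<i>"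
    define F where "F = (\<lambda>N. \<Prod>i<N. (1 - exp s * q ^ i) * (1 - q ^ Suc i / exp s))"
    define G where "G = (\<lambda>N. \<Prod>i<N. (1 - exp s * q ^ Suc i) * (1 - q ^ Suc i / exp s))"
    define g where "g = (\<lambda>n::int. theta_term (of_int n - 1 / 2) \<tau> (z + 1 / 2))"
    have gs: "(\<lambda>n. norm (g n)) summable_on UNIV"
      using theta_term_abs_summable[OF \<tau>, of "- 1 / 2" 0 "z + 1 / 2"] by (simp add: g_def)
    have fin: "exp (Q / 8 - t / 2) * F N = (\<Sum>\<^sub>\<infinity>n. ?b N n * g n)" for N
    proof -
      have "(\<Sum>\<^sub>\<infinity>n. ?b N n * g n) = (\<Sum>\<^sub>\<infinity>n\<in>{- int N..int N}. ?b N n * g n)"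
        by (rule infsum_cong_neutral) auto
      also have "\<dots> = (\<Sum>n\<in>{- int N..int N}. ?b N n * g n)" by simp
      also have "\<dots> = (\<Sum>j\<le>2 * N. qbin q (2 * N) j * g (int j - int N))"
        by (rule sum.reindex_bij_witness[where i = "\<lambda>j. int j - int N" and j = "\<lambda>n. nat (int N + n)"]) auto
      also have "\<dots> = exp (Q / 8 - t / 2) * F N"
        unfolding g_def F_def q_def
        by (rule finite_triple_product_theta_term[symmetric]) (simp_all add: Q_def t_def s_def)
      finally show ?thesis ..
    qed
    have "(\<lambda>N. \<Sum>\<^sub>\<infinity>n. ?b N n * g n) \<longlonglongrightarrow> (\<Sum>\<^sub>\<infinity>n. C * g n)"
    proof (rule infsum_dominated_convergence[where M = "\<lambda>n. K * norm (g n)"])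
      show "(\<lambda>n. K * norm (g n)) summable_on UNIV" using gs by (rule summable_on_cmult_right)
      show "norm (?b N n * g n) \<le> K * norm (g n)" for N n
        unfolding norm_mult by (rule mult_right_mono[OF C(3)]) simp
      show "(\<lambda>N. ?b N n * g n) \<longlonglongrightarrow> C * g n" for n
        by (rule tendsto_mult_right[OF C(2)])
    qed
    also have "(\<Sum>\<^sub>\<infinity>n. C * g n) = C * theta 0 (1 / 2) \<tau> (z + 1 / 2)"
      using theta_shift[of 0 "- 1 / 2" \<tau> "z + 1 / 2"] by (simp add: infsum_cmult_right' theta_def g_def)
    finally have lim: "(\<lambda>N. exp (Q / 8 - t / 2) * F N) \<longlonglongrightarrow> C * theta 0 (1 / 2) \<tau> (z + 1 / 2)"
      by (simp only: fin)
    have "(\<lambda>N. exp s * q ^ N) \<longlonglongrightarrow> exp s * 0"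
      using q by (intro tendsto_mult_left LIMSEQ_power_zero)
    hence "(\<lambda>N. exp (Q / 8 - t / 2) * F N * (1 - exp s * q ^ N)) \<longlonglongrightarrow> C * theta 0 (1 / 2) \<tau> (z + 1 / 2) * (1 - exp s * 0)"
      by (rule tendsto_mult[OF lim tendsto_diff[OF tendsto_const]])
    moreover have "exp (Q / 8 - t / 2) * F N * (1 - exp s * q ^ N) = exp (Q / 8 - t / 2) * (1 - exp s) * G N" for N
    proof -
      \<comment> \<open>Shifting the index splits off the factor that vanishes at \<open>z = 0\<close>.\<close>
      have "(\<Prod>i<N. 1 - exp s * q ^ i) * (1 - exp s * q ^ N) = (1 - exp s) * (\<Prod>i<N. 1 - exp s * q ^ Suc i)"
        using prod.lessThan_Suc_shift[of "\<lambda>i. 1 - exp s * q ^ i" N] by simp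
      thus ?thesis unfolding F_def G_def prod.distrib by (simp add: mult_ac)
    qed
    ultimately have "(\<lambda>N. exp (Q / 8 - t / 2) * (1 - exp s) * G N) \<longlonglongrightarrow> C * theta 0 (1 / 2) \<tau> (z + 1 / 2)"
      by simp
    moreover have "(\<lambda>N. exp (Q / 8 - t / 2) * (1 - exp s) * G N) \<longlonglongrightarrow> exp (Q / 8 - t / 2) * (1 - exp s) * exp (- lambert q 0 s)"
      unfolding G_def using nome_strip[OF z]
      by (intro tendsto_mult_left product_tendsto_exp_lambert q) (simp add: q_def s_def)
    ultimately have "C * theta 0 (1 / 2) \<tau> (z + 1 / 2) = exp (Q / 8 - t / 2) * (1 - exp s) * exp (- lambert q 0 s)"
      by (rule LIMSEQ_unique)
    moreover have "exp (Q / 8 - t / 2) * (1 - exp s) = - exp (Q / 8 - of_real pi * \<i> / 2) *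
       (exp (of_real pi * \<i> * z) - exp (- (of_real pi * \<i> * z)))"
    proof -
      have "exp (Q / 8 - t / 2) = exp (Q / 8 - of_real pi * \<i> / 2) * exp (- (of_real pi * \<i> * z))"
        unfolding mult_exp_exp by (rule arg_cong[of _ _ exp]) (simp add: t_def s_def field_simps)
      moreover have "exp (- (of_real pi * \<i> * z)) * (1 - exp s) = - (exp (of_real pi * \<i> * z) - exp (- (of_real pi * \<i> * z)))"
        by (simp add: right_diff_distrib mult_exp_exp s_def mult_ac)
      ultimately show ?thesis by (simp add: mult.assoc right_diff_distrib)
    qed
    ultimately have "C * theta 0 (1 / 2) \<tau> (z + 1 / 2) = - exp (Q / 8 - of_real pi * \<i> / 2) *
       (exp (of_real pi * \<i> * z) - exp (- (of_real pi * \<i> * z))) * exp (- lambert q 0 s)"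
      by (simp only:)
    hence "theta 0 (1 / 2) \<tau> (z + 1 / 2) = (- exp (Q / 8 - of_real pi * \<i> / 2) *
       (exp (of_real pi * \<i> * z) - exp (- (of_real pi * \<i> * z))) * exp (- lambert q 0 s)) / C"
      using C(1) by (metis nonzero_mult_div_cancel_left)
    thus "theta 0 (1 / 2) \<tau> (z + 1 / 2) = - exp (Q / 8 - of_real pi * \<i> / 2) / C *
        (exp (of_real pi * \<i> * z) - exp (- (of_real pi * \<i> * z))) * exp (- lambert (nome \<tau>) 0 (2 * of_real pi * \<i> * z))"
      unfolding q_def s_def by simp
  qed (use C in auto)
qed

section \<open>Eisenstein series as Taylor coefficients\<close>

text \<open>
  In the strip the exponential factor has no zeros, so \<open>\<theta>\<^sub>1\<close> vanishes only where \<open>sin (\<pi> z)\<close> does.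
\<close>
lemma theta_half_nonzero:
  assumes \<tau>: "Im \<tau> > 0" and z: "\<bar>Im z\<bar> < Im \<tau>" "exp (2 * of_real pi * \<i> * z) \<noteq> 1"
  shows "theta 0 (1 / 2) \<tau> (z + 1 / 2) \<noteq> 0"
proof -
  obtain C where C: "C \<noteq> 0" "\<And>z. \<bar>Im z\<bar> < Im \<tau> \<Longrightarrow> theta 0 (1 / 2) \<tau> (z + 1 / 2) =
     C * (exp (of_real pi * \<i> * z) - exp (- (of_real pi * \<i> * z))) * exp (- lambert (nome \<tau>) 0 (2 * of_real pi * \<i> * z))"
    using theta_product[OF \<tau>] by blast
  have "exp (of_real pi * \<i> * z) \<noteq> exp (- (of_real pi * \<i> * z))"
  proof
    assume "exp (of_real pi * \<i> * z) = exp (- (of_real pi * \<i> * z))"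
    hence "exp (of_real pi * \<i> * z) * exp (of_real pi * \<i> * z) = 1"
      by (metis exp_minus_inverse)
    also have "exp (of_real pi * \<i> * z) * exp (of_real pi * \<i> * z) = exp (2 * of_real pi * \<i> * z)"
      unfolding mult_exp_exp by (rule arg_cong[of _ _ exp]) simp
    finally show False using z by simp
  qed
  thus ?thesis using C z by simp
qed

text \<open>
  Shifting \<open>z\<close> by half a period turns \<open>\<theta>\<^sub>3(0)\<close> and \<open>\<theta>\<^sub>4(0)\<close> into values of \<open>\<theta>\<^sub>1\<close> inside the strip of
  \<open>theta_half_nonzero\<close>.
\<close>
lemma theta_half_minus_half_period:
  "theta 0 (1 / 2) \<tau> (z - \<tau> / 2) = exp (of_real pi * \<i> * z - of_real pi * \<i> * \<tau> / 4) * theta 0 0 \<tau> z"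
proof -
  have "theta_term (of_int n + 1 / 2) \<tau> (z - \<tau> / 2) = exp (of_real pi * \<i> * z - of_real pi * \<i> * \<tau> / 4) * theta_term (of_int n) \<tau> z" for n
    unfolding theta_term_def mult_exp_exp
    by (rule arg_cong[of _ _ exp]) (simp add: field_simps power2_eq_square)
  thus ?thesis by (simp add: theta_def infsum_cmult_right')
qed

lemma theta_2_nonzero: "Im \<tau> > 0 \<Longrightarrow> theta 0 (1 / 2) \<tau> 0 \<noteq> 0"
  using theta_half_nonzero[of \<tau> "- 1 / 2"] by (simp add: exp_minus)

lemma theta_3_nonzero:
  assumes \<tau>: "Im \<tau> > 0"
  shows "theta 0 0 \<tau> 0 \<noteq> 0"
proof -
  have "norm (exp (2 * of_real pi * \<i> * (- \<tau> / 2 - 1 / 2))) = exp (pi * Im \<tau>)"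
    by simp
  hence "exp (2 * of_real pi * \<i> * (- \<tau> / 2 - 1 / 2)) \<noteq> 1"
    using \<tau> by (metis exp_eq_one_iff mult_pos_pos norm_one order_less_irrefl pi_gt_zero)
  thus ?thesis
    using theta_half_nonzero[OF \<tau>, of "- \<tau> / 2 - 1 / 2"] theta_half_minus_half_period[of \<tau> 0] \<tau> by simp
qed

lemma theta_4_nonzero:
  assumes \<tau>: "Im \<tau> > 0"
  shows "theta 0 0 \<tau> (1 / 2) \<noteq> 0"
proof -
  have "norm (exp (2 * of_real pi * \<i> * (- \<tau> / 2))) = exp (pi * Im \<tau>)"
    by simp
  hence "exp (2 * of_real pi * \<i> * (- \<tau> / 2)) \<noteq> 1"
    using \<tau> by (metis exp_eq_one_iff mult_pos_pos norm_one order_less_irrefl pi_gt_zero)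
  thus ?thesis
    using theta_half_nonzero[OF \<tau>, of "- \<tau> / 2"] theta_half_minus_half_period[of \<tau> "1 / 2"] \<tau>
    by (simp add: add.commute)
qed

lemma theta_half_minus_half: "theta j (1 / 2) \<tau> (- 1 / 2) = - theta j (1 / 2) \<tau> (1 / 2)"
  using theta_add_1[of j "1 / 2" \<tau> "- 1 / 2"] by simp

lemma theta_1_even:
  assumes "even j" shows "theta j (1 / 2) \<tau> (1 / 2) = 0"
proof -
  have "theta j (1 / 2) \<tau> (- 1 / 2) = theta j (1 / 2) \<tau> (1 / 2)"
    using theta_neg[of j "1 / 2" \<tau> "1 / 2"] theta_shift[of j "- 1 / 2" \<tau> "- 1 / 2"] assms by simp
  thus ?thesis unfolding theta_half_minus_half by simp
qed

lemma theta_2_odd: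
  assumes "odd j" shows "theta j (1 / 2) \<tau> 0 = 0"
  using theta_neg[of j "1 / 2" \<tau> 0] theta_shift[of j "- 1 / 2" \<tau> 0] assms by simp

lemma theta_0_minus_half: "theta j 0 \<tau> (- 1 / 2) = theta j 0 \<tau> (1 / 2)"
  using theta_add_1[of j 0 \<tau> "- 1 / 2"] by simp

lemma theta_three_quarters: "theta j (3 / 4) \<tau> 0 = (-1) ^ j * theta j (1 / 4) \<tau> 0"
  using theta_neg[of j "1 / 4" \<tau> 0] theta_shift[of j "- 1 / 4" \<tau> 0] by simp

lemma theta_1_deriv_nonzero:
  assumes \<tau>: "Im \<tau> > 0"
  shows "theta 1 (1 / 2) \<tau> (1 / 2) \<noteq> 0"
proof -
  obtain C where C: "C \<noteq> 0" "\<And>z. \<bar>Im z\<bar> < Im \<tau> \<Longrightarrow> theta 0 (1 / 2) \<tau> (z + 1 / 2) =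
     C * (exp (of_real pi * \<i> * z) - exp (- (of_real pi * \<i> * z))) * exp (- lambert (nome \<tau>) 0 (2 * of_real pi * \<i> * z))"
    using theta_product[OF \<tau>] by blast
  let ?f = "\<lambda>z. C * (exp (of_real pi * \<i> * z) - exp (- (of_real pi * \<i> * z))) * exp (- lambert (nome \<tau>) 0 (2 * of_real pi * \<i> * z))"
  have l: "((\<lambda>z. lambert (nome \<tau>) 0 (2 * of_real pi * \<i> * z)) has_field_derivative
        lambert (nome \<tau>) (Suc 0) 0 * (2 * of_real pi * \<i>)) (at 0)"
    using \<tau> by (intro DERIV_chain2[of "lambert (nome \<tau>) 0"])
      (auto intro!: derivative_eq_intros lambert_deriv nome_norm_less_1 nome_nonzero simp: nome_norm_less_1)
  have "(?f has_field_derivative C * (2 * of_real pi * \<i>) * exp (- lambert (nome \<tau>) 0 0)) (at 0)"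
    by (rule derivative_eq_intros refl l | simp)+
  moreover have "eventually (\<lambda>z. theta 0 (1 / 2) \<tau> (z + 1 / 2) = ?f z) (nhds 0)"
  proof (rule eventually_nhds_in_open[THEN eventually_mono, of "{z. \<bar>Im z\<bar> < Im \<tau>}"])
    show "open {z. \<bar>Im z\<bar> < Im \<tau>}" by (intro open_Collect_less continuous_intros)
  qed (use \<tau> C(2) in auto)
  ultimately have "((\<lambda>z. theta 0 (1 / 2) \<tau> (z + 1 / 2)) has_field_derivative C * (2 * of_real pi * \<i>) * exp (- lambert (nome \<tau>) 0 0)) (at 0)"
    by (subst DERIV_cong_ev[OF refl _ refl])
  moreover have "((\<lambda>z. theta 0 (1 / 2) \<tau> (z + 1 / 2)) has_field_derivative 2 * of_real pi * \<i> * theta 1 (1 / 2) \<tau> (1 / 2)) (at 0)"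
    using theta_deriv_z[OF \<tau>, of 0 "1 / 2" "1 / 2"] DERIV_shift[of "theta 0 (1 / 2) \<tau>" _ 0 "1 / 2"] by simp
  ultimately have "C * (2 * of_real pi * \<i>) * exp (- lambert (nome \<tau>) 0 0) = 2 * of_real pi * \<i> * theta 1 (1 / 2) \<tau> (1 / 2)"
    by (rule DERIV_unique)
  thus ?thesis using C(1) by auto
qed

lemma has_fps_expansion_deriv_chain:
  fixes g :: "nat \<Rightarrow> complex \<Rightarrow> complex"
  assumes S: "open S" "0 \<in> S"
    and g: "\<And>j s. s \<in> S \<Longrightarrow> (g j has_field_derivative g (Suc j) s) (at s)"
  shows "g 0 has_fps_expansion Abs_fps (\<lambda>n. g n 0 / fact n)"
proof -
  have "g 0 holomorphic_on S"
    using g S(1) by (auto simp: holomorphic_on_open)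
  hence F: "g 0 has_fps_expansion fps_expansion (g 0) 0"
    using S by blast
  have "\<forall>s\<in>S. (deriv ^^ n) (g 0) s = g n s" for n
  proof (induction n)
    case (Suc n)
    show ?case
    proof
      fix s assume s: "s \<in> S"
      have "eventually (\<lambda>w. (deriv ^^ n) (g 0) w = g n w) (nhds s)"
        using eventually_nhds_in_open[OF S(1) s] Suc.IH by (auto elim: eventually_mono)
      hence "deriv ((deriv ^^ n) (g 0)) s = deriv (g n) s" by (rule deriv_cong_ev) simp
      thus "(deriv ^^ Suc n) (g 0) s = g (Suc n) s" using DERIV_imp_deriv[OF g[OF s]] by simp
    qed
  qed auto
  hence "fps_expansion (g 0) 0 = Abs_fps (\<lambda>n. g n 0 / fact n)"
    using S by (simp add: fps_expansion_def)
  with F show ?thesis by simp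
qed

definition theta_fps :: "complex \<Rightarrow> complex fps" where
  "theta_fps \<tau> = Abs_fps (\<lambda>n. theta n (1 / 2) \<tau> (1 / 2) / fact n)"

text \<open>
  The logarithmic derivative of the triple product in \<open>s = 2 \<pi> \<i> z\<close>, multiplied out so that no pole
  at \<open>s = 0\<close> occurs.
\<close>
lemma theta_fps_ode:
  assumes \<tau>: "Im \<tau> > 0"
  defines "A \<equiv> fps_exp (1 / 2) - fps_exp (- 1 / 2 :: complex)" and "B \<equiv> fps_exp (1 / 2) + fps_exp (- 1 / 2 :: complex)"
  shows "fps_deriv (theta_fps \<tau>) * A = theta_fps \<tau> *
    (fps_const (1 / 2) * B - A * Abs_fps (\<lambda>n. lambert (nome \<tau>) (Suc n) 0 / fact n))"
proof -
  define q where "q = nome \<tau>"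
  have q: "norm q < 1" "q \<noteq> 0" using nome_norm_less_1[OF \<tau>] nome_nonzero by (auto simp: q_def)
  define c where "c = 2 * of_real pi * \<i>"
  have c: "c \<noteq> 0" by (simp add: c_def)
  define T where "T = (\<lambda>j s. theta j (1 / 2) \<tau> (s / c + 1 / 2))"
  define S where "S = {s. norm q * exp \<bar>Re s\<bar> < 1}"
  have S: "open S" "0 \<in> S"
    unfolding S_def using q by (auto intro!: open_Collect_less continuous_intros)
  have dT: "(T j has_field_derivative T (Suc j) s) (at s)" for j s
  proof -
    have "((\<lambda>s. s / c + 1 / 2) has_field_derivative 1 / c) (at s)"
      using c by (auto intro!: derivative_eq_intros)
    from DERIV_chain2[OF theta_deriv_z[OF \<tau>, of j "1 / 2" "s / c + 1 / 2"] this]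
    show ?thesis unfolding T_def c_def[symmetric] using c by simp
  qed
  have dl: "(lambert q j has_field_derivative lambert q (Suc j) s) (at s)" if "s \<in> S" for j s
    using q that by (intro lambert_deriv) (auto simp: S_def)
  have FT: "T 0 has_fps_expansion theta_fps \<tau>"
    using has_fps_expansion_deriv_chain[OF S, of T] dT by (simp add: theta_fps_def T_def)
  have FL: "lambert q (Suc 0) has_fps_expansion Abs_fps (\<lambda>n. lambert q (Suc n) 0 / fact n)"
    using has_fps_expansion_deriv_chain[OF S, of "\<lambda>j. lambert q (Suc j)"] dl by simp
  obtain C where C: "C \<noteq> 0" "\<And>z. \<bar>Im z\<bar> < Im \<tau> \<Longrightarrow> theta 0 (1 / 2) \<tau> (z + 1 / 2) =
     C * (exp (of_real pi * \<i> * z) - exp (- (of_real pi * \<i> * z))) * exp (- lambert (nome \<tau>) 0 (2 * of_real pi * \<i> * z))"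
    using theta_product[OF \<tau>] by blast
  let ?a = "\<lambda>s. exp (1 / 2 * s) - exp (- 1 / 2 * s)" and ?b = "\<lambda>s. exp (1 / 2 * s) + exp (- 1 / 2 * s)"
  have T0: "T 0 s = C * ?a s * exp (- lambert q 0 s)" if s: "s \<in> S" for s
  proof -
    have "exp (- 2 * pi * Im \<tau> + \<bar>Re s\<bar>) < exp 0"
      using s by (simp add: S_def q_def nome_norm mult_exp_exp)
    hence "\<bar>Re s\<bar> < 2 * pi * Im \<tau>" by (simp only: exp_less_cancel_iff)
    moreover have "\<bar>Im (s / c)\<bar> = \<bar>Re s\<bar> / (2 * pi)"
      by (simp add: c_def Im_divide power2_eq_square field_simps)
    ultimately have "\<bar>Im (s / c)\<bar> < Im \<tau>"
      by (simp add: divide_less_eq mult.commute mult.left_commute)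
    moreover have "- 1 / 2 * s = - (1 / 2 * s)" by simp
    moreover have "of_real pi * \<i> * (s / c) = 1 / 2 * s" "2 * of_real pi * \<i> * (s / c) = s"
      by (simp_all add: c_def)
    ultimately show ?thesis using C(2)[of "s / c"] unfolding T_def q_def by (simp only:)
  qed
  have ode: "T 1 s * ?a s = T 0 s * (1 / 2 * ?b s - ?a s * lambert q (Suc 0) s)" if s: "s \<in> S" for s
  proof -
    have "((\<lambda>s. C * ?a s * exp (- lambert q 0 s)) has_field_derivative
      C * (1 / 2 * ?b s) * exp (- lambert q 0 s) - C * ?a s * exp (- lambert q 0 s) * lambert q (Suc 0) s) (at s)"
      by (rule derivative_eq_intros refl dl s | simp add: algebra_simps)+
    moreover have "eventually (\<lambda>s. T 0 s = C * ?a s * exp (- lambert q 0 s)) (nhds s)"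
      using eventually_nhds_in_open[OF S(1) s] T0 by (auto elim: eventually_mono)
    ultimately have "(T 0 has_field_derivative
      C * (1 / 2 * ?b s) * exp (- lambert q 0 s) - C * ?a s * exp (- lambert q 0 s) * lambert q (Suc 0) s) (at s)"
      by (subst DERIV_cong_ev[OF refl _ refl])
    from DERIV_unique[OF dT this] have "T (Suc 0) s = C * (1 / 2 * ?b s) * exp (- lambert q 0 s) - C * ?a s * exp (- lambert q 0 s) * lambert q (Suc 0) s" .
    note T1 = this
    show ?thesis unfolding One_nat_def T1 T0[OF s] by (simp add: field_simps)
  qed
  have "deriv (T 0) = T 1"
    using DERIV_imp_deriv[OF dT] by auto
  hence FT1: "T 1 has_fps_expansion fps_deriv (theta_fps \<tau>)"
    using has_fps_expansion_deriv[OF FT] by simp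
  have FA: "?a has_fps_expansion A" and FB: "?b has_fps_expansion B"
    unfolding A_def B_def by (intro fps_expansion_intros)+
  have L: "(\<lambda>s. T 1 s * ?a s) has_fps_expansion fps_deriv (theta_fps \<tau>) * A"
    by (intro fps_expansion_intros FT1 FA)
  have R: "(\<lambda>s. T 0 s * (1 / 2 * ?b s - ?a s * lambert q (Suc 0) s)) has_fps_expansion
     theta_fps \<tau> * (fps_const (1 / 2) * B - A * Abs_fps (\<lambda>n. lambert q (Suc n) 0 / fact n))"
    by (intro fps_expansion_intros FT FA FB FL)
  have "eventually (\<lambda>s. T 1 s * ?a s = T 0 s * (1 / 2 * ?b s - ?a s * lambert q (Suc 0) s)) (nhds 0)"
    using eventually_nhds_in_open[OF S] ode by (auto elim: eventually_mono)
  hence "(\<lambda>s. T 1 s * ?a s) has_fps_expansion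
     theta_fps \<tau> * (fps_const (1 / 2) * B - A * Abs_fps (\<lambda>n. lambert q (Suc n) 0 / fact n))"
    using R by (subst has_fps_expansion_cong[OF _ refl])
  from fps_expansion_unique_complex[OF L this] show ?thesis by (simp add: q_def)
qed

text \<open>
  Comparison of the coefficients of \<open>s\<^sup>3\<close>, \<open>s\<^sup>5\<close> and \<open>s\<^sup>7\<close> in \<open>theta_fps_ode\<close>. They
  express the Laurent coefficients of the logarithmic derivative of \<open>\<theta>\<^sub>1\<close> in two ways.
\<close>
lemma theta_fps_coeffs:
  assumes \<tau>: "Im \<tau> > 0"
  defines "m \<equiv> \<lambda>j. theta j (1 / 2) \<tau> (1 / 2)" and "L \<equiv> \<lambda>j. lambert (nome \<tau>) j 0"
  shows "m 3 = m 1 * (1 / 4 - 3 * L 2)"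
    and "m 1 ^ 2 * (1 + 120 * L 4) = 40 * m 3 ^ 2 - 24 * m 5 * m 1"
    and "m 1 ^ 3 * (1 - 252 * L 6) = 36 * m 7 * m 1 ^ 2 - 252 * m 3 * m 5 * m 1 + 280 * m 3 ^ 3"
proof -
  define F where "F = Abs_fps (\<lambda>n. L (Suc n) / fact n)"
  have T: "fps_nth (theta_fps \<tau>) n = m n / fact n" for n
    by (simp add: theta_fps_def m_def)
  have F: "fps_nth F n = L (Suc n) / fact n" for n
    by (simp add: F_def)
  have m0: "m 0 = 0" "m 2 = 0" "m 4 = 0" "m 6 = 0" "m 8 = 0"
    unfolding m_def by (rule theta_1_even; simp)+
  have L0: "L 1 = 0" "L 3 = 0" "L 5 = 0" "L 7 = 0"
    unfolding L_def by (rule lambert_odd_0; simp)+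
  have eq: "fps_nth (fps_deriv (theta_fps \<tau>) * (fps_exp (1 / 2) - fps_exp (- 1 / 2))) n =
     fps_nth (theta_fps \<tau> * (fps_const (1 / 2) * (fps_exp (1 / 2) + fps_exp (- 1 / 2)) - (fps_exp (1 / 2) - fps_exp (- 1 / 2)) * F)) n" for n
    using theta_fps_ode[OF \<tau>] by (simp add: F_def L_def)
  note m0' = m0[unfolded eval_nat_numeral BitM.simps numeral_One One_nat_def] and L0' = L0[unfolded eval_nat_numeral BitM.simps numeral_One One_nat_def]
  note simps = m0' L0' fps_mult_nth T F eval_nat_numeral sum.atLeast0_atMost_Suc fact_numeral
  have e3: "m 1 / 24 + m 3 / 2 = m 1 * (1 / 8 - L 2) + m 3 / 6"
    using eq[of 3] by (simp add: simps)
  have e5: "m 1 / 1920 + m 3 / 48 + m 5 / 24 =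
      m 1 * (1 / 384 - (L 4 / 6 + L 2 / 24)) + m 3 * (1 / 8 - L 2) / 6 + m 5 / 120"
    using eq[of 5] by (simp add: simps)
  have e7: "m 1 / 322560 + m 3 / 3840 + m 5 / 576 + m 7 / 720 =
      m 1 * (1 / 46080 - (L 6 / 120 + L 4 / 144 + L 2 / 1920)) +
      m 3 * (1 / 384 - (L 4 / 6 + L 2 / 24)) / 6 + m 5 * (1 / 8 - L 2) / 120 + m 7 / 5040"
    using eq[of 7] by (simp add: simps)
  show "m 3 = m 1 * (1 / 4 - 3 * L 2)"
    using e3 by algebra
  define a b c d x y l where short: "a = m 1" "b = m 3" "c = m 5" "d = m 7" "x = L 2" "y = L 4" "l = L 6"
  note e3 = e3[folded short] and e5 = e5[folded short] and e7 = e7[folded short]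
  have "a * x = a * x + (a * (1 / 8 - x) + b / 6 - (a / 24 + b / 2))"
    unfolding e3 by simp
  also have "\<dots> = a / 12 - b / 3"
    by (simp add: field_simps)
  finally have ax: "a * x = a / 12 - b / 3" .
  have "a * y = a * y + 6 * (a * (1 / 384 - (y / 6 + x / 24)) + b * (1 / 8 - x) / 6 + c / 120 - (a / 1920 + b / 48 + c / 24))"
    unfolding e5 by simp
  also have "\<dots> = a / 80 - (a * x) / 4 - b * x - c / 5"
    by (simp add: field_simps)
  finally have ay: "a * y = a / 80 - (a * x) / 4 - b * x - c / 5" .
  have "a\<^sup>2 * (1 + 120 * y) = a\<^sup>2 + 120 * a * (a * y)"
    by (simp add: power2_eq_square algebra_simps)
  also have "\<dots> = a\<^sup>2 + 120 * (a\<^sup>2 / 80 - a * (a * x) / 4 - b * (a * x) - a * c / 5)"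
    unfolding ay by (simp add: power2_eq_square algebra_simps)
  also have "\<dots> = 40 * b\<^sup>2 - 24 * c * a"
    unfolding ax by (simp add: power2_eq_square field_simps)
  finally have E4: "a\<^sup>2 * (1 + 120 * y) = 40 * b\<^sup>2 - 24 * c * a" .
  thus "m 1 ^ 2 * (1 + 120 * L 4) = 40 * m 3 ^ 2 - 24 * m 5 * m 1"
    unfolding short .
  have "a\<^sup>2 * y = (a\<^sup>2 * (1 + 120 * y) - a\<^sup>2) / 120" by (simp add: algebra_simps)
  hence ay2: "a\<^sup>2 * y = (40 * b\<^sup>2 - 24 * c * a - a\<^sup>2) / 120" unfolding E4 .
  have "a * l = a * l + 120 * (a * (1 / 46080 - (l / 120 + y / 144 + x / 1920)) +
      b * (1 / 384 - (y / 6 + x / 24)) / 6 + c * (1 / 8 - x) / 120 + d / 5040 - (a / 322560 + b / 3840 + c / 576 + d / 720))"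
    unfolding e7 by simp
  also have "\<dots> = 120 * (a / 53760 - a * y / 144 - a * x / 1920 + b / 5760 - b * y / 36 - b * x / 144 - c / 1440 - c * x / 120 - d / 840)"
    by (simp add: field_simps)
  finally have al: "a * l = 120 * (a / 53760 - a * y / 144 - a * x / 1920 + b / 5760 - b * y / 36 - b * x / 144 - c / 1440 - c * x / 120 - d / 840)" .
  have "a ^ 3 * (1 - 252 * l) = a ^ 3 - 252 * (a\<^sup>2 * (a * l))"
    by (simp add: power2_eq_square power3_eq_cube algebra_simps)
  also have "a\<^sup>2 * (a * l) = 120 * (a ^ 3 / 53760 - a * (a\<^sup>2 * y) / 144 - a\<^sup>2 * (a * x) / 1920 + a\<^sup>2 * b / 5760
      - b * (a\<^sup>2 * y) / 36 - a * b * (a * x) / 144 - a\<^sup>2 * c / 1440 - a * c * (a * x) / 120 - a\<^sup>2 * d / 840)"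
    unfolding al by (simp add: power2_eq_square power3_eq_cube algebra_simps)
  also have "a ^ 3 - 252 * \<dots> = 36 * d * a ^ 2 - 252 * b * c * a + 280 * b ^ 3"
    unfolding ax ay2 by (simp add: power2_eq_square power3_eq_cube field_simps)
  finally show "m 1 ^ 3 * (1 - 252 * L 6) = 36 * m 7 * m 1 ^ 2 - 252 * m 3 * m 5 * m 1 + 280 * m 3 ^ 3"
    unfolding short .
qed

lemma eisenstein_theta:
  assumes \<tau>: "Im \<tau> > 0"
  defines "m \<equiv> \<lambda>j. theta j (1 / 2) \<tau> (1 / 2)"
  shows "m 3 = - 6 * G2 \<tau> * m 1"
    and "m 1 ^ 2 * E4 \<tau> = 40 * m 3 ^ 2 - 24 * m 5 * m 1"
    and "m 1 ^ 3 * E6 \<tau> = 36 * m 7 * m 1 ^ 2 - 252 * m 3 * m 5 * m 1 + 280 * m 3 ^ 3"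
proof -
  note q = nome_norm_less_1[OF \<tau>] nome_nonzero[of \<tau>]
  note c = theta_fps_coeffs[OF \<tau>]
  have "G2 \<tau> = - 1 / 24 + lambert (nome \<tau>) 2 0 / 2"
    unfolding G2_def by (subst lambert_eq_sigma[OF q]) auto
  hence "lambert (nome \<tau>) 2 0 = 2 * G2 \<tau> + 1 / 12" by simp
  with c(1) have "m 3 = m 1 * (1 / 4 - 3 * (2 * G2 \<tau> + 1 / 12))"
    unfolding m_def by simp
  thus "m 3 = - 6 * G2 \<tau> * m 1"
    by (simp add: algebra_simps)
  have "E4 \<tau> = 1 + 120 * lambert (nome \<tau>) 4 0"
    unfolding E4_def by (subst lambert_eq_sigma[OF q]) auto
  thus "m 1 ^ 2 * E4 \<tau> = 40 * m 3 ^ 2 - 24 * m 5 * m 1"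
    using c(2) unfolding m_def by simp
  have "E6 \<tau> = 1 - 252 * lambert (nome \<tau>) 6 0"
    unfolding E6_def by (subst lambert_eq_sigma[OF q]) auto
  thus "m 1 ^ 3 * E6 \<tau> = 36 * m 7 * m 1 ^ 2 - 252 * m 3 * m 5 * m 1 + 280 * m 3 ^ 3"
    using c(3) unfolding m_def by simp
qed

section \<open>The Halphen system of the theta constants\<close>

definition theta_pair :: "real \<Rightarrow> real \<Rightarrow> nat \<Rightarrow> nat \<Rightarrow> complex \<Rightarrow> complex \<Rightarrow> complex \<Rightarrow> complex" where
  "theta_pair \<gamma> \<delta> j k \<tau> x y = theta j \<gamma> (2 * \<tau>) (x + y) * theta k \<delta> (2 * \<tau>) (x - y)"

lemma theta_pair_deriv_x:
  assumes "Im \<tau> > 0"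
  shows "((\<lambda>x. theta_pair \<gamma> \<delta> j k \<tau> x y) has_field_derivative
     2 * of_real pi * \<i> * (theta_pair \<gamma> \<delta> (Suc j) k \<tau> x y + theta_pair \<gamma> \<delta> j (Suc k) \<tau> x y)) (at x)"
proof -
  have T: "Im (2 * \<tau>) > 0" using assms by simp
  have 1: "((\<lambda>x. x + y) has_field_derivative 1) (at x)" "((\<lambda>x. x - y) has_field_derivative 1) (at x)"
    by (auto intro!: derivative_eq_intros)
  from DERIV_mult[OF DERIV_chain2[OF theta_deriv_z[OF T] 1(1)] DERIV_chain2[OF theta_deriv_z[OF T] 1(2)]]
  show ?thesis unfolding theta_pair_def by (rule DERIV_cong) (simp add: algebra_simps)
qed

lemma theta_pair_deriv_y:
  assumes "Im \<tau> > 0"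
  shows "((\<lambda>y. theta_pair \<gamma> \<delta> j k \<tau> x y) has_field_derivative
     2 * of_real pi * \<i> * (theta_pair \<gamma> \<delta> (Suc j) k \<tau> x y - theta_pair \<gamma> \<delta> j (Suc k) \<tau> x y)) (at y)"
proof -
  have T: "Im (2 * \<tau>) > 0" using assms by simp
  have 1: "((\<lambda>y. x + y) has_field_derivative 1) (at y)" "((\<lambda>y. x - y) has_field_derivative - 1) (at y)"
    by (auto intro!: derivative_eq_intros)
  from DERIV_mult[OF DERIV_chain2[OF theta_deriv_z[OF T] 1(1)] DERIV_chain2[OF theta_deriv_z[OF T] 1(2)]]
  show ?thesis unfolding theta_pair_def by (rule DERIV_cong) (simp add: algebra_simps)
qed

text \<open>
  The product formula differentiated twice in \<open>x\<close> and twice in \<open>y\<close>: in terms of second derivatives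
  along \<open>x + y\<close> and \<open>x - y\<close> this is the square of the difference of the two.
\<close>
lemma theta_2_mult_theta_2:
  fixes \<alpha> \<beta> :: real
  assumes \<tau>: "Im \<tau> > 0"
  defines "F \<equiv> \<lambda>j k x y. theta_pair ((\<alpha> + \<beta>) / 2) ((\<alpha> - \<beta>) / 2) j k \<tau> x y +
      theta_pair ((\<alpha> + \<beta> + 1) / 2) ((\<alpha> - \<beta> + 1) / 2) j k \<tau> x y"
  shows "theta 2 \<alpha> \<tau> x * theta 2 \<beta> \<tau> y = F 4 0 x y - 2 * F 2 2 x y + F 0 4 x y"
proof -
  define c where "c = 2 * of_real pi * \<i>"
  have c: "c \<noteq> 0" by (simp add: c_def)
  have Fx: "((\<lambda>x. F j k x y) has_field_derivative c * (F (Suc j) k x y + F j (Suc k) x y)) (at x)" for j k x y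
    unfolding F_def c_def
    by (rule DERIV_cong[OF DERIV_add[OF theta_pair_deriv_x[OF \<tau>] theta_pair_deriv_x[OF \<tau>]]]) (simp add: algebra_simps)
  have Fy: "((\<lambda>y. F j k x y) has_field_derivative c * (F (Suc j) k x y - F j (Suc k) x y)) (at y)" for j k x y
    unfolding F_def c_def
    by (rule DERIV_cong[OF DERIV_add[OF theta_pair_deriv_y[OF \<tau>] theta_pair_deriv_y[OF \<tau>]]]) (simp add: algebra_simps)
  have Tx: "((\<lambda>x. theta j \<alpha> \<tau> x * theta k \<beta> \<tau> y) has_field_derivative c * (theta (Suc j) \<alpha> \<tau> x * theta k \<beta> \<tau> y)) (at x)" for j k x y
    by (rule DERIV_cong[OF DERIV_cmult_right[OF theta_deriv_z[OF \<tau>]]]) (simp add: c_def)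
  have Ty: "((\<lambda>y. theta j \<alpha> \<tau> x * theta k \<beta> \<tau> y) has_field_derivative c * (theta j \<alpha> \<tau> x * theta (Suc k) \<beta> \<tau> y)) (at y)" for j k x y
    by (rule DERIV_cong[OF DERIV_cmult[OF theta_deriv_z[OF \<tau>]]]) (simp add: c_def)
  have "theta 0 \<alpha> \<tau> x * theta 0 \<beta> \<tau> y = F 0 0 x y" for x y
    unfolding F_def theta_pair_def by (rule theta_mult_theta[OF \<tau>])
  hence "c * (theta (Suc 0) \<alpha> \<tau> x * theta 0 \<beta> \<tau> y) = c * (F (Suc 0) 0 x y + F 0 (Suc 0) x y)" for x y
    using DERIV_unique[OF Tx[of 0 0 y x]] Fx[of 0 0 y x] by simp
  hence "theta (Suc 0) \<alpha> \<tau> x * theta 0 \<beta> \<tau> y = F (Suc 0) 0 x y + F 0 (Suc 0) x y" for x y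
    using c by simp
  hence "c * (theta (Suc (Suc 0)) \<alpha> \<tau> x * theta 0 \<beta> \<tau> y) =
      c * (F (Suc (Suc 0)) 0 x y + F (Suc 0) (Suc 0) x y) + c * (F (Suc 0) (Suc 0) x y + F 0 (Suc (Suc 0)) x y)" for x y
    using DERIV_unique[OF Tx[of "Suc 0" 0 y x]] DERIV_add[OF Fx[of "Suc 0" 0 y x] Fx[of 0 "Suc 0" y x]] by simp
  hence "c * (theta (Suc (Suc 0)) \<alpha> \<tau> x * theta 0 \<beta> \<tau> y) =
      c * (F (Suc (Suc 0)) 0 x y + 2 * F (Suc 0) (Suc 0) x y + F 0 (Suc (Suc 0)) x y)" for x y
    by (simp add: algebra_simps)
  hence "theta 2 \<alpha> \<tau> x * theta 0 \<beta> \<tau> y = F 2 0 x y + 2 * F 1 1 x y + F 0 2 x y" for x y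
    using c by (simp add: numeral_2_eq_2)
  hence "c * (theta 2 \<alpha> \<tau> x * theta (Suc 0) \<beta> \<tau> y) =
      c * (F (Suc 2) 0 x y - F 2 (Suc 0) x y) + 2 * (c * (F (Suc 1) 1 x y - F 1 (Suc 1) x y)) + c * (F (Suc 0) 2 x y - F 0 (Suc 2) x y)" for x y
    using DERIV_unique[OF Ty[of 2 x 0 y]] DERIV_add[OF DERIV_add[OF Fy[of 2 0 x y] DERIV_cmult[OF Fy[of 1 1 x y], of 2]] Fy[of 0 2 x y]] by simp
  hence "c * (theta 2 \<alpha> \<tau> x * theta 1 \<beta> \<tau> y) = c * (F 3 0 x y + F 2 1 x y - F 1 2 x y - F 0 3 x y)" for x y
    by (simp add: algebra_simps eval_nat_numeral)
  hence "theta 2 \<alpha> \<tau> x * theta 1 \<beta> \<tau> y = F 3 0 x y + F 2 1 x y - F 1 2 x y - F 0 3 x y" for x y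
    using c by simp
  hence "c * (theta 2 \<alpha> \<tau> x * theta (Suc 1) \<beta> \<tau> y) =
      c * (F (Suc 3) 0 x y - F 3 (Suc 0) x y) + c * (F (Suc 2) 1 x y - F 2 (Suc 1) x y)
      - c * (F (Suc 1) 2 x y - F 1 (Suc 2) x y) - c * (F (Suc 0) 3 x y - F 0 (Suc 3) x y)" for x y
    using DERIV_unique[OF Ty[of 2 x 1 y]]
      DERIV_diff[OF DERIV_diff[OF DERIV_add[OF Fy[of 3 0 x y] Fy[of 2 1 x y]] Fy[of 1 2 x y]] Fy[of 0 3 x y]] by simp
  hence "c * (theta 2 \<alpha> \<tau> x * theta 2 \<beta> \<tau> y) = c * (F 4 0 x y - 2 * F 2 2 x y + F 0 4 x y)" for x y
    by (simp add: algebra_simps eval_nat_numeral)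
  thus ?thesis using c by simp
qed

lemma eventually_Im_pos: "Im \<tau> > 0 \<Longrightarrow> eventually (\<lambda>t. Im t > 0) (nhds \<tau>)"
  using eventually_nhds_in_open[of "{t. Im t > 0}" \<tau>]
  by (simp add: open_Collect_less continuous_on_Im continuous_on_id)

text \<open>
  Let \<open>h\<^sup>2\<close> be proportional to \<open>a b\<close>. Then \<open>D\<^sup>2 log (a b) = 2 D\<^sup>2 log h\<close>, and by the heat equation the
  relation between the second moments says that the latter is a multiple of \<open>(D a) (D b) / h\<^sup>2\<close>. So the sum of
  the logarithmic derivatives of \<open>a\<close> and \<open>b\<close> has derivative four times their product. The functions
  \<open>h\<close> occurring are theta constants at \<open>2 \<tau>\<close>, which explains why their derivatives carry an additional factor 2.
\<close>
lemma halphen_step: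
  fixes a b h :: "nat \<Rightarrow> complex \<Rightarrow> complex"
  assumes \<tau>: "Im \<tau> > 0" and \<kappa>: "\<kappa> \<noteq> 0"
    and a: "\<And>j t. Im t > 0 \<Longrightarrow> (a j has_field_derivative of_real pi * \<i> * a (j + 2) t) (at t)"
    and b: "\<And>j t. Im t > 0 \<Longrightarrow> (b j has_field_derivative of_real pi * \<i> * b (j + 2) t) (at t)"
    and h: "\<And>j t. Im t > 0 \<Longrightarrow> (h j has_field_derivative 2 * of_real pi * \<i> * h (j + 2) t) (at t)"
    and nz: "\<And>t. Im t > 0 \<Longrightarrow> a 0 t \<noteq> 0" "\<And>t. Im t > 0 \<Longrightarrow> b 0 t \<noteq> 0"
    and h2: "\<And>t. Im t > 0 \<Longrightarrow> \<kappa> * (h 0 t)\<^sup>2 = a 0 t * b 0 t"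
    and ab: "\<And>t. Im t > 0 \<Longrightarrow> a 2 t * b 2 t = 2 * \<kappa> * (h 0 t * h 4 t - (h 2 t)\<^sup>2)"
  shows "a 2 \<tau> / (2 * a 0 \<tau>) + b 2 \<tau> / (2 * b 0 \<tau>) = 2 * h 2 \<tau> / h 0 \<tau>" (is ?A)
    and "((\<lambda>t. a 2 t / (2 * a 0 t) + b 2 t / (2 * b 0 t)) has_field_derivative
      2 * of_real pi * \<i> * (4 * (a 2 \<tau> / (2 * a 0 \<tau>)) * (b 2 \<tau> / (2 * b 0 \<tau>)))) (at \<tau>)"
proof -
  note ev = eventually_Im_pos
  have h0: "h 0 t \<noteq> 0" if "Im t > 0" for t
    using h2[OF that] nz that by auto
  have log: "a 2 t / (2 * a 0 t) + b 2 t / (2 * b 0 t) = 2 * h 2 t / h 0 t" if t: "Im t > 0" for t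
  proof -
    have "((\<lambda>t. \<kappa> * (h 0 t)\<^sup>2) has_field_derivative \<kappa> * (2 * h 0 t * (2 * of_real pi * \<i> * h 2 t))) (at t)"
      using h[OF t, of 0] by (auto intro!: derivative_eq_intros simp: numeral_2_eq_2)
    moreover have "eventually (\<lambda>t. \<kappa> * (h 0 t)\<^sup>2 = a 0 t * b 0 t) (nhds t)"
      using ev[OF t] h2 by (auto elim: eventually_mono)
    ultimately have "((\<lambda>t. a 0 t * b 0 t) has_field_derivative \<kappa> * (2 * h 0 t * (2 * of_real pi * \<i> * h 2 t))) (at t)"
      by (subst (asm) DERIV_cong_ev[OF refl _ refl])
    from DERIV_unique[OF this DERIV_mult[OF a[OF t, of 0] b[OF t, of 0]]]
    have "(of_real pi * \<i>) * (4 * \<kappa> * h 0 t * h 2 t) = (of_real pi * \<i>) * (a 2 t * b 0 t + a 0 t * b 2 t)"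
      by (simp add: algebra_simps numeral_2_eq_2)
    hence *: "a 2 t * b 0 t + a 0 t * b 2 t = 4 * \<kappa> * h 0 t * h 2 t" by simp
    have "a 2 t / (2 * a 0 t) + b 2 t / (2 * b 0 t) = (a 2 t * b 0 t + a 0 t * b 2 t) / (2 * (a 0 t * b 0 t))"
      using nz[OF t] by (simp add: field_simps)
    also have "\<dots> = 2 * h 2 t / h 0 t"
      unfolding * h2[OF t, symmetric] using \<kappa> h0[OF t] by (simp add: field_simps power2_eq_square)
    finally show ?thesis .
  qed
  thus ?A using \<tau> by blast
  have "((\<lambda>t. 2 * h 2 t / h 0 t) has_field_derivative
     ((2 * (2 * of_real pi * \<i> * h 4 \<tau>)) * h 0 \<tau> - 2 * h 2 \<tau> * (2 * of_real pi * \<i> * h 2 \<tau>)) / (h 0 \<tau> * h 0 \<tau>)) (at \<tau>)"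
    using h[OF \<tau>, of 0, unfolded add_0] h[OF \<tau>, of 2] h0[OF \<tau>] by (intro DERIV_divide DERIV_cmult) auto
  also have "((2 * (2 * of_real pi * \<i> * h 4 \<tau>)) * h 0 \<tau> - 2 * h 2 \<tau> * (2 * of_real pi * \<i> * h 2 \<tau>)) / (h 0 \<tau> * h 0 \<tau>) =
     2 * of_real pi * \<i> * ((2 * \<kappa> * (h 0 \<tau> * h 4 \<tau> - (h 2 \<tau>)\<^sup>2)) / (\<kappa> * (h 0 \<tau>)\<^sup>2))"
    using \<kappa> h0[OF \<tau>] by (simp add: field_simps power2_eq_square)
  also have "\<dots> = 2 * of_real pi * \<i> * (4 * (a 2 \<tau> / (2 * a 0 \<tau>)) * (b 2 \<tau> / (2 * b 0 \<tau>)))"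
    unfolding ab[OF \<tau>, symmetric] h2[OF \<tau>] using nz[OF \<tau>] by (simp add: field_simps)
  finally have D: "((\<lambda>t. 2 * h 2 t / h 0 t) has_field_derivative
     2 * of_real pi * \<i> * (4 * (a 2 \<tau> / (2 * a 0 \<tau>)) * (b 2 \<tau> / (2 * b 0 \<tau>)))) (at \<tau>)" .
  moreover have "eventually (\<lambda>t. a 2 t / (2 * a 0 t) + b 2 t / (2 * b 0 t) = 2 * h 2 t / h 0 t) (nhds \<tau>)"
    using ev[OF \<tau>] log by (auto elim: eventually_mono)
  ultimately show "((\<lambda>t. a 2 t / (2 * a 0 t) + b 2 t / (2 * b 0 t)) has_field_derivative
      2 * of_real pi * \<i> * (4 * (a 2 \<tau> / (2 * a 0 \<tau>)) * (b 2 \<tau> / (2 * b 0 \<tau>)))) (at \<tau>)"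
    by (subst DERIV_cong_ev[OF refl _ refl])
qed

definition dlog2 :: "complex \<Rightarrow> complex" where "dlog2 \<tau> = theta 2 (1 / 2) \<tau> 0 / (2 * theta 0 (1 / 2) \<tau> 0)"
definition dlog3 :: "complex \<Rightarrow> complex" where "dlog3 \<tau> = theta 2 0 \<tau> 0 / (2 * theta 0 0 \<tau> 0)"
definition dlog4 :: "complex \<Rightarrow> complex" where "dlog4 \<tau> = theta 2 0 \<tau> (1 / 2) / (2 * theta 0 0 \<tau> (1 / 2))"

lemma theta_double_deriv:
  assumes "Im \<tau> > 0"
  shows "((\<lambda>t. theta j \<alpha> (2 * t) z) has_field_derivative 2 * of_real pi * \<i> * theta (j + 2) \<alpha> (2 * \<tau>) z) (at \<tau>)"
proof -
  have "Im (2 * \<tau>) > 0" using assms by simp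
  moreover have "((\<lambda>t. 2 * t) has_field_derivative 2) (at \<tau>)" by (auto intro!: derivative_eq_intros)
  ultimately show ?thesis
    by (intro DERIV_cong[OF DERIV_chain2[OF theta_deriv_tau]]) auto
qed

lemma theta_3_mult_theta_4:
  assumes \<tau>: "Im \<tau> > 0"
  shows "(theta 0 0 (2 * \<tau>) (1 / 2))\<^sup>2 = theta 0 0 \<tau> 0 * theta 0 0 \<tau> (1 / 2)"
    and "theta 2 0 \<tau> 0 * theta 2 0 \<tau> (1 / 2) = 2 * (theta 0 0 (2 * \<tau>) (1 / 2) * theta 4 0 (2 * \<tau>) (1 / 2) - (theta 2 0 (2 * \<tau>) (1 / 2))\<^sup>2)"
  using theta_mult_theta[OF \<tau>, of 0 0 0 "1 / 2"] theta_2_mult_theta_2[OF \<tau>, of 0 0 0 "1 / 2"]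
  by (simp_all add: theta_pair_def theta_0_minus_half[simplified] theta_1_even power2_eq_square)

lemma theta_2_mult_theta_3:
  assumes \<tau>: "Im \<tau> > 0"
  shows "2 * (theta 0 (1 / 4) (2 * \<tau>) 0)\<^sup>2 = theta 0 (1 / 2) \<tau> 0 * theta 0 0 \<tau> 0"
    and "theta 2 (1 / 2) \<tau> 0 * theta 2 0 \<tau> 0 = 2 * 2 * (theta 0 (1 / 4) (2 * \<tau>) 0 * theta 4 (1 / 4) (2 * \<tau>) 0 - (theta 2 (1 / 4) (2 * \<tau>) 0)\<^sup>2)"
  using theta_mult_theta[OF \<tau>, of "1 / 2" 0 0 0] theta_2_mult_theta_2[OF \<tau>, of "1 / 2" 0 0 0]
  by (simp_all add: theta_pair_def theta_three_quarters power2_eq_square)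

lemma halphen_34:
  assumes \<tau>: "Im \<tau> > 0"
  shows "dlog3 \<tau> + dlog4 \<tau> = 2 * theta 2 0 (2 * \<tau>) (1 / 2) / theta 0 0 (2 * \<tau>) (1 / 2)"
    and "((\<lambda>t. dlog3 t + dlog4 t) has_field_derivative 2 * of_real pi * \<i> * (4 * dlog3 \<tau> * dlog4 \<tau>)) (at \<tau>)"
  unfolding dlog3_def dlog4_def
  by (rule halphen_step[OF \<tau>, of 1 "\<lambda>j t. theta j 0 t 0" "\<lambda>j t. theta j 0 t (1 / 2)" "\<lambda>j t. theta j 0 (2 * t) (1 / 2)"];
      (erule theta_deriv_tau | erule theta_double_deriv | simp add: theta_3_nonzero theta_4_nonzero theta_3_mult_theta_4))+

lemma halphen_23:
  assumes \<tau>: "Im \<tau> > 0"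
  shows "((\<lambda>t. dlog2 t + dlog3 t) has_field_derivative 2 * of_real pi * \<i> * (4 * dlog2 \<tau> * dlog3 \<tau>)) (at \<tau>)"
  unfolding dlog2_def dlog3_def
  by (rule halphen_step[OF \<tau>, of 2 "\<lambda>j t. theta j (1 / 2) t 0" "\<lambda>j t. theta j 0 t 0" "\<lambda>j t. theta j (1 / 4) (2 * t) 0"];
      (erule theta_deriv_tau | erule theta_double_deriv | simp add: theta_2_nonzero theta_3_nonzero theta_2_mult_theta_3))

lemma dlog_add_1: "dlog2 (\<tau> + 1) = dlog2 \<tau>" "dlog3 (\<tau> + 1) = dlog4 \<tau>"
  by (simp_all add: dlog2_def dlog3_def dlog4_def theta_half_tau_add_1 theta_0_tau_add_1)

lemma halphen_24:
  assumes \<tau>: "Im \<tau> > 0"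
  shows "((\<lambda>t. dlog2 t + dlog4 t) has_field_derivative 2 * of_real pi * \<i> * (4 * dlog2 \<tau> * dlog4 \<tau>)) (at \<tau>)"
proof -
  have "((\<lambda>t. dlog2 t + dlog3 t) has_field_derivative 2 * of_real pi * \<i> * (4 * dlog2 (\<tau> + 1) * dlog3 (\<tau> + 1))) (at (\<tau> + 1))"
    using \<tau> by (intro halphen_23) simp
  thus ?thesis unfolding DERIV_shift dlog_add_1 .
qed

text \<open>
  Halphen's system, solved for the derivatives of the three functions.
\<close>
lemma halphen:
  assumes \<tau>: "Im \<tau> > 0"
  shows "(dlog2 has_field_derivative 2 * of_real pi * \<i> * (2 * (dlog2 \<tau> * dlog3 \<tau> + dlog2 \<tau> * dlog4 \<tau> - dlog3 \<tau> * dlog4 \<tau>))) (at \<tau>)"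
    and "(dlog3 has_field_derivative 2 * of_real pi * \<i> * (2 * (dlog2 \<tau> * dlog3 \<tau> + dlog3 \<tau> * dlog4 \<tau> - dlog2 \<tau> * dlog4 \<tau>))) (at \<tau>)"
    and "(dlog4 has_field_derivative 2 * of_real pi * \<i> * (2 * (dlog2 \<tau> * dlog4 \<tau> + dlog3 \<tau> * dlog4 \<tau> - dlog2 \<tau> * dlog3 \<tau>))) (at \<tau>)"
proof -
  note d = halphen_23[OF \<tau>] halphen_24[OF \<tau>] halphen_34(2)[OF \<tau>]
  have "((\<lambda>t. ((dlog2 t + dlog3 t) + (dlog2 t + dlog4 t) - (dlog3 t + dlog4 t)) / 2) has_field_derivative
     2 * of_real pi * \<i> * (2 * (dlog2 \<tau> * dlog3 \<tau> + dlog2 \<tau> * dlog4 \<tau> - dlog3 \<tau> * dlog4 \<tau>))) (at \<tau>)"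
    by (rule DERIV_cong[OF DERIV_cdivide[OF DERIV_diff[OF DERIV_add[OF d(1,2)] d(3)]]]) (simp add: field_simps)
  thus "(dlog2 has_field_derivative 2 * of_real pi * \<i> * (2 * (dlog2 \<tau> * dlog3 \<tau> + dlog2 \<tau> * dlog4 \<tau> - dlog3 \<tau> * dlog4 \<tau>))) (at \<tau>)" by simp
  have "((\<lambda>t. ((dlog2 t + dlog3 t) + (dlog3 t + dlog4 t) - (dlog2 t + dlog4 t)) / 2) has_field_derivative
     2 * of_real pi * \<i> * (2 * (dlog2 \<tau> * dlog3 \<tau> + dlog3 \<tau> * dlog4 \<tau> - dlog2 \<tau> * dlog4 \<tau>))) (at \<tau>)"
    by (rule DERIV_cong[OF DERIV_cdivide[OF DERIV_diff[OF DERIV_add[OF d(1,3)] d(2)]]]) (simp add: field_simps)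
  thus "(dlog3 has_field_derivative 2 * of_real pi * \<i> * (2 * (dlog2 \<tau> * dlog3 \<tau> + dlog3 \<tau> * dlog4 \<tau> - dlog2 \<tau> * dlog4 \<tau>))) (at \<tau>)" by simp
  have "((\<lambda>t. ((dlog2 t + dlog4 t) + (dlog3 t + dlog4 t) - (dlog2 t + dlog3 t)) / 2) has_field_derivative
     2 * of_real pi * \<i> * (2 * (dlog2 \<tau> * dlog4 \<tau> + dlog3 \<tau> * dlog4 \<tau> - dlog2 \<tau> * dlog3 \<tau>))) (at \<tau>)"
    by (rule DERIV_cong[OF DERIV_cdivide[OF DERIV_diff[OF DERIV_add[OF d(2,3)] d(1)]]]) (simp add: field_simps)
  thus "(dlog4 has_field_derivative 2 * of_real pi * \<i> * (2 * (dlog2 \<tau> * dlog4 \<tau> + dlog3 \<tau> * dlog4 \<tau> - dlog2 \<tau> * dlog3 \<tau>))) (at \<tau>)" by simp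
qed

text \<open>
  The duplication formula \<open>\<theta>\<^sub>1(\<tau>, z) \<theta>\<^sub>2(\<tau>, z) = \<theta>\<^sub>1(2 \<tau>, 2 z) \<theta>\<^sub>4(2 \<tau>, 0)\<close>; the second term of the
  product formula contains \<open>\<theta>\<^sub>1(2 \<tau>, 0) = 0\<close>.
\<close>
lemma theta_1_double:
  assumes \<tau>: "Im \<tau> > 0"
  shows "theta 0 (1 / 2) \<tau> (z + 1 / 2) * theta 0 (1 / 2) \<tau> z =
    theta 0 (1 / 2) (2 * \<tau>) (2 * z + 1 / 2) * theta 0 0 (2 * \<tau>) (1 / 2)"
proof -
  have "theta 0 (1 / 2) \<tau> (z + 1 / 2) * theta 0 (1 / 2) \<tau> z =
    theta 0 (1 / 2) (2 * \<tau>) (z + 1 / 2 + z) * theta 0 0 (2 * \<tau>) (1 / 2)"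
    using theta_mult_theta[OF \<tau>, of "1 / 2" "z + 1 / 2" "1 / 2" z] by (simp add: theta_1_even)
  also have "z + 1 / 2 + z = 2 * z + 1 / 2" by simp
  finally show ?thesis .
qed

text \<open>
  A logarithmic form of Jacobi's derivative formula \<open>\<theta>\<^sub>1'(0) = \<pi> \<theta>\<^sub>2(0) \<theta>\<^sub>3(0) \<theta>\<^sub>4(0)\<close>. The first and the third
  derivative in \<open>z\<close> of \<open>theta_1_double\<close> at \<open>z = 0\<close>, together with the derivative in \<open>\<tau>\<close> of the first
  one, allow the elimination of \<open>\<theta>\<^sub>1(2 \<tau>, z)\<close>.
\<close>
lemma theta_1_log_deriv:
  assumes \<tau>: "Im \<tau> > 0"
  shows "theta 3 (1 / 2) \<tau> (1 / 2) / (2 * theta 1 (1 / 2) \<tau> (1 / 2)) = dlog2 \<tau> + dlog3 \<tau> + dlog4 \<tau>"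
proof -
  define c where "c = 2 * of_real pi * \<i>"
  have c: "c \<noteq> 0" by (simp add: c_def)
  define p where "p = (\<lambda>j t z. theta j (1 / 2) t (z + 1 / 2))"
  define r where "r = (\<lambda>j t z. theta j (1 / 2) t z)"
  define R where "R = (\<lambda>j t z. theta j (1 / 2) (2 * t) (2 * z + 1 / 2))"
  define h where "h = (\<lambda>j t. theta j 0 (2 * t) (1 / 2))"
  have T: "Im (2 * t) > 0" if "Im t > 0" for t using that by simp
  have dp: "(p j t has_field_derivative c * p (Suc j) t z) (at z)" if "Im t > 0" for j t z
    unfolding p_def c_def by (rule DERIV_cong[OF DERIV_chain2[OF theta_deriv_z[OF that]]]) (auto intro!: derivative_eq_intros)
  have dr: "(r j t has_field_derivative c * r (Suc j) t z) (at z)" if "Im t > 0" for j t z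
    unfolding r_def c_def by (rule theta_deriv_z[OF that])
  have dR: "(R j t has_field_derivative 2 * (c * R (Suc j) t z)) (at z)" if "Im t > 0" for j t z
    unfolding R_def c_def by (rule DERIV_cong[OF DERIV_chain2[OF theta_deriv_z[OF T[OF that]]]]) (auto intro!: derivative_eq_intros)
  have 0: "p 0 t z * r 0 t z = R 0 t z * h 0 t" if "Im t > 0" for t z
    unfolding p_def r_def R_def h_def by (rule theta_1_double[OF that])
  have 1: "p 1 t z * r 0 t z + p 0 t z * r 1 t z = 2 * R 1 t z * h 0 t" if t: "Im t > 0" for t z
  proof -
    have "((\<lambda>z. p 0 t z * r 0 t z) has_field_derivative 2 * (c * R 1 t z) * h 0 t) (at z)"
      using DERIV_cmult_right[OF dR[OF t, of 0 z], of "h 0 t"] 0[OF t] by simp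
    from DERIV_unique[OF DERIV_mult[OF dp[OF t, of 0 z] dr[OF t, of 0 z]] this]
    have "c * (p 1 t z * r 0 t z + p 0 t z * r 1 t z) = c * (2 * R 1 t z * h 0 t)" by (simp add: algebra_simps)
    thus ?thesis using c by simp
  qed
  have 2: "p 2 t z * r 0 t z + 2 * p 1 t z * r 1 t z + p 0 t z * r 2 t z = 4 * R 2 t z * h 0 t" if t: "Im t > 0" for t z
  proof -
    have "((\<lambda>z. p 1 t z * r 0 t z + p 0 t z * r 1 t z) has_field_derivative 2 * (2 * (c * R 2 t z)) * h 0 t) (at z)"
      using DERIV_cmult_right[OF DERIV_cmult[OF dR[OF t, of 1 z], of 2], of "h 0 t"] 1[OF t] by (simp add: numeral_2_eq_2)
    from DERIV_unique[OF DERIV_add[OF DERIV_mult[OF dp[OF t, of 1 z] dr[OF t, of 0 z]] DERIV_mult[OF dp[OF t, of 0 z] dr[OF t, of 1 z]]] this]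
    have "c * (p 2 t z * r 0 t z + 2 * p 1 t z * r 1 t z + p 0 t z * r 2 t z) = c * (4 * R 2 t z * h 0 t)"
      by (simp add: algebra_simps numeral_2_eq_2)
    thus ?thesis using c by simp
  qed
  have 3: "p 3 t z * r 0 t z + 3 * p 2 t z * r 1 t z + 3 * p 1 t z * r 2 t z + p 0 t z * r 3 t z = 8 * R 3 t z * h 0 t" if t: "Im t > 0" for t z
  proof -
    have "((\<lambda>z. p 2 t z * r 0 t z + 2 * p 1 t z * r 1 t z + p 0 t z * r 2 t z) has_field_derivative 4 * (2 * (c * R 3 t z)) * h 0 t) (at z)"
      using DERIV_cmult_right[OF DERIV_cmult[OF dR[OF t, of 2 z], of 4], of "h 0 t"] 2[OF t] by (simp add: numeral_3_eq_3 numeral_2_eq_2)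
    from DERIV_unique[OF DERIV_add[OF DERIV_add[OF DERIV_mult[OF dp[OF t, of 2 z] dr[OF t, of 0 z]]
        DERIV_mult[OF DERIV_cmult[OF dp[OF t, of 1 z], of 2] dr[OF t, of 1 z]]] DERIV_mult[OF dp[OF t, of 0 z] dr[OF t, of 2 z]]] this]
    have "c * (p 3 t z * r 0 t z + 3 * p 2 t z * r 1 t z + 3 * p 1 t z * r 2 t z + p 0 t z * r 3 t z) = c * (8 * R 3 t z * h 0 t)"
      by (simp add: algebra_simps numeral_3_eq_3 numeral_2_eq_2)
    thus ?thesis using c by simp
  qed
  have z: "p 0 t 0 = 0" "p 2 t 0 = 0" "r 1 t 0 = 0" "r 3 t 0 = 0" for t
    unfolding p_def r_def by (simp_all add: theta_1_even theta_2_odd)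
  have first: "p 1 t 0 * r 0 t 0 = 2 * R 1 t 0 * h 0 t" if "Im t > 0" for t
    using 1[OF that, of 0] z by simp
  \<comment> \<open>By parity, two of the four terms vanish at \<open>z = 0\<close>.\<close>
  have third: "p 3 \<tau> 0 * r 0 \<tau> 0 + 3 * p 1 \<tau> 0 * r 2 \<tau> 0 = 8 * R 3 \<tau> 0 * h 0 \<tau>"
    using 3[OF \<tau>, of 0] z by simp
  have dt: "((\<lambda>t. p 1 t 0 * r 0 t 0) has_field_derivative
      of_real pi * \<i> * p 3 \<tau> 0 * r 0 \<tau> 0 + of_real pi * \<i> * r 2 \<tau> 0 * p 1 \<tau> 0) (at \<tau>)"
    unfolding p_def r_def
    using DERIV_mult[OF theta_deriv_tau[OF \<tau>, of 1 "1/2" "0 + 1/2"] theta_deriv_tau[OF \<tau>, of 0 "1/2" 0]] by (simp add: eval_nat_numeral)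
  have "((\<lambda>t. 2 * R 1 t 0 * h 0 t) has_field_derivative
      2 * (2 * of_real pi * \<i> * R 3 \<tau> 0) * h 0 \<tau> + 2 * of_real pi * \<i> * h 2 \<tau> * (2 * R 1 \<tau> 0)) (at \<tau>)"
    unfolding R_def h_def
    using DERIV_mult[OF DERIV_cmult[OF theta_double_deriv[OF \<tau>, of 1 "1/2" "2 * 0 + 1/2"], of 2] theta_double_deriv[OF \<tau>, of 0 0 "1/2"]] by (simp add: eval_nat_numeral)
  moreover have "eventually (\<lambda>t. 2 * R 1 t 0 * h 0 t = p 1 t 0 * r 0 t 0) (nhds \<tau>)"
    using eventually_Im_pos[OF \<tau>] by eventually_elim (rule first[symmetric])
  ultimately have "((\<lambda>t. p 1 t 0 * r 0 t 0) has_field_derivative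
      2 * (2 * of_real pi * \<i> * R 3 \<tau> 0) * h 0 \<tau> + 2 * of_real pi * \<i> * h 2 \<tau> * (2 * R 1 \<tau> 0)) (at \<tau>)"
    by (subst (asm) DERIV_cong_ev[OF refl _ refl])
  from DERIV_unique[OF dt this]
  have "(of_real pi * \<i>) * (p 3 \<tau> 0 * r 0 \<tau> 0 + p 1 \<tau> 0 * r 2 \<tau> 0) =
     (of_real pi * \<i>) * (4 * R 3 \<tau> 0 * h 0 \<tau> + 2 * h 2 \<tau> * (2 * R 1 \<tau> 0))"
    by (simp add: algebra_simps)
  hence "p 3 \<tau> 0 * r 0 \<tau> 0 + p 1 \<tau> 0 * r 2 \<tau> 0 = 4 * R 3 \<tau> 0 * h 0 \<tau> + 4 * h 2 \<tau> * R 1 \<tau> 0"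
    by simp
  hence "p 3 \<tau> 0 * r 0 \<tau> 0 - p 1 \<tau> 0 * r 2 \<tau> 0 = 8 * h 2 \<tau> * R 1 \<tau> 0"
    using third by algebra
  hence main: "(p 3 \<tau> 0 * r 0 \<tau> 0 - p 1 \<tau> 0 * r 2 \<tau> 0) * h 0 \<tau> = 4 * h 2 \<tau> * (p 1 \<tau> 0 * r 0 \<tau> 0)"
    using first[OF \<tau>] by algebra
  have nz: "p 1 \<tau> 0 \<noteq> 0" "r 0 \<tau> 0 \<noteq> 0" "h 0 \<tau> \<noteq> 0"
    using theta_1_deriv_nonzero[OF \<tau>] theta_2_nonzero[OF \<tau>] theta_4_nonzero[OF T[OF \<tau>]]
    by (auto simp: p_def r_def h_def)
  have "p 3 \<tau> 0 / (2 * p 1 \<tau> 0) - r 2 \<tau> 0 / (2 * r 0 \<tau> 0) = 2 * h 2 \<tau> / h 0 \<tau>"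
    using main nz by (simp add: field_simps)
  thus ?thesis
    using halphen_34(1)[OF \<tau>] by (simp add: p_def r_def h_def dlog2_def algebra_simps)
qed

section \<open>Eisenstein series in terms of theta constants\<close>

definition dlog_sum :: "complex \<Rightarrow> complex" where "dlog_sum \<tau> = dlog2 \<tau> + dlog3 \<tau> + dlog4 \<tau>"
definition dlog_pairs :: "complex \<Rightarrow> complex" where "dlog_pairs \<tau> = dlog2 \<tau> * dlog3 \<tau> + dlog2 \<tau> * dlog4 \<tau> + dlog3 \<tau> * dlog4 \<tau>"
definition dlog_prod :: "complex \<Rightarrow> complex" where "dlog_prod \<tau> = dlog2 \<tau> * dlog3 \<tau> * dlog4 \<tau>"

lemma dlog_sum_deriv:
  assumes \<tau>: "Im \<tau> > 0"
  shows "(dlog_sum has_field_derivative 2 * of_real pi * \<i> * (2 * dlog_pairs \<tau>)) (at \<tau>)"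
  unfolding dlog_sum_def[abs_def] dlog_pairs_def
  by (rule DERIV_cong[OF DERIV_add[OF DERIV_add[OF halphen(1)[OF \<tau>] halphen(2)[OF \<tau>]] halphen(3)[OF \<tau>]]])
    (simp add: algebra_simps)

lemma dlog_pairs_deriv:
  assumes \<tau>: "Im \<tau> > 0"
  shows "(dlog_pairs has_field_derivative 2 * of_real pi * \<i> * (12 * dlog_prod \<tau>)) (at \<tau>)"
  unfolding dlog_pairs_def[abs_def] dlog_prod_def
  by (rule DERIV_cong[OF DERIV_add[OF DERIV_add[OF DERIV_mult[OF halphen(1)[OF \<tau>] halphen(2)[OF \<tau>]]
        DERIV_mult[OF halphen(1)[OF \<tau>] halphen(3)[OF \<tau>]]] DERIV_mult[OF halphen(2)[OF \<tau>] halphen(3)[OF \<tau>]]]])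
    (simp add: algebra_simps)

text \<open>
  Start from \<open>theta_1_log_deriv\<close> and differentiate in \<open>\<tau>\<close>: by the heat equation each derivative of an odd
  moment is the next odd moment, and the Halphen system keeps the right-hand side polynomial.
\<close>
lemma theta_1_moments:
  assumes \<tau>: "Im \<tau> > 0"
  defines "m \<equiv> \<lambda>j t. theta j (1 / 2) t (1 / 2)"
  shows "m 3 \<tau> = 2 * dlog_sum \<tau> * m 1 \<tau>"
    and "m 5 \<tau> = (8 * dlog_pairs \<tau> + 4 * (dlog_sum \<tau>)\<^sup>2) * m 1 \<tau>"
    and "m 7 \<tau> = (192 * dlog_prod \<tau> + 48 * dlog_sum \<tau> * dlog_pairs \<tau> + 8 * dlog_sum \<tau> ^ 3) * m 1 \<tau>"
proof -
  have dm: "(m j has_field_derivative of_real pi * \<i> * m (j + 2) t) (at t)" if "Im t > 0" for j t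
    unfolding m_def by (rule theta_deriv_tau[OF that])
  have dm1: "(m 1 has_field_derivative of_real pi * \<i> * m 3 t) (at t)" if "Im t > 0" for t
    using dm[OF that, of 1] by (simp add: numeral_3_eq_3)
  have m3: "m 3 t = 2 * dlog_sum t * m 1 t" if t: "Im t > 0" for t
    using theta_1_log_deriv[OF t] theta_1_deriv_nonzero[OF t] by (simp add: m_def dlog_sum_def field_simps)
  thus "m 3 \<tau> = 2 * dlog_sum \<tau> * m 1 \<tau>" using \<tau> by blast
  have m5: "m 5 t = (8 * dlog_pairs t + 4 * (dlog_sum t)\<^sup>2) * m 1 t" if t: "Im t > 0" for t
  proof -
    have "((\<lambda>t. 2 * dlog_sum t * m 1 t) has_field_derivative
       2 * (2 * of_real pi * \<i> * (2 * dlog_pairs t)) * m 1 t + of_real pi * \<i> * m 3 t * (2 * dlog_sum t)) (at t)"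
      by (intro DERIV_mult DERIV_cmult dlog_sum_deriv dm1 t)
    moreover have "eventually (\<lambda>t. m 3 t = 2 * dlog_sum t * m 1 t) (nhds t)"
      using eventually_Im_pos[OF t] by eventually_elim (rule m3)
    ultimately have "(m 3 has_field_derivative
       2 * (2 * of_real pi * \<i> * (2 * dlog_pairs t)) * m 1 t + of_real pi * \<i> * m 3 t * (2 * dlog_sum t)) (at t)"
      by (subst DERIV_cong_ev[OF refl _ refl])
    from DERIV_unique[OF dm[OF t, of 3] this]
    have "of_real pi * \<i> * m 5 t = of_real pi * \<i> * (8 * dlog_pairs t * m 1 t + 2 * dlog_sum t * m 3 t)"
      by (simp add: algebra_simps)
    hence "m 5 t = 8 * dlog_pairs t * m 1 t + 2 * dlog_sum t * m 3 t" by simp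
    thus ?thesis unfolding m3[OF t] by (simp add: algebra_simps power2_eq_square)
  qed
  thus "m 5 \<tau> = (8 * dlog_pairs \<tau> + 4 * (dlog_sum \<tau>)\<^sup>2) * m 1 \<tau>" using \<tau> by blast
  have "((\<lambda>t. (8 * dlog_pairs t + 4 * (dlog_sum t)\<^sup>2) * m 1 t) has_field_derivative
       (8 * (2 * of_real pi * \<i> * (12 * dlog_prod \<tau>)) + 4 * (of_nat 2 * ((2 * of_real pi * \<i> * (2 * dlog_pairs \<tau>)) * dlog_sum \<tau> ^ (2 - Suc 0)))) * m 1 \<tau>
       + of_real pi * \<i> * m 3 \<tau> * (8 * dlog_pairs \<tau> + 4 * (dlog_sum \<tau>)\<^sup>2)) (at \<tau>)"
    by (intro DERIV_mult DERIV_add DERIV_cmult DERIV_power dlog_sum_deriv dlog_pairs_deriv dm1 \<tau>)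
  moreover have "eventually (\<lambda>t. m 5 t = (8 * dlog_pairs t + 4 * (dlog_sum t)\<^sup>2) * m 1 t) (nhds \<tau>)"
    using eventually_Im_pos[OF \<tau>] by eventually_elim (rule m5)
  ultimately have "(m 5 has_field_derivative
      (8 * (2 * of_real pi * \<i> * (12 * dlog_prod \<tau>)) + 4 * (of_nat 2 * ((2 * of_real pi * \<i> * (2 * dlog_pairs \<tau>)) * dlog_sum \<tau> ^ (2 - Suc 0)))) * m 1 \<tau>
       + of_real pi * \<i> * m 3 \<tau> * (8 * dlog_pairs \<tau> + 4 * (dlog_sum \<tau>)\<^sup>2)) (at \<tau>)"
    by (subst DERIV_cong_ev[OF refl _ refl])
  from DERIV_unique[OF dm[OF \<tau>, of 5] this]
  have "of_real pi * \<i> * m 7 \<tau> = of_real pi * \<i> * (2 * (96 * dlog_prod \<tau> + 16 * dlog_sum \<tau> * dlog_pairs \<tau>) * m 1 \<tau> + (8 * dlog_pairs \<tau> + 4 * (dlog_sum \<tau>)\<^sup>2) * m 3 \<tau>)"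
    by (simp add: algebra_simps)
  hence "m 7 \<tau> = 2 * (96 * dlog_prod \<tau> + 16 * dlog_sum \<tau> * dlog_pairs \<tau>) * m 1 \<tau> + (8 * dlog_pairs \<tau> + 4 * (dlog_sum \<tau>)\<^sup>2) * m 3 \<tau>"
    by simp
  thus "m 7 \<tau> = (192 * dlog_prod \<tau> + 48 * dlog_sum \<tau> * dlog_pairs \<tau> + 8 * dlog_sum \<tau> ^ 3) * m 1 \<tau>"
    unfolding m3[OF \<tau>] by (simp add: algebra_simps power2_eq_square power3_eq_cube)
qed

lemma eisenstein_dlog:
  assumes \<tau>: "Im \<tau> > 0"
  shows "G2 \<tau> = - dlog_sum \<tau> / 3"
    and "E4 \<tau> = 64 * (dlog_sum \<tau>)\<^sup>2 - 192 * dlog_pairs \<tau>"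
    and "E6 \<tau> = 512 * dlog_sum \<tau> ^ 3 - 2304 * dlog_sum \<tau> * dlog_pairs \<tau> + 6912 * dlog_prod \<tau>"
proof -
  define a where "a = theta 1 (1 / 2) \<tau> (1 / 2)"
  have a: "a \<noteq> 0" using theta_1_deriv_nonzero[OF \<tau>] by (simp add: a_def)
  note e = eisenstein_theta[OF \<tau>, unfolded theta_1_moments[OF \<tau>], folded a_def]
  have "a * (2 * dlog_sum \<tau>) = a * (- 6 * G2 \<tau>)"
    using e(1) by (simp add: mult_ac)
  hence "2 * dlog_sum \<tau> = - 6 * G2 \<tau>" using a by (metis mult_left_cancel)
  thus "G2 \<tau> = - dlog_sum \<tau> / 3" by (simp add: field_simps)
  have "a ^ 2 * E4 \<tau> = a ^ 2 * (64 * (dlog_sum \<tau>)\<^sup>2 - 192 * dlog_pairs \<tau>)"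
    unfolding e(2) by (simp add: algebra_simps power2_eq_square)
  thus "E4 \<tau> = 64 * (dlog_sum \<tau>)\<^sup>2 - 192 * dlog_pairs \<tau>" using a by simp
  have "a ^ 3 * E6 \<tau> = a ^ 3 * (512 * dlog_sum \<tau> ^ 3 - 2304 * dlog_sum \<tau> * dlog_pairs \<tau> + 6912 * dlog_prod \<tau>)"
    unfolding e(3) by (simp add: algebra_simps power2_eq_square power3_eq_cube)
  thus "E6 \<tau> = 512 * dlog_sum \<tau> ^ 3 - 2304 * dlog_sum \<tau> * dlog_pairs \<tau> + 6912 * dlog_prod \<tau>" using a by simp
qed

section \<open>The operators on combinations of theta products\<close>

text \<open>
  The even theta functions are numbered as usual, so that \<open>i\<close> ranges over \<open>{2, 3, 4}\<close>;
  \<open>theta_char_a i\<close> and \<open>theta_char_b i\<close> are the two parts of the characteristic of \<open>\<theta>\<^sub>i\<close>.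
\<close>
definition theta_char_a :: "nat \<Rightarrow> real" where "theta_char_a i = (if i = 2 then 1 / 2 else 0)"
definition theta_char_b :: "nat \<Rightarrow> complex" where "theta_char_b i = (if i = 4 then 1 / 2 else 0)"

definition theta_const :: "nat \<Rightarrow> complex \<Rightarrow> complex" where
  "theta_const i \<tau> = theta 0 (theta_char_a i) \<tau> (theta_char_b i)"

definition dlog :: "nat \<Rightarrow> complex \<Rightarrow> complex" where
  "dlog i \<tau> = theta 2 (theta_char_a i) \<tau> (theta_char_b i) / (2 * theta_const i \<tau>)"

definition even_theta_D8 :: "nat \<Rightarrow> complex \<Rightarrow> complex^8 \<Rightarrow> complex" where
  "even_theta_D8 i \<tau> z = (\<Prod>k\<in>UNIV. theta 0 (theta_char_a i) \<tau> (z $ k + theta_char_b i))"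

text \<open>
  Up to constants these are \<open>\<theta>\<^sub>i\<^sup>4 / \<eta>\<^sup>1\<^sup>2\<close>, because \<open>\<theta>\<^sub>2 \<theta>\<^sub>3 \<theta>\<^sub>4 = 2 \<eta>\<^sup>3\<close>.
\<close>
definition phi_coeff :: "nat \<Rightarrow> complex \<Rightarrow> complex" where
  "phi_coeff i \<tau> = (if i = 3 then 8 else - 8) *
     (theta_const i \<tau> / (theta_const 2 \<tau> * theta_const 3 \<tau> * theta_const 4 \<tau>)) ^ 4"

definition theta_comb :: "(nat \<Rightarrow> complex) \<Rightarrow> complex \<Rightarrow> complex^8 \<Rightarrow> complex" where
  "theta_comb r \<tau> z = (\<Sum>i\<in>{2, 3, 4}. r i * phi_coeff i \<tau> * even_theta_D8 i \<tau> z)"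

lemma dlog_simps: "dlog 2 = dlog2" "dlog 3 = dlog3" "dlog 4 = dlog4"
  by (auto simp: dlog_def dlog2_def dlog3_def dlog4_def theta_const_def theta_char_a_def theta_char_b_def)

lemma theta_const_nonzero:
  "Im \<tau> > 0 \<Longrightarrow> i \<in> {2, 3, 4} \<Longrightarrow> theta_const i \<tau> \<noteq> 0"
  using theta_2_nonzero theta_3_nonzero theta_4_nonzero
  by (auto simp: theta_const_def theta_char_a_def theta_char_b_def)

lemma theta_const_deriv:
  assumes "Im \<tau> > 0" "i \<in> {2, 3, 4}"
  shows "(theta_const i has_field_derivative 2 * of_real pi * \<i> * (dlog i \<tau> * theta_const i \<tau>)) (at \<tau>)"
  unfolding theta_const_def[abs_def]
  by (rule DERIV_cong[OF theta_deriv_tau[OF assms(1)]])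
    (use theta_const_nonzero[OF assms] in \<open>simp add: dlog_def theta_const_def numeral_2_eq_2\<close>)

lemma dlog_deriv:
  assumes \<tau>: "Im \<tau> > 0" and i: "i \<in> {2, 3, 4}"
  shows "(dlog i has_field_derivative 2 * of_real pi * \<i> * (4 * dlog i \<tau> * (dlog_sum \<tau> - dlog i \<tau>) - 2 * dlog_pairs \<tau>)) (at \<tau>)"
proof -
  consider "i = 2" | "i = 3" | "i = 4" using i by auto
  thus ?thesis
  proof cases
    case 1 show ?thesis unfolding 1 dlog_simps
      by (rule DERIV_cong[OF halphen(1)[OF \<tau>]]) (simp add: dlog_sum_def dlog_pairs_def algebra_simps)
  next
    case 2 show ?thesis unfolding 2 dlog_simps
      by (rule DERIV_cong[OF halphen(2)[OF \<tau>]]) (simp add: dlog_sum_def dlog_pairs_def algebra_simps)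
  next
    case 3 show ?thesis unfolding 3 dlog_simps
      by (rule DERIV_cong[OF halphen(3)[OF \<tau>]]) (simp add: dlog_sum_def dlog_pairs_def algebra_simps)
  qed
qed

lemma phi_coeff_deriv:
  assumes \<tau>: "Im \<tau> > 0" and i: "i \<in> {2, 3, 4}"
  shows "(phi_coeff i has_field_derivative 2 * of_real pi * \<i> * (4 * (dlog i \<tau> - dlog_sum \<tau>) * phi_coeff i \<tau>)) (at \<tau>)"
proof -
  define c where "c = 2 * of_real pi * \<i>"
  let ?N = "\<lambda>t. theta_const 2 t * theta_const 3 t * theta_const 4 t"
  have nz: "?N \<tau> \<noteq> 0" using theta_const_nonzero[OF \<tau>] by simp
  have "(?N has_field_derivative c * (dlog_sum \<tau> * ?N \<tau>)) (at \<tau>)"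
    by (rule DERIV_cong[OF DERIV_mult[OF DERIV_mult[OF theta_const_deriv[OF \<tau>] theta_const_deriv[OF \<tau>]] theta_const_deriv[OF \<tau>]]])
      (simp_all add: dlog_sum_def dlog_simps c_def algebra_simps)
  from DERIV_divide[OF theta_const_deriv[OF \<tau> i] this nz]
  have q: "((\<lambda>t. theta_const i t / ?N t) has_field_derivative c * ((dlog i \<tau> - dlog_sum \<tau>) * (theta_const i \<tau> / ?N \<tau>))) (at \<tau>)"
    by (rule DERIV_cong) (use nz in \<open>simp add: c_def field_simps\<close>)
  show ?thesis
    unfolding phi_coeff_def[abs_def]
    by (rule DERIV_cong[OF DERIV_cmult[OF DERIV_power[OF q]]])
      (simp add: c_def algebra_simps power4_eq_xxxx power3_eq_cube)
qed

definition even_theta_D8_deriv2 :: "nat \<Rightarrow> complex \<Rightarrow> complex^8 \<Rightarrow> 8 \<Rightarrow> complex" where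
  "even_theta_D8_deriv2 i \<tau> z k = theta 2 (theta_char_a i) \<tau> (z $ k + theta_char_b i) *
     (\<Prod>l\<in>UNIV - {k}. theta 0 (theta_char_a i) \<tau> (z $ l + theta_char_b i))"

lemma even_theta_D8_deriv_tau:
  assumes "Im \<tau> > 0"
  shows "((\<lambda>t. even_theta_D8 i t z) has_field_derivative of_real pi * \<i> * (\<Sum>k\<in>UNIV. even_theta_D8_deriv2 i \<tau> z k)) (at \<tau>)"
  unfolding even_theta_D8_def
  by (rule DERIV_cong[OF has_field_derivative_prod[OF theta_deriv_tau[OF assms]]])
    (simp add: even_theta_D8_deriv2_def sum_distrib_left mult_ac numeral_2_eq_2)

lemma partial2_theta_comb:
  assumes \<tau>: "Im \<tau> > 0"
  shows "partial2 k (theta_comb r \<tau>) z = (2 * of_real pi * \<i>) ^ 2 * (\<Sum>i\<in>{2, 3, 4}. r i * phi_coeff i \<tau> * even_theta_D8_deriv2 i \<tau> z k)"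
proof -
  define c where "c = 2 * of_real pi * \<i>"
  define Q where "Q = (\<lambda>i. \<Prod>l\<in>UNIV - {k}. theta 0 (theta_char_a i) \<tau> (z $ l + theta_char_b i))"
  define F where "F = (\<lambda>j w. \<Sum>i\<in>{2, 3, 4}. r i * phi_coeff i \<tau> * (theta j (theta_char_a i) \<tau> (w + theta_char_b i) * Q i))"
  have F0: "(\<lambda>w. theta_comb r \<tau> (\<chi> j. if j = k then w else z $ j)) = F 0"
  proof
    fix w
    have "even_theta_D8 i \<tau> (\<chi> j. if j = k then w else z $ j) = theta 0 (theta_char_a i) \<tau> (w + theta_char_b i) * Q i" for i
      unfolding even_theta_D8_def Q_def by (subst prod.remove[of UNIV k]) (auto intro!: prod.cong)
    thus "theta_comb r \<tau> (\<chi> j. if j = k then w else z $ j) = F 0 w"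
      unfolding theta_comb_def F_def by simp
  qed
  have d: "(F j has_field_derivative c * F (Suc j) w) (at w)" for j w
  proof -
    have "((\<lambda>w. theta j (theta_char_a i) \<tau> (w + theta_char_b i)) has_field_derivative c * theta (Suc j) (theta_char_a i) \<tau> (w + theta_char_b i)) (at w)" for i
      using theta_deriv_z[OF \<tau>, of j "theta_char_a i" "w + theta_char_b i"] unfolding DERIV_shift c_def .
    hence "(F j has_field_derivative (\<Sum>i\<in>{2, 3, 4}. r i * phi_coeff i \<tau> * (c * theta (Suc j) (theta_char_a i) \<tau> (w + theta_char_b i) * Q i))) (at w)"
      unfolding F_def by (intro DERIV_sum DERIV_cmult DERIV_cmult_right)
    thus ?thesis
      by (rule DERIV_cong) (simp add: F_def algebra_simps)
  qed
  have "deriv (F 0) = (\<lambda>w. c * F 1 w)"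
    using DERIV_imp_deriv[OF d] by auto
  moreover have "deriv (\<lambda>w. c * F 1 w) w = c * (c * F 2 w)" for w
    using DERIV_imp_deriv[OF DERIV_cmult[OF d[of 1 w], of c]] by (simp add: numeral_2_eq_2)
  ultimately have "(deriv ^^ 2) (F 0) (z $ k) = c ^ 2 * F 2 (z $ k)"
    by (simp add: numeral_2_eq_2)
  thus ?thesis
    unfolding partial2_def F0 by (simp add: F_def c_def even_theta_D8_deriv2_def Q_def)
qed

text \<open>
  The derivatives in \<open>z\<close> cancel against the part of the \<open>\<tau>\<close>-derivative that falls on the theta
  products. What remains acts on the coefficients; \<open>4 (dlog i - dlog_sum)\<close> is the logarithmic
  derivative of \<open>phi_coeff i\<close>, and \<open>G2\<close> is expressed through \<open>dlog_sum\<close>.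
\<close>
lemma H_theta_comb:
  assumes \<tau>: "Im \<tau> > 0"
    and f: "\<And>t w. Im t > 0 \<Longrightarrow> f t w = theta_comb (\<lambda>i. r i t) t w"
    and r: "\<And>i. i \<in> {2, 3, 4} \<Longrightarrow> (r i has_field_derivative 2 * of_real pi * \<i> * d i) (at \<tau>)"
  shows "H k f \<tau> z = theta_comb (\<lambda>i. d i + (4 * (dlog i \<tau> - dlog_sum \<tau>) + (8 - 2 * of_int k) / 3 * dlog_sum \<tau>) * r i \<tau>) \<tau> z"
proof -
  define c where "c = 2 * of_real pi * \<i>"
  have c: "c \<noteq> 0" and c2: "of_real pi ^ 2 = - (c ^ 2) / 4" by (simp_all add: c_def power_mult_distrib)
  let ?I = "{2, 3, 4} :: nat set"
  define S where "S = (\<lambda>i. \<Sum>k\<in>UNIV. even_theta_D8_deriv2 i \<tau> z k)"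
  define p where "p = (\<lambda>i. phi_coeff i \<tau>)"
  define T where "T = (\<lambda>i. even_theta_D8 i \<tau> z)"
  define V where "V = dlog_sum \<tau>"
  have "((\<lambda>t. \<Sum>i\<in>?I. r i t * phi_coeff i t * even_theta_D8 i t z) has_field_derivative
     (\<Sum>i\<in>?I. ((c * d i) * p i + (c * (4 * (dlog i \<tau> - V) * p i)) * r i \<tau>) * T i + (of_real pi * \<i> * S i) * (r i \<tau> * p i))) (at \<tau>)"
    unfolding p_def T_def S_def V_def c_def
    by (intro DERIV_sum DERIV_mult r phi_coeff_deriv even_theta_D8_deriv_tau \<tau>)
  hence "((\<lambda>t. theta_comb (\<lambda>i. r i t) t z) has_field_derivative
     c * (\<Sum>i\<in>?I. (d i + 4 * (dlog i \<tau> - V) * r i \<tau>) * p i * T i + r i \<tau> * p i * S i / 2)) (at \<tau>)"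
    unfolding theta_comb_def by (rule DERIV_cong) (simp add: c_def algebra_simps)
  moreover have "eventually (\<lambda>t. f t z = theta_comb (\<lambda>i. r i t) t z) (nhds \<tau>)"
    using eventually_Im_pos[OF \<tau>] by eventually_elim (rule f)
  ultimately have "((\<lambda>t. f t z) has_field_derivative
     c * (\<Sum>i\<in>?I. (d i + 4 * (dlog i \<tau> - V) * r i \<tau>) * p i * T i + r i \<tau> * p i * S i / 2)) (at \<tau>)"
    by (subst DERIV_cong_ev[OF refl _ refl])
  hence 1: "deriv (\<lambda>t. f t z) \<tau> = c * (\<Sum>i\<in>?I. (d i + 4 * (dlog i \<tau> - V) * r i \<tau>) * p i * T i + r i \<tau> * p i * S i / 2)"
    by (rule DERIV_imp_deriv)
  have "f \<tau> = theta_comb (\<lambda>i. r i \<tau>) \<tau>" using f[OF \<tau>] by auto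
  hence "(\<Sum>k\<in>UNIV. partial2 k (f \<tau>) z) = (\<Sum>k\<in>UNIV. c ^ 2 * (\<Sum>i\<in>?I. r i \<tau> * p i * even_theta_D8_deriv2 i \<tau> z k))"
    by (simp only: partial2_theta_comb[OF \<tau>] c_def p_def)
  also have "\<dots> = c ^ 2 * (\<Sum>i\<in>?I. r i \<tau> * p i * S i)"
    unfolding sum_distrib_left[symmetric] S_def by (subst sum.swap) (simp only: sum_distrib_left)
  finally have 2: "(\<Sum>k\<in>UNIV. partial2 k (f \<tau>) z) = c ^ 2 * (\<Sum>i\<in>?I. r i \<tau> * p i * S i)" .
  have 3: "f \<tau> z = (\<Sum>i\<in>?I. r i \<tau> * p i * T i)"
    using f[OF \<tau>] by (simp only: theta_comb_def p_def T_def)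
  have "1 / (8 * of_real pi ^ 2) * (c ^ 2 * X) = - X / 2" for X :: complex
    using c unfolding c2 by simp
  hence "H k f \<tau> z = (\<Sum>i\<in>?I. (d i + 4 * (dlog i \<tau> - V) * r i \<tau>) * p i * T i + r i \<tau> * p i * S i / 2)
     - (\<Sum>i\<in>?I. r i \<tau> * p i * S i) / 2 + (2 * of_int k - 8) * (- V / 3) * (\<Sum>i\<in>?I. r i \<tau> * p i * T i)"
    unfolding H_def 1 2 3 eisenstein_dlog(1)[OF \<tau>] c_def[symmetric] V_def using c by simp
  also have "\<dots> = theta_comb (\<lambda>i. d i + (4 * (dlog i \<tau> - V) + (8 - 2 * of_int k) / 3 * V) * r i \<tau>) \<tau> z"
    unfolding theta_comb_def p_def[symmetric] T_def[symmetric] by (simp add: p_def T_def field_simps)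
  finally show ?thesis unfolding V_def .
qed

text \<open>
  The coefficient that \<open>H 0\<close> produces from the constant coefficient 1.
\<close>
definition H0_coeff :: "nat \<Rightarrow> complex \<Rightarrow> complex" where
  "H0_coeff i \<tau> = 4 * dlog i \<tau> - 4 / 3 * dlog_sum \<tau>"

text \<open>
  Written with \<open>H0_coeff\<close>, the weight enters only through a multiple of \<open>dlog_sum\<close>, that is of \<open>E\<^sub>2\<close>, as in
  a Serre derivative.
\<close>
lemma H_theta_comb_coeff:
  assumes \<tau>: "Im \<tau> > 0"
    and f: "\<And>t w. Im t > 0 \<Longrightarrow> f t w = theta_comb (\<lambda>i. r i t) t w"
    and r: "\<And>i. i \<in> {2, 3, 4} \<Longrightarrow> (r i has_field_derivative 2 * of_real pi * \<i> * d i) (at \<tau>)"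
    and s: "\<And>i. i \<in> {2, 3, 4} \<Longrightarrow> d i + (H0_coeff i \<tau> - 2 / 3 * of_int k * dlog_sum \<tau>) * r i \<tau> = s i"
  shows "H k f \<tau> z = theta_comb s \<tau> z"
proof -
  have eq: "d i + (4 * (dlog i \<tau> - dlog_sum \<tau>) + (8 - 2 * of_int k) / 3 * dlog_sum \<tau>) * r i \<tau> = s i" if "i \<in> {2, 3, 4}" for i
    unfolding s[OF that, symmetric] H0_coeff_def by (simp add: field_simps)
  have "H k f \<tau> z = theta_comb (\<lambda>i. d i + (4 * (dlog i \<tau> - dlog_sum \<tau>) + (8 - 2 * of_int k) / 3 * dlog_sum \<tau>) * r i \<tau>) \<tau> z"
    by (rule H_theta_comb[OF \<tau> f r])
  also have "\<dots> = theta_comb s \<tau> z"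
    unfolding theta_comb_def by (rule sum.cong[OF refl]) (simp only: eq)
  finally show ?thesis .
qed

lemma theta_comb_cmult: "a * theta_comb r \<tau> z = theta_comb (\<lambda>i. a * r i) \<tau> z"
  by (simp add: theta_comb_def algebra_simps)

lemma theta_comb_add: "theta_comb r \<tau> z + theta_comb s \<tau> z = theta_comb (\<lambda>i. r i + s i) \<tau> z"
  by (simp add: theta_comb_def algebra_simps)

lemma theta_comb_diff: "theta_comb r \<tau> z - theta_comb s \<tau> z = theta_comb (\<lambda>i. r i - s i) \<tau> z"
  by (simp add: theta_comb_def algebra_simps)

section \<open>The theta expansion of the weak Jacobi form\<close>

lemma even_theta_D8_simps:
  "even_theta_D8 2 \<tau> z = (\<Prod>k\<in>UNIV. theta 0 (1 / 2) \<tau> (z $ k))"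
  "even_theta_D8 3 \<tau> z = (\<Prod>k\<in>UNIV. theta 0 0 \<tau> (z $ k))"
  "even_theta_D8 4 \<tau> z = (\<Prod>k\<in>UNIV. theta 0 0 \<tau> (z $ k + 1 / 2))"
  by (simp_all add: even_theta_D8_def theta_char_a_def theta_char_b_def)

lemma theta_const_simps:
  "theta_const 2 \<tau> = theta 0 (1 / 2) \<tau> 0"
  "theta_const 3 \<tau> = theta 0 0 \<tau> 0"
  "theta_const 4 \<tau> = theta 0 0 \<tau> (1 / 2)"
  by (simp_all add: theta_const_def theta_char_a_def theta_char_b_def)

text \<open>
  In the product formula for \<open>\<theta>\<^sub>1 \<theta>\<^sub>4\<close> the two summands have a common factor, a theta constant of
  characteristic \<open>1/4\<close>; the sum of the other factors is \<open>\<theta>\<^sub>1\<close> at \<open>\<tau>/2\<close>, split by the parity of the summation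
  index.
\<close>
lemma theta_1_half:
  assumes \<tau>: "Im \<tau> > 0"
  shows "theta 0 (1 / 2) (\<tau> / 2) (z + 1 / 2) * theta 0 (1 / 4) (2 * \<tau>) 0 =
    theta 0 (1 / 2) \<tau> (z + 1 / 2) * theta 0 0 \<tau> (z + 1 / 2)"
proof -
  have "theta 0 (1 / 2) \<tau> (z + 1 / 2) * theta 0 0 \<tau> (z + 1 / 2) =
     (theta 0 (1 / 4) (2 * \<tau>) (2 * (z + 1 / 2)) + theta 0 (3 / 4) (2 * \<tau>) (2 * (z + 1 / 2))) * theta 0 (1 / 4) (2 * \<tau>) 0"
    using theta_mult_theta[OF \<tau>, of "1 / 2" "z + 1 / 2" 0 "z + 1 / 2"] theta_three_quarters[of 0 "2 * \<tau>"]
    unfolding mult_2 by (simp add: algebra_simps)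
  thus ?thesis
    using theta_duplicate[OF \<tau>, of "1 / 4" "z + 1 / 2"] by simp
qed

lemma jacobi_theta_double:
  assumes \<tau>: "Im \<tau> > 0"
  shows "jacobi_theta (2 * \<tau>) (2 * z) * theta 0 0 (2 * \<tau>) (1 / 2) = jacobi_theta \<tau> z * theta 0 (1 / 2) \<tau> z"
  unfolding jacobi_theta_eq_theta using theta_1_double[OF \<tau>, of z] by (simp add: mult_ac)

lemma jacobi_theta_half:
  assumes \<tau>: "Im \<tau> > 0"
  shows "jacobi_theta (\<tau> / 2) z * theta 0 (1 / 4) (2 * \<tau>) 0 = jacobi_theta \<tau> z * theta 0 0 \<tau> (z + 1 / 2)"
  unfolding jacobi_theta_eq_theta using theta_1_half[OF \<tau>, of z] by (simp add: mult_ac)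

lemma jacobi_theta_half_shift:
  assumes \<tau>: "Im \<tau> > 0"
  shows "jacobi_theta ((\<tau> + 1) / 2) z * theta 0 (1 / 4) (2 * (\<tau> + 1)) 0 =
    exp (of_real pi * \<i> / 4) * (jacobi_theta \<tau> z * theta 0 0 \<tau> z)"
proof -
  have "theta 0 0 (\<tau> + 1) (z + 1 / 2) = theta 0 0 \<tau> z"
    using theta_add_1[of 0 0 \<tau> z] by (simp add: theta_0_tau_add_1 add.assoc)
  moreover have "jacobi_theta (\<tau> + 1) z = exp (of_real pi * \<i> / 4) * jacobi_theta \<tau> z"
    by (simp add: jacobi_theta_eq_theta theta_half_tau_add_1)
  moreover have "Im (\<tau> + 1) > 0" using \<tau> by simp
  ultimately show ?thesis using jacobi_theta_half[of "\<tau> + 1" z] by (simp add: mult_ac)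
qed

lemma exp_quarter_power: "exp (of_real pi * \<i> / 4) ^ 4 = -1" "exp (of_real pi * \<i> / 4) ^ 8 = 1"
proof -
  show "exp (of_real pi * \<i> / 4) ^ 4 = -1"
    by (subst exp_of_nat_mult[symmetric]) simp
  hence "(exp (of_real pi * \<i> / 4) ^ 4) ^ 2 = (-1 :: complex) ^ 2" by (rule arg_cong)
  thus "exp (of_real pi * \<i> / 4) ^ 8 = 1" by (simp add: power_mult[symmetric])
qed

text \<open>
  Each of the three terms is \<open>\<Theta>\<close> times a product of even theta functions, divided by the eighth
  power of a theta constant at \<open>2 \<tau>\<close> (or \<open>2 (\<tau> + 1)\<close>). The squares of these constants are, by the
  product formula again, products of two even theta constants at \<open>\<tau>\<close>; the eighth root of unity from
  \<open>\<tau> + 1\<close> leaves the minus sign of the middle term.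
\<close>
lemma Theta_D8_T2_eq:
  assumes \<tau>: "Im \<tau> > 0"
  shows "- Theta_D8_T2 \<tau> z = theta_comb (\<lambda>i. 1) \<tau> z * Theta_D8 \<tau> z"
proof -
  define t2 where "t2 = theta 0 (1 / 2) \<tau> 0"
  define t3 where "t3 = theta 0 0 \<tau> 0"
  define t4 where "t4 = theta 0 0 \<tau> (1 / 2)"
  have nz: "t2 \<noteq> 0" "t3 \<noteq> 0" "t4 \<noteq> 0"
    using theta_2_nonzero[OF \<tau>] theta_3_nonzero[OF \<tau>] theta_4_nonzero[OF \<tau>] by (auto simp: t2_def t3_def t4_def)
  have prod: "(\<Prod>k\<in>(UNIV :: 8 set). f k * c) = (\<Prod>k\<in>UNIV. f k) * c ^ 8" for f and c :: complex
    by (simp add: prod.distrib)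
  define h where "h = theta 0 0 (2 * \<tau>) (1 / 2)"
  have "h ^ 2 = t3 * t4"
    using theta_3_mult_theta_4(1)[OF \<tau>] by (simp add: h_def t3_def t4_def)
  hence "(h ^ 2) ^ 4 = (t3 * t4) ^ 4" by simp
  hence h8: "h ^ 8 = (t3 * t4) ^ 4" by (simp add: power_mult[symmetric])
  define A where "A = theta 0 (1 / 4) (2 * \<tau>) 0"
  have "2 * A ^ 2 = t2 * t3"
    using theta_2_mult_theta_3(1)[OF \<tau>] by (simp add: A_def t3_def t2_def)
  hence "(2 * A ^ 2) ^ 4 = (t2 * t3) ^ 4" by simp
  hence A8: "16 * A ^ 8 = (t2 * t3) ^ 4" by (simp add: power_mult_distrib power_mult[symmetric])
  define B where "B = theta 0 (1 / 4) (2 * (\<tau> + 1)) 0"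
  have "2 * B ^ 2 = theta 0 (1 / 2) (\<tau> + 1) 0 * theta 0 0 (\<tau> + 1) 0"
    using theta_2_mult_theta_3(1)[of "\<tau> + 1"] \<tau> by (simp add: B_def)
  also have "\<dots> = exp (of_real pi * \<i> / 4) * (t2 * t4)"
    by (simp add: theta_half_tau_add_1 theta_0_tau_add_1 t2_def t4_def)
  finally have "(2 * B ^ 2) ^ 4 = (exp (of_real pi * \<i> / 4) * (t2 * t4)) ^ 4" by simp
  also have "\<dots> = - ((t2 * t4) ^ 4)" unfolding power_mult_distrib exp_quarter_power by simp
  finally have B8: "16 * B ^ 8 = - ((t2 * t4) ^ 4)" by (simp add: power_mult_distrib power_mult[symmetric])
  have 1: "Theta_D8 (2 * \<tau>) (2 *s z) * h ^ 8 = Theta_D8 \<tau> z * even_theta_D8 2 \<tau> z"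
    unfolding Theta_D8_def even_theta_D8_simps prod[symmetric] h_def prod.distrib[symmetric]
    by (simp only: vector_smult_component jacobi_theta_double[OF \<tau>])
  have 2: "Theta_D8 (\<tau> / 2) z * A ^ 8 = Theta_D8 \<tau> z * even_theta_D8 4 \<tau> z"
    unfolding Theta_D8_def even_theta_D8_simps prod[symmetric] A_def prod.distrib[symmetric]
    by (simp only: jacobi_theta_half[OF \<tau>])
  have "Theta_D8 ((\<tau> + 1) / 2) z * B ^ 8 = (\<Prod>k\<in>UNIV. (jacobi_theta \<tau> (z $ k) * theta 0 0 \<tau> (z $ k)) * exp (of_real pi * \<i> / 4))"
    unfolding Theta_D8_def prod[of "\<lambda>k. jacobi_theta ((\<tau> + 1) / 2) (z $ k)", symmetric] B_def
    by (simp only: jacobi_theta_half_shift[OF \<tau>] mult.commute[of _ "exp (of_real pi * \<i> / 4)"])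
  also have "\<dots> = Theta_D8 \<tau> z * even_theta_D8 3 \<tau> z"
    unfolding prod exp_quarter_power Theta_D8_def even_theta_D8_simps by (simp add: prod.distrib)
  finally have 3: "Theta_D8 ((\<tau> + 1) / 2) z * B ^ 8 = Theta_D8 \<tau> z * even_theta_D8 3 \<tau> z" .
  have "h ^ 8 \<noteq> 0" "A ^ 8 \<noteq> 0" "B ^ 8 \<noteq> 0" using h8 A8 B8 nz by auto
  hence "Theta_D8 (2 * \<tau>) (2 *s z) = Theta_D8 \<tau> z * even_theta_D8 2 \<tau> z / h ^ 8"
    "Theta_D8 (\<tau> / 2) z = 16 * Theta_D8 \<tau> z * even_theta_D8 4 \<tau> z / (16 * A ^ 8)"
    "Theta_D8 ((\<tau> + 1) / 2) z = 16 * Theta_D8 \<tau> z * even_theta_D8 3 \<tau> z / (16 * B ^ 8)"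
    using 1 2 3 by (simp_all add: field_simps)
  hence "Theta_D8_T2 \<tau> z = 8 * Theta_D8 \<tau> z * (even_theta_D8 2 \<tau> z / (t3 * t4) ^ 4
      - even_theta_D8 3 \<tau> z / (t2 * t4) ^ 4 + even_theta_D8 4 \<tau> z / (t2 * t3) ^ 4)"
    unfolding Theta_D8_T2_def h8 A8 B8 by (simp add: algebra_simps)
  moreover have "phi_coeff 2 \<tau> = - 8 / (t3 * t4) ^ 4" "phi_coeff 3 \<tau> = 8 / (t2 * t4) ^ 4" "phi_coeff 4 \<tau> = - 8 / (t2 * t3) ^ 4"
    using nz unfolding phi_coeff_def theta_const_simps t2_def[symmetric] t3_def[symmetric] t4_def[symmetric]
    by (simp_all add: power_mult_distrib power_divide)
  ultimately show ?thesis
    by (simp add: theta_comb_def algebra_simps)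
qed

lemma isCont_phi_coeff:
  assumes "Im \<tau> > 0" "i \<in> {2, 3, 4}"
  shows "isCont (phi_coeff i) \<tau>"
  using phi_coeff_deriv[OF assms] by (rule DERIV_isCont)

lemma theta_comb_tendsto:
  assumes \<tau>: "Im \<tau> > 0"
  shows "((\<lambda>p. theta_comb (\<lambda>i. 1) (fst p) (snd p)) \<longlongrightarrow> theta_comb (\<lambda>i. 1) \<tau> z) (at (\<tau>, z) within S)"
proof -
  have fst: "((\<lambda>p. fst p) \<longlongrightarrow> \<tau>) (at (\<tau>, z) within S)" and snd: "((\<lambda>p. snd p) \<longlongrightarrow> z) (at (\<tau>, z) within S)"
    by (auto intro!: tendsto_eq_intros)
  have c: "((\<lambda>p. phi_coeff i (fst p)) \<longlongrightarrow> phi_coeff i \<tau>) (at (\<tau>, z) within S)" if "i \<in> {2, 3, 4}" for i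
    by (rule isCont_tendsto_compose[OF isCont_phi_coeff[OF \<tau> that] fst])
  have th: "((\<lambda>p. theta 0 \<alpha> (fst p) (snd p $ k + b)) \<longlongrightarrow> theta 0 \<alpha> \<tau> (z $ k + b)) (at (\<tau>, z) within S)" for \<alpha> b k
  proof -
    have "((\<lambda>p. (fst p, snd p $ k + b)) \<longlongrightarrow> (\<tau>, z $ k + b)) (at (\<tau>, z) within S)"
      by (intro tendsto_Pair fst tendsto_add tendsto_const tendsto_vec_nth snd)
    from isCont_tendsto_compose[OF isCont_theta[where j = 0 and \<alpha> = \<alpha> and z = "z $ k + b", OF \<tau>] this]
    show ?thesis by simp
  qed
  show ?thesis
    unfolding theta_comb_def even_theta_D8_def
    by (intro tendsto_sum tendsto_mult tendsto_const tendsto_prod c th)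
qed

lemma jacobi_theta_nonzero_near:
  assumes \<tau>: "Im \<tau> > 0" and e: "e > 0"
  obtains w where "w \<noteq> x" "dist w x < e" "jacobi_theta \<tau> w \<noteq> 0"
proof -
  have "(\<lambda>w. theta 0 (1 / 2) \<tau> (w + 1 / 2)) holomorphic_on UNIV"
    using theta_deriv_z[OF \<tau>, of 0 "1 / 2"] DERIV_shift
    by (auto simp: holomorphic_on_open) blast
  moreover have "theta 0 (1 / 2) \<tau> (- 1 / 2 + 1 / 2) \<noteq> 0" using theta_2_nonzero[OF \<tau>] by simp
  ultimately have "\<forall>\<^sub>F w in at x. theta 0 (1 / 2) \<tau> (w + 1 / 2) \<noteq> 0 \<and> w \<in> UNIV"
    by (intro non_zero_neighbour_alt[of _ UNIV x "- 1 / 2"]) auto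
  then obtain d where d: "d > 0" "\<And>w. w \<noteq> x \<Longrightarrow> dist w x < d \<Longrightarrow> theta 0 (1 / 2) \<tau> (w + 1 / 2) \<noteq> 0"
    unfolding eventually_at by auto
  define w where "w = x + of_real (min d e / 2)"
  have "dist w x = min d e / 2" using d(1) e by (simp add: w_def dist_norm)
  hence "w \<noteq> x" "dist w x < d" "dist w x < e" using d(1) e by auto
  thus ?thesis using that d(2) by (auto simp: jacobi_theta_eq_theta)
qed

text \<open>
  For fixed \<open>\<tau>\<close> the zeros of \<open>\<theta>\<^sub>1(\<tau>, \<cdot>)\<close> are isolated. So the coordinates of \<open>z\<close> can be moved
  slightly such that no factor vanishes, and the limit in the definition of \<open>phi_D8\<close> is taken along a
  proper filter.
\<close>
lemma theta_regular_islimpt: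
  assumes \<tau>: "Im \<tau> > 0"
  shows "(\<tau>, z) islimpt {(t, w). Im t > 0 \<and> Theta_D8 t w \<noteq> 0}"
  unfolding islimpt_approachable
proof (intro allI impI)
  fix e :: real assume e: "e > 0"
  have "\<forall>k. \<exists>w. w \<noteq> z $ k \<and> dist w (z $ k) < e / 8 \<and> jacobi_theta \<tau> w \<noteq> 0"
    using jacobi_theta_nonzero_near[OF \<tau>, of "e / 8"] e by (metis divide_pos_pos zero_less_numeral)
  then obtain f where f: "\<And>k. f k \<noteq> z $ k" "\<And>k. dist (f k) (z $ k) < e / 8" "\<And>k. jacobi_theta \<tau> (f k) \<noteq> 0"
    by metis
  define w :: "complex^8" where "w = (\<chi> k. f k)"
  have "dist w z \<le> (\<Sum>k\<in>UNIV. dist (w $ k) (z $ k))"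
    unfolding dist_vec_def by (rule L2_set_le_sum) simp
  also have "\<dots> < (\<Sum>k\<in>(UNIV :: 8 set). e / 8)"
    by (rule sum_strict_mono) (use f(2) in \<open>auto simp: w_def\<close>)
  finally have "dist w z < e" by simp
  moreover have "w \<noteq> z" using f(1) by (metis vec_lambda_beta w_def)
  moreover have "Theta_D8 \<tau> w \<noteq> 0" using f(3) by (simp add: Theta_D8_def w_def)
  ultimately show "\<exists>x'\<in>{(t, w). Im t > 0 \<and> Theta_D8 t w \<noteq> 0}. x' \<noteq> (\<tau>, z) \<and> dist x' (\<tau>, z) < e"
    using \<tau> by (intro bexI[of _ "(\<tau>, w)"]) (auto simp: dist_Pair_Pair)
qed

lemma phi_D8_eq:
  assumes \<tau>: "Im \<tau> > 0"
  shows "phi_D8 \<tau> z = theta_comb (\<lambda>i. 1) \<tau> z"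
proof -
  let ?S = "{(t, w). Im t > 0 \<and> Theta_D8 t w \<noteq> 0}"
  have "((\<lambda>(t, w). - (Theta_D8_T2 t w / Theta_D8 t w)) \<longlongrightarrow> theta_comb (\<lambda>i. 1) \<tau> z) (at (\<tau>, z) within ?S)"
  proof (rule Lim_transform_within[OF theta_comb_tendsto[OF \<tau>] zero_less_one])
    fix p assume "p \<in> ?S"
    thus "theta_comb (\<lambda>i. 1) (fst p) (snd p) = (case p of (t, w) \<Rightarrow> - (Theta_D8_T2 t w / Theta_D8 t w))"
      using Theta_D8_T2_eq[of "fst p" "snd p"]
      by (auto simp: minus_divide_left simp del: divide_minus_left)
  qed
  thus ?thesis
    unfolding phi_D8_def using theta_regular_islimpt[OF \<tau>]
    by (intro tendsto_Lim) (auto simp: trivial_limit_within)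
qed

section \<open>The modular differential equation\<close>

lemma dlog_prod_deriv:
  assumes \<tau>: "Im \<tau> > 0"
  shows "(dlog_prod has_field_derivative 2 * of_real pi * \<i> * (8 * dlog_sum \<tau> * dlog_prod \<tau> - 2 * (dlog_pairs \<tau>)\<^sup>2)) (at \<tau>)"
  unfolding dlog_prod_def[abs_def]
  by (rule DERIV_cong[OF DERIV_mult[OF DERIV_mult[OF halphen(1)[OF \<tau>] halphen(2)[OF \<tau>]] halphen(3)[OF \<tau>]]])
    (simp add: dlog_sum_def dlog_pairs_def algebra_simps power2_eq_square)

text \<open>
  Ramanujan's formula, where \<open>8 dlog_sum\<close> is \<open>E\<^sub>2 = - 24 G2\<close>.
\<close>
lemma E4_deriv:
  assumes \<tau>: "Im \<tau> > 0"
  shows "(E4 has_field_derivative 2 * of_real pi * \<i> * ((8 * dlog_sum \<tau> * E4 \<tau> - E6 \<tau>) / 3)) (at \<tau>)"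
proof -
  have "((\<lambda>t. 64 * (dlog_sum t)\<^sup>2 - 192 * dlog_pairs t) has_field_derivative
     2 * of_real pi * \<i> * ((8 * dlog_sum \<tau> * E4 \<tau> - E6 \<tau>) / 3)) (at \<tau>)"
    by (rule DERIV_cong[OF DERIV_diff[OF DERIV_cmult[OF DERIV_power[OF dlog_sum_deriv[OF \<tau>]]] DERIV_cmult[OF dlog_pairs_deriv[OF \<tau>]]]])
      (simp add: eisenstein_dlog[OF \<tau>] field_simps power2_eq_square power3_eq_cube)
  moreover have "eventually (\<lambda>t. E4 t = 64 * (dlog_sum t)\<^sup>2 - 192 * dlog_pairs t) (nhds \<tau>)"
    using eventually_Im_pos[OF \<tau>] by eventually_elim (rule eisenstein_dlog)
  ultimately show ?thesis by (subst DERIV_cong_ev[OF refl _ refl])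
qed

lemma E6_deriv:
  assumes \<tau>: "Im \<tau> > 0"
  shows "(E6 has_field_derivative 2 * of_real pi * \<i> * ((8 * dlog_sum \<tau> * E6 \<tau> - (E4 \<tau>)\<^sup>2) / 2)) (at \<tau>)"
proof -
  have "((\<lambda>t. 512 * dlog_sum t ^ 3 - 2304 * dlog_sum t * dlog_pairs t + 6912 * dlog_prod t) has_field_derivative
     2 * of_real pi * \<i> * ((8 * dlog_sum \<tau> * E6 \<tau> - (E4 \<tau>)\<^sup>2) / 2)) (at \<tau>)"
    by (rule DERIV_cong[OF DERIV_add[OF DERIV_diff[OF DERIV_cmult[OF DERIV_power[OF dlog_sum_deriv[OF \<tau>]]]
        DERIV_mult[OF DERIV_cmult[OF dlog_sum_deriv[OF \<tau>]] dlog_pairs_deriv[OF \<tau>]]] DERIV_cmult[OF dlog_prod_deriv[OF \<tau>]]]])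
      (simp add: eisenstein_dlog[OF \<tau>] field_simps power2_eq_square power3_eq_cube)
  moreover have "eventually (\<lambda>t. E6 t = 512 * dlog_sum t ^ 3 - 2304 * dlog_sum t * dlog_pairs t + 6912 * dlog_prod t) (nhds \<tau>)"
    using eventually_Im_pos[OF \<tau>] by eventually_elim (rule eisenstein_dlog)
  ultimately show ?thesis by (subst DERIV_cong_ev[OF refl _ refl])
qed

lemma H0_coeff_deriv:
  assumes \<tau>: "Im \<tau> > 0" and i: "i \<in> {2, 3, 4}"
  shows "(H0_coeff i has_field_derivative
    2 * of_real pi * \<i> * (E4 \<tau> / 18 - (H0_coeff i \<tau> - 4 / 3 * dlog_sum \<tau>) * H0_coeff i \<tau>)) (at \<tau>)"
  unfolding H0_coeff_def[abs_def]
  by (rule DERIV_cong[OF DERIV_diff[OF DERIV_cmult[OF dlog_deriv[OF assms]] DERIV_cmult[OF dlog_sum_deriv[OF \<tau>]]]])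
    (simp add: eisenstein_dlog(2)[OF \<tau>] field_simps power2_eq_square)

lemma H0_phi:
  assumes \<tau>: "Im \<tau> > 0"
  shows "H 0 phi_D8 \<tau> z = theta_comb (\<lambda>i. H0_coeff i \<tau>) \<tau> z"
  by (rule H_theta_comb_coeff[where r = "\<lambda>i t. 1" and d = "\<lambda>i. 0", OF \<tau>]) (auto simp: phi_D8_eq)

lemma H4_E4_phi:
  assumes \<tau>: "Im \<tau> > 0"
  shows "H 4 (\<lambda>t w. E4 t * phi_D8 t w) \<tau> z = theta_comb (\<lambda>i. E4 \<tau> * H0_coeff i \<tau> - E6 \<tau> / 3) \<tau> z"
  by (rule H_theta_comb_coeff[where r = "\<lambda>i. E4", OF \<tau> _ E4_deriv[OF \<tau>]])
    (auto simp: phi_D8_eq theta_comb_cmult field_simps)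

lemma H6_E6_phi:
  assumes \<tau>: "Im \<tau> > 0"
  shows "H 6 (\<lambda>t w. E6 t * phi_D8 t w) \<tau> z = theta_comb (\<lambda>i. E6 \<tau> * H0_coeff i \<tau> - (E4 \<tau>)\<^sup>2 / 2) \<tau> z"
  by (rule H_theta_comb_coeff[where r = "\<lambda>i. E6", OF \<tau> _ E6_deriv[OF \<tau>]])
    (auto simp: phi_D8_eq theta_comb_cmult field_simps)

text \<open>
  The heart of the equation: on coefficients it is the second-order equation satisfied by the fourth
  powers of all three theta constants.
\<close>
lemma H2_H0_phi:
  assumes \<tau>: "Im \<tau> > 0"
  shows "H 2 (H 0 phi_D8) \<tau> z = E4 \<tau> / 18 * phi_D8 \<tau> z"
proof -
  have "H 2 (H 0 phi_D8) \<tau> z = theta_comb (\<lambda>i. E4 \<tau> / 18) \<tau> z"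
    by (rule H_theta_comb_coeff[OF \<tau> H0_phi H0_coeff_deriv[OF \<tau>]]) auto
  thus ?thesis by (simp add: phi_D8_eq[OF \<tau>] theta_comb_cmult)
qed

lemma H4_H2_H0_phi:
  assumes \<tau>: "Im \<tau> > 0"
  shows "H 4 (H 2 (H 0 phi_D8)) \<tau> z = theta_comb (\<lambda>i. 1 / 18 * (E4 \<tau> * H0_coeff i \<tau> - E6 \<tau> / 3)) \<tau> z"
  by (rule H_theta_comb_coeff[where r = "\<lambda>i t. E4 t / 18" and d = "\<lambda>i. (8 * dlog_sum \<tau> * E4 \<tau> - E6 \<tau>) / 54", OF \<tau> _ DERIV_cdivide[OF E4_deriv[OF \<tau>], THEN DERIV_cong]])
    (auto simp: H2_H0_phi phi_D8_eq theta_comb_cmult field_simps)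

lemma H6_E4_H0_phi:
  assumes \<tau>: "Im \<tau> > 0"
  shows "H 6 (\<lambda>t w. E4 t * H 0 phi_D8 t w) \<tau> z = theta_comb (\<lambda>i. (E4 \<tau>)\<^sup>2 / 18 - E6 \<tau> * H0_coeff i \<tau> / 3) \<tau> z"
proof (rule H_theta_comb_coeff[OF \<tau>])
  show "E4 t * H 0 phi_D8 t w = theta_comb (\<lambda>i. E4 t * H0_coeff i t) t w" if "Im t > 0" for t w
    using H0_phi[OF that] by (simp add: theta_comb_cmult)
  fix i :: nat assume i: "i \<in> {2, 3, 4}"
  show "((\<lambda>t. E4 t * H0_coeff i t) has_field_derivative 2 * of_real pi * \<i> *
     ((8 * dlog_sum \<tau> * E4 \<tau> - E6 \<tau>) / 3 * H0_coeff i \<tau> +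
      (E4 \<tau> / 18 - (H0_coeff i \<tau> - 4 / 3 * dlog_sum \<tau>) * H0_coeff i \<tau>) * E4 \<tau>)) (at \<tau>)"
    by (rule DERIV_cong[OF DERIV_mult[OF E4_deriv[OF \<tau>] H0_coeff_deriv[OF \<tau> i]]]) (simp add: algebra_simps)
qed (simp add: field_simps power2_eq_square)

text \<open>
  Applies both to \<open>H 4\<close> of \<open>E4 \<phi>\<close> and to \<open>H 4 (H 2 (H 0 \<phi>))\<close>, which differ by the factor 18.
\<close>
lemma H6_theta_comb:
  assumes \<tau>: "Im \<tau> > 0"
    and f: "\<And>t w. Im t > 0 \<Longrightarrow> f t w = theta_comb (\<lambda>i. c * (E4 t * H0_coeff i t - E6 t / 3)) t w"
  shows "H 6 f \<tau> z = theta_comb (\<lambda>i. c * (2 / 9 * (E4 \<tau>)\<^sup>2 - 2 / 3 * E6 \<tau> * H0_coeff i \<tau>)) \<tau> z"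
proof (rule H_theta_comb_coeff[OF \<tau> f])
  fix i :: nat assume i: "i \<in> {2, 3, 4}"
  show "((\<lambda>t. c * (E4 t * H0_coeff i t - E6 t / 3)) has_field_derivative 2 * of_real pi * \<i> *
     (c * ((8 * dlog_sum \<tau> * E4 \<tau> - E6 \<tau>) / 3 * H0_coeff i \<tau> +
      (E4 \<tau> / 18 - (H0_coeff i \<tau> - 4 / 3 * dlog_sum \<tau>) * H0_coeff i \<tau>) * E4 \<tau>
      - (8 * dlog_sum \<tau> * E6 \<tau> - (E4 \<tau>)\<^sup>2) / 6))) (at \<tau>)"
    by (rule DERIV_cong[OF DERIV_cmult[OF DERIV_diff[OF DERIV_mult[OF E4_deriv[OF \<tau>] H0_coeff_deriv[OF \<tau> i]] DERIV_cdivide[OF E6_deriv[OF \<tau>]]]]])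
      (simp add: field_simps)
qed (simp_all add: field_simps power2_eq_square)

theorem mainTheorem3:
  fixes a1 a2 a3 a4 a5 :: complex and \<tau> :: complex and z :: "complex^8"
  assumes "Im \<tau> > 0"
  shows "a1 * (H 6 \<circ> H 4 \<circ> H 2 \<circ> H 0) phi_D8 \<tau> z
    + a2 * (H 6 \<circ> H 4) (\<lambda>t w. E4 t * phi_D8 t w) \<tau> z
    + a3 * H 6 (\<lambda>t w. E4 t * H 0 phi_D8 t w) \<tau> z
    + a4 * H 6 (\<lambda>t w. E6 t * phi_D8 t w) \<tau> z
    + a5 * E4 \<tau> * (H 2 \<circ> H 0) phi_D8 \<tau> z
    + 1 / 27 * (a1 + 18 * a2 + 9 * a3 - 27 * a4) * E6 \<tau> * H 0 phi_D8 \<tau> z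
    - 1 / 162 * (2 * a1 + 36 * a2 + 9 * a3 - 81 * a4 + 9 * a5) * (E4 \<tau>)^2 * phi_D8 \<tau> z = 0"
proof -
  have 1: "H 6 (H 4 (H 2 (H 0 phi_D8))) \<tau> z =
      theta_comb (\<lambda>i. 1 / 18 * (2 / 9 * (E4 \<tau>)\<^sup>2 - 2 / 3 * E6 \<tau> * H0_coeff i \<tau>)) \<tau> z"
    by (rule H6_theta_comb[OF assms H4_H2_H0_phi])
  have 2: "H 6 (H 4 (\<lambda>t w. E4 t * phi_D8 t w)) \<tau> z =
      theta_comb (\<lambda>i. 1 * (2 / 9 * (E4 \<tau>)\<^sup>2 - 2 / 3 * E6 \<tau> * H0_coeff i \<tau>)) \<tau> z"
    by (rule H6_theta_comb[OF assms]) (simp add: H4_E4_phi)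
  show ?thesis
    unfolding o_apply 1 2 H6_E4_H0_phi[OF assms] H6_E6_phi[OF assms] H2_H0_phi[OF assms] H0_phi[OF assms] phi_D8_eq[OF assms]
    by (simp only: theta_comb_cmult theta_comb_add theta_comb_diff) (simp add: theta_comb_def field_simps power2_eq_square)
qed

end
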